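(* Let $\nu>-\frac12$ and let $\mathbf{m}=\begin{pmatrix}a&b\\c&d\end{pmatrix}\in SL(2,\mathbb{R})$ with $b\neq0$. The operators $T_x^{\nu,\mathbf{m}}$ satisfy the following properties. 1) (Symmetry) For continuous even $f$ on $\mathbb{R}$ and $x,y\in\mathbb{R}$: $T_0^{\nu,\mathbf{m}}f=f$ and $T_x^{\nu,\mathbf{m}}f(y)=T_y^{\nu,\mathbf{m}}f(x)$. 2) (Linearity) $T_x^{\nu,\mathbf{m}}[\lambda f+g](y)=\lambda T_x^{\nu,\mathbf{m}}f(y)+T_x^{\nu,\mathbf{m}}g(y)$ for $f,g\in\mathcal{C}(\mathbb{R})$, $\lambda\in\mathbb{C}$. 3) (Compact support) Let $f\in\mathcal{C}(\mathbb{R})$, $r>0$ and $x\ge0$. If $f(y)=0$ for $y\ge r$, then $T_x^{\nu,\mathbf{m}}f(y)=0$ for all $y\ge 0$ with $|x-y|\ge r$. 4) (Product formula) For all $x,y,z\in\mathbb{R}$, $$T_x^{\nu,\mathbf{m}}\left[K_\nu^{\mathbf{m}}(\cdot,y)\right](z)=e^{-\frac{i}{2}\frac{a}{b}y^2}K_\nu^{\mathbf{m}}(x,y)K_\nu^{\mathbf{m}}(z,y).$$ 5) For all $x,y>0$ and $f\in\mathcal{C}(\mathbb{R})$, $$T_x^{\nu,\mathbf{m}}f(y)=\int_0^{+\infty}e^{-i\frac{d}{b}z^2}f(z)\,\mathcal{W}_\nu^{\mathbf{m}}(x,y,z)\,z^{2\nu+1}dz,\qquad \mathcal{W}_\nu^{\mathbf{m}}(x,y,z)=e^{\frac{i}{2}\frac{d}{b}(x^2+y^2+z^2)}\mathcal{W}_\nu(x,y,z).$$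 6) (Continuity) The operator $T_x^{\nu,\mathbf{m}}$ is continuous from $\mathcal{C}(\mathbb{R})$ into itself, from $\mathcal{E}_*(\mathbb{R})$ into itself, and from $\mathcal{L}_{p,\nu}$ into itself; more precisely, for all $p\in[1,+\infty]$, $f\in\mathcal{L}_{p,\nu}$ and $x\ge0$, the function $T_x^{\nu,\mathbf{m}}f$ is defined almost everywhere on $[0,+\infty[$, belongs to $\mathcal{L}_{p,\nu}$, and $$\|T_x^{\nu,\mathbf{m}}f\|_{p,\nu}\le\|f\|_{p,\nu}.$$ 7) (Commutativity) $T_x^{\nu,\mathbf{m}}\circ T_y^{\nu,\mathbf{m}}=T_y^{\nu,\mathbf{m}}\circ T_x^{\nu,\mathbf{m}}$ on $\mathcal{C}(\mathbb{R})$, and $\Delta_\nu^{\mathbf{m}}\circ T_x^{\nu,\mathbf{m}}=T_x^{\nu,\mathbf{m}}\circ\Delta_\nu^{\mathbf{m}}$ on $\mathcal{E}_*(\mathbb{R})$. 8) For $f\in\mathcal{L}_{1,\nu}$, $g\in\mathcal{C}_{*,b}(\mathbb{R})$ and $x\ge 0$, $$\int_0^{+\infty}\left[T_x^{\nu,\mathbf{m}}f(y)\right]\left[e^{-i\frac{d}{b}y^2}g(y)\right]y^{2\nu+1}dy=\int_0^{+\infty}\left[e^{-i\frac{d}{b}y^2}f(y)\right]\left[T_x^{\nu,\mathbf{m}}g(y)\right]y^{2\nu+1}dy.$$ 9) For all $f\in\mathcal{L}_{1,\nu}$, $x\ge0$ and $\lambda\in\mathbb{R}$, $$\mathcal{F}_\nu^{\mathbf{m}}\left[T_x^{\nu,\mathbf{m}^{-1}}f\right](\lambda)=e^{\frac{i}{2}\frac{d}{b}\lambda^2}K_\nu^{\mathbf{m}^{-1}}(x,\lambda)\,\mathcal{F}_\nu^{\mathbf{m}}f(\lambda).$$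 10) For all $p\in\,]1,2]$, $f\in\mathcal{L}_{p,\nu}$ and $x\ge0$, the identity $$\mathcal{F}_\nu^{\mathbf{m}}\left[T_x^{\nu,\mathbf{m}^{-1}}f\right](\lambda)=e^{\frac{i}{2}\frac{d}{b}\lambda^2}K_\nu^{\mathbf{m}^{-1}}(x,\lambda)\,\mathcal{F}_\nu^{\mathbf{m}}f(\lambda)$$ holds for almost every $\lambda$.
   Context: Function spaces: $\mathcal{C}(\mathbb{R})$ is the space of continuous complex functions on $\mathbb{R}$ with uniform convergence on compact sets; $\mathcal{E}_*(\mathbb{R})$ is the space of even $\mathcal{C}^\infty$ functions on $\mathbb{R}$ with uniform convergence on compacts of all derivatives; $\mathcal{C}_{*,b}(\mathbb{R})$ is the space of even bounded continuous functions on $\mathbb{R}$; $\mathcal{L}_{p,\nu}$ ($1\le p\le\infty$) is the Lebesgue space on $[0,+\infty[$ with norm $\|f\|_{p,\nu}=\left(\int_0^{+\infty}|f(y)|^py^{2\nu+1}dy\right)^{1/p}$ for $p<\infty$ and the essential sup norm for $p=\infty$. Bessel translation: for $f$ continuous, $$T_x^\nu f(y)=\frac{\Gamma(\nu+1)}{\sqrt\pi\,\Gamma(\nu+1/2)}\int_0^\pi f\left(\sqrt{x^2+y^2-2xy\cos\theta}\right)(\sin\theta)^{2\nu}d\theta .$$ It is even in each of $x,y$. For $x,y>0$ it equals $\int_0^{+\infty}f(z)\mathcal{W}_\nu(x,y,z)z^{2\nu+1}dz$, where $$\mathcal{W}_\nu(x,y,z)=\frac{2^{2\nu-1}\Gamma(\nu+1)}{\sqrt\pi\,\Gamma(\nu+1/2)}\frac{\Delta^{2\nu-1}}{(xyz)^{2\nu}}\mathbf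 1_{[|x-y|,x+y]}(z),\qquad \Delta=\tfrac14\sqrt{(x+y+z)(x+y-z)(x-y+z)(y+z-x)};$$ this kernel formula (and $T_0^\nu=\mathrm{id}$) defines $T_x^\nu$ on $\mathcal{L}_{p,\nu}$ for $x\geq 0$. Translation associated with $\mathbf{m}$: $T_x^{\nu,\mathbf{m}}f(y)=e^{\frac{i}{2}\frac{d}{b}(x^2+y^2)}T_x^\nu\left[s\mapsto e^{-\frac{i}{2}\frac{d}{b}s^2}f(s)\right](y)$. Differential operator: $\Delta_\nu^{\mathbf{m}}g(x)=g''(x)+\left(\frac{2\nu+1}{x}-2i\frac{d}{b}x\right)g'(x)-\left(\frac{d^2}{b^2}x^2+2i(\nu+1)\frac{d}{b}\right)g(x)$ (for even smooth $g$, $g'(x)/x$ is extended by continuity at $0$). Transform: $j_\nu(x)=\sum_{n\ge0}(-1)^n\frac{\Gamma(\nu+1)}{n!\,\Gamma(n+\nu+1)}\left(\frac x2\right)^{2n}$, $K_\nu^{\mathbf{m}}(x,y)=e^{\frac i2(\frac db x^2+\frac ab y^2)}j_\nu\left(\frac{xy}{b}\right)$, $c_\nu^{-1}=2^\nu\Gamma(\nu+1)$, and for $f\in\mathcal{L}_{1,\nu}$ $$\mathcal{F}_\nu^{\mathbf{m}}f(x)=\frac{c_\nu}{(ib)^{\nu+1}}\int_0^{+\infty}K_\nu^{\mathbf{m}}(x,y)f(y)y^{2\nu+1}dy$$ (with a fixed, say principal, branch of the power). For $1<p\le2$, $1/p+1/q=1$, $\mathcal{F}_\nu^{\mathbf{m}}$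 extends continuously from $\mathcal{L}_{1,\nu}\cap\mathcal{L}_{p,\nu}$ to a bounded operator $\mathcal{L}_{p,\nu}\to\mathcal{L}_{q,\nu}$ (Babenko inequality). Objects attached to $\mathbf{m}^{-1}=\begin{pmatrix}d&-b\\-c&a\end{pmatrix}$ are obtained by replacing $(a,b,c,d)$ with $(d,-b,-c,a)$; e.g. $T_x^{\nu,\mathbf{m}^{-1}}f(y)=e^{-\frac i2\frac ab(x^2+y^2)}T_x^\nu\left[e^{\frac i2\frac ab s^2}f(s)\right](y)$ and $K_\nu^{\mathbf{m}^{-1}}(x,y)=e^{-\frac i2(\frac ab x^2+\frac db y^2)}j_\nu\left(\frac{xy}{b}\right)$. *)

theory Defs
  imports "HOL-Analysis.Analysis" "HOL-Probability.Essential_Supremum"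
begin

definition cont_functions :: "(real \<Rightarrow> complex) set" where
  "cont_functions = {f. continuous_on UNIV f}"

definition even_function :: "(real \<Rightarrow> complex) \<Rightarrow> bool" where
  "even_function f \<longleftrightarrow> (\<forall>t. f (- t) = f t)"

text \<open>On a compact set the supremum of a continuous function is attained, so the sets below are
  the open balls of the seminorms (sup of the modulus over \<open>K\<close>); they generate the topology of
  uniform convergence on compact sets.\<close>

definition cont_topology :: "(real \<Rightarrow> complex) topology" where
  "cont_topology = topology_generated_by
     {{g \<in> cont_functions. \<forall>t\<in>K. dist (g t) (f t) < e} |f K e.
        f \<in> cont_functions \<and> compact K \<and> e > 0}"

definition iter_deriv :: "nat \<Rightarrow> (real \<Rightarrow> complex) \<Rightarrow> real \<Rightarrow> complex" where
  "iter_deriv k f = ((\<lambda>g t. vector_derivative g (at t)) ^^ k) f"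

definition even_smooth_functions :: "(real \<Rightarrow> complex) set" where
  "even_smooth_functions =
     {f. even_function f \<and> (\<forall>k. iter_deriv k f differentiable_on UNIV)}"

definition even_smooth_topology :: "(real \<Rightarrow> complex) topology" where
  "even_smooth_topology = topology_generated_by
     {{g \<in> even_smooth_functions. \<forall>t\<in>K. dist (iter_deriv k g t) (iter_deriv k f t) < e} |f K k e.
        f \<in> even_smooth_functions \<and> compact K \<and> e > 0}"

definition even_bounded_cont_functions :: "(real \<Rightarrow> complex) set" where
  "even_bounded_cont_functions =
     {f. even_function f \<and> continuous_on UNIV f \<and> bounded (range f)}"

text \<open>The measure \<open>y powr (2 * \<nu> + 1) dy\<close> on the half-line \<open>[0, \<infinity>)\<close>. For \<open>\<nu> > -1/2\<close> it has the same null sets as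
  Lebesgue measure on the half-line.\<close>

definition bessel_measure :: "real \<Rightarrow> real measure" where
  "bessel_measure \<nu> = density (lebesgue_on {0..}) (\<lambda>y. ennreal (y powr (2 * \<nu> + 1)))"

text \<open>Elements of the Lebesgue spaces are represented by functions on the whole real line whose
  values on the negative half-line are irrelevant; functions equal almost everywhere are not
  identified.\<close>

definition Lp_functions :: "real \<Rightarrow> ennreal \<Rightarrow> (real \<Rightarrow> complex) set" where
  "Lp_functions \<nu> p =
     {f \<in> borel_measurable (bessel_measure \<nu>).
        if p = \<infinity> then esssup (bessel_measure \<nu>) (\<lambda>y. ennreal (norm (f y))) < \<infinity>
        else integrable (bessel_measure \<nu>) (\<lambda>y. norm (f y) powr enn2real p)}"

definition Lp_norm :: "real \<Rightarrow> ennreal \<Rightarrow> (real \<Rightarrow> complex) \<Rightarrow> real" where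
  "Lp_norm \<nu> p f =
     (if p = \<infinity> then enn2real (esssup (bessel_measure \<nu>) (\<lambda>y. ennreal (norm (f y))))
      else (LINT y|bessel_measure \<nu>. norm (f y) powr enn2real p) powr (1 / enn2real p))"

definition bessel_const :: "real \<Rightarrow> real" where
  "bessel_const \<nu> = Gamma (\<nu> + 1) / (sqrt pi * Gamma (\<nu> + 1 / 2))"

definition bessel_translation :: "real \<Rightarrow> real \<Rightarrow> (real \<Rightarrow> complex) \<Rightarrow> real \<Rightarrow> complex" where
  "bessel_translation \<nu> x f y = complex_of_real (bessel_const \<nu>) *
     (LINT \<theta>:{0..pi}|lborel.
        f (sqrt (x\<^sup>2 + y\<^sup>2 - 2 * x * y * cos \<theta>)) * complex_of_real (sin \<theta> powr (2 * \<nu>)))"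

definition triangle_area :: "real \<Rightarrow> real \<Rightarrow> real \<Rightarrow> real" where
  "triangle_area x y z = 1 / 4 * sqrt ((x + y + z) * (x + y - z) * (x - y + z) * (y + z - x))"

definition bessel_kernel :: "real \<Rightarrow> real \<Rightarrow> real \<Rightarrow> real \<Rightarrow> real" where
  "bessel_kernel \<nu> x y z =
     2 powr (2 * \<nu> - 1) * Gamma (\<nu> + 1) / (sqrt pi * Gamma (\<nu> + 1 / 2)) *
     (triangle_area x y z powr (2 * \<nu> - 1) / (x * y * z) powr (2 * \<nu>)) *
     indicator {\<bar>x - y\<bar>..x + y} z"

text \<open>The translation on the Lebesgue spaces, for \<open>x \<ge> 0\<close>. It is meaningful only at the points
  singled out by the predicate that follows it; elsewhere its value is arbitrary.\<close>

definition bessel_translation_Lp :: "real \<Rightarrow> real \<Rightarrow> (real \<Rightarrow> complex) \<Rightarrow> real \<Rightarrow> complex" where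
  "bessel_translation_Lp \<nu> x f y =
     (if x = 0 then f y
      else (LINT z|bessel_measure \<nu>. f z * complex_of_real (bessel_kernel \<nu> x y z)))"

definition bessel_translation_Lp_defined_at ::
    "real \<Rightarrow> real \<Rightarrow> (real \<Rightarrow> complex) \<Rightarrow> real \<Rightarrow> bool" where
  "bessel_translation_Lp_defined_at \<nu> x f y \<longleftrightarrow>
     x = 0 \<or>
     (y > 0 \<and> integrable (bessel_measure \<nu>) (\<lambda>z. f z * complex_of_real (bessel_kernel \<nu> x y z)))"

text \<open>The entries of \<open>m\<close> are \<open>a = m $ 1 $ 1\<close>, \<open>b = m $ 1 $ 2\<close>, \<open>c = m $ 2 $ 1\<close>, \<open>d = m $ 2 $ 2\<close>.\<close>

definition lct_translation ::
    "real \<Rightarrow> real^2^2 \<Rightarrow> real \<Rightarrow> (real \<Rightarrow> complex) \<Rightarrow> real \<Rightarrow> complex" where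
  "lct_translation \<nu> m x f y =
     exp (\<i> / 2 * complex_of_real (m $ 2 $ 2 / m $ 1 $ 2 * (x\<^sup>2 + y\<^sup>2))) *
     bessel_translation \<nu> x
       (\<lambda>s. exp (- (\<i> / 2) * complex_of_real (m $ 2 $ 2 / m $ 1 $ 2 * s\<^sup>2)) * f s) y"

definition lct_translation_Lp ::
    "real \<Rightarrow> real^2^2 \<Rightarrow> real \<Rightarrow> (real \<Rightarrow> complex) \<Rightarrow> real \<Rightarrow> complex" where
  "lct_translation_Lp \<nu> m x f y =
     exp (\<i> / 2 * complex_of_real (m $ 2 $ 2 / m $ 1 $ 2 * (x\<^sup>2 + y\<^sup>2))) *
     bessel_translation_Lp \<nu> x
       (\<lambda>s. exp (- (\<i> / 2) * complex_of_real (m $ 2 $ 2 / m $ 1 $ 2 * s\<^sup>2)) * f s) y"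

definition lct_translation_Lp_defined_at ::
    "real \<Rightarrow> real^2^2 \<Rightarrow> real \<Rightarrow> (real \<Rightarrow> complex) \<Rightarrow> real \<Rightarrow> bool" where
  "lct_translation_Lp_defined_at \<nu> m x f y \<longleftrightarrow>
     bessel_translation_Lp_defined_at \<nu> x
       (\<lambda>s. exp (- (\<i> / 2) * complex_of_real (m $ 2 $ 2 / m $ 1 $ 2 * s\<^sup>2)) * f s) y"

definition lct_translation_kernel ::
    "real \<Rightarrow> real^2^2 \<Rightarrow> real \<Rightarrow> real \<Rightarrow> real \<Rightarrow> complex" where
  "lct_translation_kernel \<nu> m x y z =
     exp (\<i> / 2 * complex_of_real (m $ 2 $ 2 / m $ 1 $ 2 * (x\<^sup>2 + y\<^sup>2 + z\<^sup>2))) *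
     complex_of_real (bessel_kernel \<nu> x y z)"

text \<open>The quotient \<open>g'(x) / x\<close>, extended by continuity to \<open>x = 0\<close>.\<close>

definition deriv_quotient :: "(real \<Rightarrow> complex) \<Rightarrow> real \<Rightarrow> complex" where
  "deriv_quotient g x =
     (if x = 0 then Lim (at 0) (\<lambda>t. iter_deriv 1 g t / complex_of_real t)
      else iter_deriv 1 g x / complex_of_real x)"

definition lct_operator :: "real \<Rightarrow> real^2^2 \<Rightarrow> (real \<Rightarrow> complex) \<Rightarrow> real \<Rightarrow> complex" where
  "lct_operator \<nu> m g x =
     iter_deriv 2 g x
     + (complex_of_real (2 * \<nu> + 1) * deriv_quotient g x
        - 2 * \<i> * complex_of_real (m $ 2 $ 2 / m $ 1 $ 2 * x) * iter_deriv 1 g x)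
     - (complex_of_real ((m $ 2 $ 2)\<^sup>2 / (m $ 1 $ 2)\<^sup>2 * x\<^sup>2)
        + 2 * \<i> * complex_of_real ((\<nu> + 1) * (m $ 2 $ 2 / m $ 1 $ 2))) * g x"

definition normalized_bessel :: "real \<Rightarrow> real \<Rightarrow> real" where
  "normalized_bessel \<nu> x =
     (\<Sum>n. (-1) ^ n * (Gamma (\<nu> + 1) / (fact n * Gamma (real n + \<nu> + 1))) * (x / 2) ^ (2 * n))"

definition lct_kernel :: "real \<Rightarrow> real^2^2 \<Rightarrow> real \<Rightarrow> real \<Rightarrow> complex" where
  "lct_kernel \<nu> m x y =
     exp (\<i> / 2 * complex_of_real (m $ 2 $ 2 / m $ 1 $ 2 * x\<^sup>2 + m $ 1 $ 1 / m $ 1 $ 2 * y\<^sup>2)) *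
     complex_of_real (normalized_bessel \<nu> (x * y / m $ 1 $ 2))"

text \<open>The power of \<open>\<i> b\<close> is taken with the principal branch.\<close>

definition lct_transform :: "real \<Rightarrow> real^2^2 \<Rightarrow> (real \<Rightarrow> complex) \<Rightarrow> real \<Rightarrow> complex" where
  "lct_transform \<nu> m f x =
     complex_of_real (1 / (2 powr \<nu> * Gamma (\<nu> + 1))) /
       (\<i> * complex_of_real (m $ 1 $ 2)) powr complex_of_real (\<nu> + 1) *
     (LINT y|bessel_measure \<nu>. lct_kernel \<nu> m x y * f y)"

text \<open>\<open>F\<close> is a bounded linear operator from \<open>L\<^sub>p\<close> to \<open>L\<^sub>q\<close> (acting on representatives) extending the
  integral transform from \<open>L\<^sub>1 \<inter> L\<^sub>p\<close>. As \<open>L\<^sub>1 \<inter> L\<^sub>p\<close> is dense, this determines \<open>F f\<close> up to equality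
  almost everywhere; for \<open>1 < p \<le> 2\<close> and \<open>1/p + 1/q = 1\<close> the existence of such an \<open>F\<close> is Babenko's
  inequality.\<close>

definition lct_transform_extension ::
    "real \<Rightarrow> real^2^2 \<Rightarrow> real \<Rightarrow> real \<Rightarrow> ((real \<Rightarrow> complex) \<Rightarrow> real \<Rightarrow> complex) \<Rightarrow> bool" where
  "lct_transform_extension \<nu> m p q F \<longleftrightarrow>
     (\<forall>f \<in> Lp_functions \<nu> (ennreal p). F f \<in> Lp_functions \<nu> (ennreal q)) \<and>
     (\<forall>f \<in> Lp_functions \<nu> (ennreal p). \<forall>g \<in> Lp_functions \<nu> (ennreal p). \<forall>\<alpha>.
        AE t in lebesgue_on {0..}. F (\<lambda>s. \<alpha> * f s + g s) t = \<alpha> * F f t + F g t) \<and>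
     (\<exists>C. \<forall>f \<in> Lp_functions \<nu> (ennreal p).
        Lp_norm \<nu> (ennreal q) (F f) \<le> C * Lp_norm \<nu> (ennreal p) f) \<and>
     (\<forall>f \<in> Lp_functions \<nu> 1 \<inter> Lp_functions \<nu> (ennreal p).
        AE t in lebesgue_on {0..}. F f t = lct_transform \<nu> m f t)"

end

theory Submission
  imports Defs "HOL-Probability.Probability_Measure" "HOL-Computational_Algebra.Formal_Power_Series"
begin

text \<open>Put \<open>\<alpha> = d / b\<close>. Multiplication by the chirp \<open>exp (\<i> \<alpha> t\<^sup>2 / 2)\<close> conjugates the translation attached to
  \<open>m\<close> to the plain Bessel translation, and the differential operator attached to \<open>m\<close> to the Bessel
  operator \<open>g'' + (2 \<nu> + 1) g' / t\<close> (\<open>lct_translation_eq\<close>, \<open>lct_operator_chirp\<close>). Chirps have modulus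
  one, so every assertion becomes one about the Bessel translation.

  The Bessel translate of \<open>f\<close> at \<open>y\<close> is the mean of \<open>f (r)\<close>, where \<open>r\<close> is the third side of a triangle
  with sides \<open>x\<close> and \<open>y\<close> and the enclosed angle \<open>\<theta>\<close> is random in \<open>[0, \<pi>]\<close> with density proportional to
  \<open>sin \<theta> powr (2 \<nu>)\<close>. Linearity, symmetry, the support property and uniform bounds are evident from this
  description. The exponent enters through an integration by parts (\<open>angular_integral_by_parts\<close>),
  which is used twice.

  First, it yields the moments of \<open>cos \<theta>\<close>. With \<open>a\<^sub>n = n! (\<nu> + 1)\<^sub>n\<close> and \<open>w\<^sub>n (t) = t ^ (2 n) / a\<^sub>n\<close>, the
  Vandermonde identity then shows that the translate of \<open>w\<^sub>n\<close> is \<open>\<Sum>k\<le>n. w\<^sub>k (x) w\<^sub>n\<^sub>-\<^sub>k (y)\<close>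
  (\<open>angular_integral_radius_power\<close>). As \<open>j\<^sub>\<nu>\<close> is a power series in the \<open>w\<^sub>n\<close>, the Cauchy product gives the
  product formula. An iterated translate of \<open>w\<^sub>n\<close> is a coefficient of a product of three power series,
  so translations commute on even polynomials, and by the Weierstrass theorem on all continuous
  functions.

  Second, it shows that the Bessel operator commutes with translations. For an even smooth \<open>f\<close> the
  quotient \<open>D f = f' / t\<close> is again even and smooth, and the \<open>y\<close>-derivative of \<open>f (r)\<close> is
  \<open>(y - x cos \<theta>) D f (r)\<close>. Hence all derivatives of a translate are combinations of means of
  \<open>D (\<dots> (D f)) (r) cos\<^sup>j \<theta>\<close>, which proves smoothness, continuity in the topology of smooth functions
  (\<open>angular_average_deriv_bound\<close>) and, after integration by parts, the commutation
  (\<open>bessel_operator_translation\<close>).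

  For \<open>x, y > 0\<close> the substitution \<open>z = r\<close> turns the mean into an integral against the kernel
  \<open>W (x, y, z)\<close> with respect to \<open>z powr (2 \<nu> + 1) dz\<close>. For fixed \<open>x\<close> this kernel is nonnegative, symmetric in
  \<open>y\<close> and \<open>z\<close> and of total mass one. Such a kernel acts as a contraction on every Lebesgue space, by Jensen
  and Tonelli (\<open>apply_kernel_powr\<close>), and is self-adjoint, by Fubini (\<open>apply_kernel_duality\<close>). Applying
  self-adjointness to \<open>j\<^sub>\<nu>\<close>, which is bounded by one because of its Poisson integral, and then the product
  formula, gives the transform of a translate of an integrable function. For \<open>1 < p \<le> 2\<close> the identity
  holds for the truncations of \<open>f\<close> to bounded intervals, and both of its sides are continuous from
  the Lebesgue space with exponent \<open>p\<close> to the one with the conjugate exponent.\<close>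

section \<open>The angular measure\<close>

lemma bessel_const_pos: "\<nu> > - 1 / 2 \<Longrightarrow> bessel_const \<nu> > 0"
  by (simp add: bessel_const_def)

lemma Gamma_duplication_real:
  fixes \<nu> :: real
  assumes "\<nu> > - 1 / 2"
  shows "Gamma (\<nu> + 1 / 2) * Gamma (\<nu> + 1) = 2 powr (- 2 * \<nu>) * sqrt pi * Gamma (2 * \<nu> + 1)"
proof -
  define z where "z = complex_of_real (\<nu> + 1/2)"
  have 1: "Gamma z = of_real (Gamma (\<nu> + 1/2))"
    unfolding z_def by (rule Gamma_complex_of_real)
  have 2: "Gamma (z + 1/2) = of_real (Gamma (\<nu> + 1))"
    unfolding z_def using Gamma_complex_of_real[of "\<nu> + 1"] by (simp add: add.assoc)
  have 3: "Gamma (2 * z) = of_real (Gamma (2 * \<nu> + 1))"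
    unfolding z_def using Gamma_complex_of_real[of "2 * \<nu> + 1"] by (simp add: algebra_simps)
  have pos: "w \<notin> \<int>\<^sub>\<le>\<^sub>0" if "Re w > 0" for w :: complex
    using that by (auto elim!: nonpos_Ints_cases)
  have "Gamma z * Gamma (z + 1/2) = exp ((1 - 2 * z) * of_real (ln 2)) * of_real (sqrt pi) * Gamma (2 * z)"
    by (rule Gamma_legendre_duplication; rule pos) (use assms in \<open>auto simp: z_def\<close>)
  also have "exp ((1 - 2 * z) * of_real (ln 2)) = of_real (2 powr (- 2 * \<nu>))"
  proof -
    have "(1 - 2 * z) * of_real (ln 2) = of_real (- 2 * \<nu> * ln 2)"
      by (simp add: z_def algebra_simps)
    thus ?thesis by (simp only: exp_of_real powr_def) simp
  qed
  finally have "of_real (Gamma (\<nu> + 1 / 2) * Gamma (\<nu> + 1)) =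
      complex_of_real (2 powr (- 2 * \<nu>) * sqrt pi * Gamma (2 * \<nu> + 1))"
    by (simp only: 1 2 3 of_real_mult)
  thus ?thesis by (simp only: of_real_eq_iff)
qed

text \<open>The substitution \<open>t = (1 - cos \<theta>) / 2\<close> gives \<open>2 powr (2 * \<nu>) * Beta (\<nu> + 1 / 2) (\<nu> + 1 / 2)\<close>, and the
  duplication formula identifies this with the reciprocal of the normalizing constant.\<close>

lemma sin_powr_integral:
  assumes nu: "\<nu> > - 1 / 2"
  shows "(\<lambda>\<theta>. sin \<theta> powr (2 * \<nu>)) absolutely_integrable_on {0..pi}"
    and "integral {0..pi} (\<lambda>\<theta>. sin \<theta> powr (2 * \<nu>)) = 1 / bessel_const \<nu>"
proof -
  define g where "g = (\<lambda>\<theta>::real. (1 - cos \<theta>) / 2)"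
  define B where "B = Beta (\<nu> + 1/2) (\<nu> + 1/2)"
  let ?f = "\<lambda>t. t powr (\<nu> - 1/2) * (1 - t) powr (\<nu> - 1/2)"
  let ?S = "{0<..<pi}"
  have "(?f has_integral B) {0<..<1}"
    using has_integral_Beta_real[of "\<nu> + 1/2" "\<nu> + 1/2"] nu
    by (simp add: B_def has_integral_Icc_iff_Ioo)
  hence f: "?f absolutely_integrable_on {0<..<1} \<and> integral {0<..<1} ?f = B"
    by (auto intro!: nonnegative_absolutely_integrable_1 simp: integral_unique has_integral_integrable)
  have inj: "inj_on g ?S"
    unfolding g_def inj_on_def by (auto simp: cos_inj_pi)
  have im: "g ` ?S = {0<..<1}"
  proof (intro equalityI subsetI)
    fix t assume "t \<in> g ` ?S"
    then obtain \<theta> where th: "0 < \<theta>" "\<theta> < pi" "t = (1 - cos \<theta>) / 2" by (auto simp: g_def)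
    have "cos \<theta> < cos 0" "cos pi < cos \<theta>"
      using th by (intro cos_monotone_0_pi; simp)+
    thus "t \<in> {0<..<1}" using th by simp
  next
    fix t :: real assume t: "t \<in> {0<..<1}"
    have "arccos (1 - 2 * t) \<in> ?S"
      using t arccos_lt_bounded[of "1 - 2 * t"] by auto
    moreover have "t = g (arccos (1 - 2 * t))" using t by (simp add: g_def)
    ultimately show "t \<in> g ` ?S" by blast
  qed
  have cv: "(\<lambda>\<theta>. \<bar>sin \<theta> / 2\<bar> *\<^sub>R ?f (g \<theta>)) absolutely_integrable_on ?S
      \<and> integral ?S (\<lambda>\<theta>. \<bar>sin \<theta> / 2\<bar> *\<^sub>R ?f (g \<theta>)) = B"
    by (subst has_absolute_integral_change_of_variables_real[where h="\<lambda>\<theta>. sin \<theta> / 2"])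
       (use f inj im in \<open>auto simp: g_def intro!: derivative_eq_intros\<close>)
  have pt: "\<bar>sin \<theta> / 2\<bar> *\<^sub>R ?f (g \<theta>) = 2 powr (- 2 * \<nu>) * sin \<theta> powr (2 * \<nu>)"
    if "\<theta> \<in> ?S" for \<theta>
  proof -
    have s: "sin \<theta> > 0" using that by (simp add: sin_gt_zero)
    have c: "cos \<theta> < cos 0" "cos pi < cos \<theta>"
      using that by (intro cos_monotone_0_pi; simp)+
    have "?f (g \<theta>) = (g \<theta> * (1 - g \<theta>)) powr (\<nu> - 1/2)"
      using c by (subst powr_mult) (auto simp: g_def)
    also have "g \<theta> * (1 - g \<theta>) = (sin \<theta> / 2)\<^sup>2"
      unfolding power_divide sin_squared_eq by (simp add: g_def power2_eq_square field_split_simps)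
    also have "\<dots> powr (\<nu> - 1/2) = (sin \<theta> / 2) powr (2 * \<nu> - 1)"
      using s by (simp add: powr_powr flip: powr_numeral)
    finally have "\<bar>sin \<theta> / 2\<bar> *\<^sub>R ?f (g \<theta>) = (sin \<theta> / 2) powr (2 * \<nu>)"
      using s powr_mult_base[of "sin \<theta> / 2" "2 * \<nu> - 1"] by simp
    also have "\<dots> = 2 powr (- 2 * \<nu>) * sin \<theta> powr (2 * \<nu>)"
      using s by (simp add: powr_divide powr_minus divide_simps)
    finally show ?thesis .
  qed
  have A: "(\<lambda>\<theta>. 2 powr (- 2 * \<nu>) * sin \<theta> powr (2 * \<nu>)) absolutely_integrable_on ?S"
    by (rule iffD1[OF set_integrable_cong[OF refl refl pt] conjunct1[OF cv]])
  have A2: "integral ?S (\<lambda>\<theta>. 2 powr (- 2 * \<nu>) * sin \<theta> powr (2 * \<nu>)) = B"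
    by (rule trans[OF Henstock_Kurzweil_Integration.integral_cong[OF pt[symmetric]] conjunct2[OF cv]])
  have "(\<lambda>\<theta>. 2 powr (2 * \<nu>) * (2 powr (- 2 * \<nu>) * sin \<theta> powr (2 * \<nu>))) absolutely_integrable_on ?S"
    by (intro set_integrable_mult_right A)
  hence int1: "(\<lambda>\<theta>. sin \<theta> powr (2 * \<nu>)) absolutely_integrable_on ?S"
    by (simp add: powr_minus mult.assoc[symmetric])
  hence "((\<lambda>\<theta>. sin \<theta> powr (2 * \<nu>)) has_integral integral ?S (\<lambda>\<theta>. sin \<theta> powr (2 * \<nu>))) {0..pi}"
    by (simp add: has_integral_Icc_iff_Ioo set_lebesgue_integral_eq_integral integrable_integral)
  note hi = this
  show "(\<lambda>\<theta>. sin \<theta> powr (2 * \<nu>)) absolutely_integrable_on {0..pi}"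
    by (rule nonnegative_absolutely_integrable_1) (use hi in \<open>auto simp: has_integral_integrable\<close>)
  have "integral {0..pi} (\<lambda>\<theta>. sin \<theta> powr (2 * \<nu>)) = integral ?S (\<lambda>\<theta>. sin \<theta> powr (2 * \<nu>))"
    using hi by (rule integral_unique)
  also have "\<dots> = 2 powr (2 * \<nu>) * B"
    using A2 by (simp add: powr_minus field_simps)
  also have "\<dots> = 1 / bessel_const \<nu>"
  proof -
    have p: "Gamma (\<nu> + 1) > 0" "Gamma (\<nu> + 1/2) > 0" "Gamma (2 * \<nu> + 1) > 0" using nu by auto
    have B: "B = Gamma (\<nu> + 1/2) * Gamma (\<nu> + 1/2) / Gamma (2 * \<nu> + 1)"
      by (simp add: B_def Beta_def)
    have G: "Gamma (2 * \<nu> + 1) = 2 powr (2 * \<nu>) * (Gamma (\<nu> + 1 / 2) * Gamma (\<nu> + 1)) / sqrt pi"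
      unfolding Gamma_duplication_real[OF nu] by (simp add: powr_minus)
    show ?thesis unfolding bessel_const_def B G using p by (simp add: field_simps)
  qed
  finally show "integral {0..pi} (\<lambda>\<theta>. sin \<theta> powr (2 * \<nu>)) = 1 / bessel_const \<nu>" .
qed

definition angular_density :: "real \<Rightarrow> real \<Rightarrow> real" where
  "angular_density \<nu> \<theta> = bessel_const \<nu> * (indicator {0..pi} \<theta> * sin \<theta> powr (2 * \<nu>))"

definition angular_measure :: "real \<Rightarrow> real measure" where
  "angular_measure \<nu> = density lborel (\<lambda>\<theta>. ennreal (angular_density \<nu> \<theta>))"

lemma angular_density_nonneg: "\<nu> > - 1 / 2 \<Longrightarrow> angular_density \<nu> \<theta> \<ge> 0"
  using bessel_const_pos[of \<nu>] by (simp add: angular_density_def)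

lemma angular_density_measurable [measurable]: "angular_density \<nu> \<in> borel_measurable borel"
  unfolding angular_density_def by measurable

lemma sets_angular_measure [simp, measurable_cong]: "sets (angular_measure \<nu>) = sets borel"
  and space_angular_measure [simp]: "space (angular_measure \<nu>) = UNIV"
  by (simp_all add: angular_measure_def)

lemma angular_measure_prob_space:
  assumes nu: "\<nu> > - 1 / 2"
  shows "prob_space (angular_measure \<nu>)"
proof
  have "set_integrable lborel {0..pi} (\<lambda>\<theta>. sin \<theta> powr (2 * \<nu>))"
    using sin_powr_integral(1)[OF nu] unfolding set_integrable_def
    by (subst (asm) integrable_completion) auto
  note i = this
  have I: "integrable lborel (angular_density \<nu>)"
    using i unfolding set_integrable_def angular_density_def by simp
  have "emeasure (angular_measure \<nu>) (space (angular_measure \<nu>)) = (\<integral>\<^sup>+\<theta>. ennreal (angular_density \<nu> \<theta>) \<partial>lborel)"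
    by (simp add: angular_measure_def emeasure_density)
  also have "\<dots> = ennreal (LINT \<theta>|lborel. angular_density \<nu> \<theta>)"
    using I by (intro nn_integral_eq_integral) (auto simp: angular_density_nonneg[OF nu])
  also have "(LINT \<theta>|lborel. angular_density \<nu> \<theta>) = bessel_const \<nu> * (LINT \<theta>:{0..pi}|lborel. sin \<theta> powr (2 * \<nu>))"
    unfolding angular_density_def set_lebesgue_integral_def by simp
  also have "\<dots> = 1"
    using bessel_const_pos[OF nu]
    by (simp add: set_borel_integral_eq_integral(2)[OF i] sin_powr_integral(2)[OF nu])
  finally show "emeasure (angular_measure \<nu>) (space (angular_measure \<nu>)) = 1" by simp
qed

text \<open>Since \<open>sin\<close> vanishes at \<open>0\<close> and \<open>\<pi>\<close> and \<open>0 powr a = 0\<close>, the density vanishes at both endpoints, whatever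
  the sign of \<open>\<nu>\<close>.\<close>

lemma AE_angular_measure:
  assumes "\<nu> > - 1 / 2"
  shows "AE \<theta> in angular_measure \<nu>. \<theta> \<in> {0<..<pi}"
proof -
  have "\<theta> \<in> {0<..<pi}" if "0 < angular_density \<nu> \<theta>" for \<theta>
  proof (rule ccontr)
    assume "\<theta> \<notin> {0<..<pi}"
    hence "\<theta> \<notin> {0..pi} \<or> \<theta> = 0 \<or> \<theta> = pi" by auto
    thus False using that by (auto simp: angular_density_def)
  qed
  thus ?thesis
    unfolding angular_measure_def by (subst AE_density) (auto simp del: greaterThanLessThan_iff)
qed

lemma integrable_angular_measure_bounded:
  fixes g :: "real \<Rightarrow> 'b::{banach, second_countable_topology}"
  assumes nu: "\<nu> > - 1 / 2" and "g \<in> borel_measurable borel"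
    and "\<And>\<theta>. \<theta> \<in> {0<..<pi} \<Longrightarrow> norm (g \<theta>) \<le> C"
  shows "integrable (angular_measure \<nu>) g"
proof -
  interpret prob_space "angular_measure \<nu>" by (rule angular_measure_prob_space[OF nu])
  have "AE \<theta> in angular_measure \<nu>. norm (g \<theta>) \<le> C"
    using AE_angular_measure[OF nu] by eventually_elim (rule assms(3))
  moreover have "g \<in> borel_measurable (angular_measure \<nu>)"
    using assms(2) by measurable
  ultimately show ?thesis by (rule integrable_const_bound)
qed

lemma integrable_angular_measure_continuous:
  fixes g :: "real \<Rightarrow> 'b::euclidean_space"
  assumes nu: "\<nu> > - 1 / 2" and c: "continuous_on UNIV g"
  shows "integrable (angular_measure \<nu>) g"
proof -
  have "compact (g ` {0..pi})"
    by (intro compact_continuous_image continuous_on_subset[OF c]) auto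
  hence "bounded (g ` {0..pi})" by (rule compact_imp_bounded)
  then obtain C where C: "\<forall>v\<in>g ` {0..pi}. norm v \<le> C"
    unfolding bounded_iff ..
  show ?thesis
  proof (rule integrable_angular_measure_bounded[OF nu])
    show "g \<in> borel_measurable borel" by (rule borel_measurable_continuous_onI[OF c])
    show "norm (g \<theta>) \<le> C" if "\<theta> \<in> {0<..<pi}" for \<theta>
      using that by (intro C[rule_format] imageI) auto
  qed
qed

lemma norm_integral_angular_le:
  fixes g :: "real \<Rightarrow> 'b::{banach, second_countable_topology}"
  assumes nu: "\<nu> > - 1 / 2" and C: "0 \<le> C"
    and le: "\<And>\<theta>. \<theta> \<in> {0<..<pi} \<Longrightarrow> norm (g \<theta>) \<le> C"
  shows "norm (LINT \<theta>|angular_measure \<nu>. g \<theta>) \<le> C"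
proof -
  interpret prob_space "angular_measure \<nu>" by (rule angular_measure_prob_space[OF nu])
  have AE: "AE \<theta> in angular_measure \<nu>. norm (g \<theta>) \<le> C"
    using AE_angular_measure[OF nu] by eventually_elim (rule le)
  show ?thesis
  proof (cases "integrable (angular_measure \<nu>) g")
    case True
    have "norm (LINT \<theta>|angular_measure \<nu>. g \<theta>) \<le> (LINT \<theta>|angular_measure \<nu>. norm (g \<theta>))"
      by (rule integral_norm_bound)
    also have "\<dots> \<le> (LINT \<theta>|angular_measure \<nu>. C)"
      using True AE by (intro integral_mono_AE) auto
    finally show ?thesis using prob_space by simp
  qed (simp add: not_integrable_integral_eq C)
qed

text \<open>The function \<open>sin \<theta> powr (2 * \<nu> + 1) *\<^sub>R \<phi> \<theta>\<close> vanishes at both endpoints because \<open>2 * \<nu> + 1 > 0\<close>, so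
  the integral of its derivative is zero. For \<open>\<phi> = cos\<^sup>n\<^sup>+\<^sup>1\<close> this gives the moments of the cosine, for
  \<open>\<phi> \<theta> = D f (r)\<close> the commutation with the Bessel operator.\<close>

lemma angular_integral_by_parts:
  fixes \<phi> :: "real \<Rightarrow> 'b::euclidean_space"
  assumes nu: "\<nu> > - 1 / 2" and c: "continuous_on UNIV \<phi>" and c': "continuous_on UNIV \<phi>'"
    and d: "\<And>\<theta>. \<theta> \<in> {0<..<pi} \<Longrightarrow> (\<phi> has_vector_derivative \<phi>' \<theta>) (at \<theta>)"
  shows "(2 * \<nu> + 1) *\<^sub>R (LINT \<theta>|angular_measure \<nu>. cos \<theta> *\<^sub>R \<phi> \<theta>)
           = - (LINT \<theta>|angular_measure \<nu>. sin \<theta> *\<^sub>R \<phi>' \<theta>)"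
proof -
  define h where "h = (\<lambda>\<theta>. sin \<theta> *\<^sub>R \<phi>' \<theta> + ((2 * \<nu> + 1) * cos \<theta>) *\<^sub>R \<phi> \<theta>)"
  have ch: "continuous_on UNIV h" unfolding h_def by (intro continuous_intros c c')
  have meas: "h \<in> borel_measurable borel" by (rule borel_measurable_continuous_onI[OF ch])
  have int: "integrable (angular_measure \<nu>) h"
    by (rule integrable_angular_measure_continuous[OF nu ch])
  hence int': "integrable lborel (\<lambda>\<theta>. angular_density \<nu> \<theta> *\<^sub>R h \<theta>)"
    unfolding angular_measure_def
    by (subst (asm) integrable_density) (auto simp: angular_density_nonneg[OF nu] meas)
  have s: "set_integrable lborel {0..pi} (\<lambda>\<theta>. (bessel_const \<nu> * sin \<theta> powr (2 * \<nu>)) *\<^sub>R h \<theta>)"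
    using int' unfolding set_integrable_def angular_density_def by (simp add: mult_ac)
  let ?F = "\<lambda>\<theta>. (bessel_const \<nu> * sin \<theta> powr (2 * \<nu> + 1)) *\<^sub>R \<phi> \<theta>"
  have "((\<lambda>\<theta>. (bessel_const \<nu> * sin \<theta> powr (2 * \<nu>)) *\<^sub>R h \<theta>) has_integral ?F pi - ?F 0) {0..pi}"
  proof (rule fundamental_theorem_of_calculus_interior)
    show "continuous_on {0..pi} ?F"
      using nu by (intro continuous_intros continuous_on_powr' continuous_on_subset[OF c])
        (auto simp: sin_ge_zero)
    fix \<theta> assume th: "\<theta> \<in> {0<..<pi}"
    have sp: "sin \<theta> > 0" using th by (simp add: sin_gt_zero)
    have "((\<lambda>\<theta>. bessel_const \<nu> * sin \<theta> powr (2 * \<nu> + 1)) has_real_derivative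
        bessel_const \<nu> * ((2 * \<nu> + 1) * sin \<theta> powr (2 * \<nu>) * cos \<theta>)) (at \<theta>)"
      using sp by (auto intro!: derivative_eq_intros)
    from has_vector_derivative_scaleR[OF this d[OF th]]
    show "(?F has_vector_derivative (bessel_const \<nu> * sin \<theta> powr (2 * \<nu>)) *\<^sub>R h \<theta>) (at \<theta>)"
      using sp by (simp add: h_def scaleR_add_right algebra_simps powr_add)
  qed simp
  hence "integral {0..pi} (\<lambda>\<theta>. (bessel_const \<nu> * sin \<theta> powr (2 * \<nu>)) *\<^sub>R h \<theta>) = 0"
    using nu by (simp add: integral_unique)
  hence "(LINT \<theta>:{0..pi}|lborel. (bessel_const \<nu> * sin \<theta> powr (2 * \<nu>)) *\<^sub>R h \<theta>) = 0"
    by (simp add: set_borel_integral_eq_integral(2)[OF s])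
  hence "(LINT \<theta>|lborel. angular_density \<nu> \<theta> *\<^sub>R h \<theta>) = 0"
    unfolding set_lebesgue_integral_def angular_density_def by (simp add: mult_ac)
  hence "(LINT \<theta>|angular_measure \<nu>. h \<theta>) = 0"
    unfolding angular_measure_def by (subst integral_density) (auto simp: angular_density_nonneg[OF nu] meas)
  moreover have "(LINT \<theta>|angular_measure \<nu>. h \<theta>) = (LINT \<theta>|angular_measure \<nu>. sin \<theta> *\<^sub>R \<phi>' \<theta>)
      + (2 * \<nu> + 1) *\<^sub>R (LINT \<theta>|angular_measure \<nu>. cos \<theta> *\<^sub>R \<phi> \<theta>)"
    unfolding h_def scaleR_scaleR[symmetric] integral_scaleR_right[symmetric]
    by (intro Bochner_Integration.integral_add integrable_angular_measure_continuous[OF nu] continuous_intros c c')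
  ultimately have "(LINT \<theta>|angular_measure \<nu>. sin \<theta> *\<^sub>R \<phi>' \<theta>)
      + (2 * \<nu> + 1) *\<^sub>R (LINT \<theta>|angular_measure \<nu>. cos \<theta> *\<^sub>R \<phi> \<theta>) = 0" by simp
  thus ?thesis by (simp only: add_eq_0_iff)
qed

lemma angular_moment_step:
  assumes nu: "\<nu> > - 1 / 2"
  shows "(2 * \<nu> + 2 + real n) * (LINT \<theta>|angular_measure \<nu>. cos \<theta> ^ (n + 2))
      = (real n + 1) * (LINT \<theta>|angular_measure \<nu>. cos \<theta> ^ n)"
proof -
  have "(2 * \<nu> + 1) *\<^sub>R (LINT \<theta>|angular_measure \<nu>. cos \<theta> *\<^sub>R (cos \<theta> ^ (n + 1)))
      = - (LINT \<theta>|angular_measure \<nu>. sin \<theta> *\<^sub>R (- (real n + 1) * cos \<theta> ^ n * sin \<theta>))"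
  proof (rule angular_integral_by_parts[OF nu])
    show "((\<lambda>\<theta>. cos \<theta> ^ (n + 1)) has_vector_derivative - (real n + 1) * cos \<theta> ^ n * sin \<theta>) (at \<theta>)" for \<theta>
      unfolding has_real_derivative_iff_has_vector_derivative[symmetric]
      by (rule DERIV_cong[OF DERIV_power[OF DERIV_cos]]) (simp add: algebra_simps)
  qed (intro continuous_intros)+
  also have "(\<lambda>\<theta>. sin \<theta> *\<^sub>R (- (real n + 1) * cos \<theta> ^ n * sin \<theta>))
      = (\<lambda>\<theta>. (real n + 1) * cos \<theta> ^ (n + 2) - (real n + 1) * cos \<theta> ^ n)"
  proof
    fix \<theta> :: real
    have "sin \<theta> *\<^sub>R (- (real n + 1) * cos \<theta> ^ n * sin \<theta>) = - (real n + 1) * cos \<theta> ^ n * (sin \<theta>)\<^sup>2"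
      by (simp add: power2_eq_square)
    also have "\<dots> = (real n + 1) * cos \<theta> ^ (n + 2) - (real n + 1) * cos \<theta> ^ n"
      unfolding sin_squared_eq by (simp add: algebra_simps power_add power2_eq_square)
    finally show "sin \<theta> *\<^sub>R (- (real n + 1) * cos \<theta> ^ n * sin \<theta>)
        = (real n + 1) * cos \<theta> ^ (n + 2) - (real n + 1) * cos \<theta> ^ n" .
  qed
  also have "(LINT \<theta>|angular_measure \<nu>. (real n + 1) * cos \<theta> ^ (n + 2) - (real n + 1) * cos \<theta> ^ n)
      = (real n + 1) * (LINT \<theta>|angular_measure \<nu>. cos \<theta> ^ (n + 2)) - (real n + 1) * (LINT \<theta>|angular_measure \<nu>. cos \<theta> ^ n)"
    by (subst Bochner_Integration.integral_diff)
       (auto intro!: integrable_angular_measure_continuous[OF nu] continuous_intros)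
  finally show ?thesis by (simp add: algebra_simps)
qed

lemma angular_moment_odd:
  assumes nu: "\<nu> > - 1 / 2"
  shows "(LINT \<theta>|angular_measure \<nu>. cos \<theta> ^ (2 * k + 1)) = 0"
proof (induction k)
  case 0
  have "(2 * \<nu> + 1) *\<^sub>R (LINT \<theta>|angular_measure \<nu>. cos \<theta> *\<^sub>R (1::real)) = - (LINT \<theta>|angular_measure \<nu>. sin \<theta> *\<^sub>R 0)"
    by (rule angular_integral_by_parts[OF nu]) (auto intro!: continuous_intros)
  thus ?case using nu by simp
next
  case (Suc k)
  thus ?case using angular_moment_step[OF nu, of "2 * k + 1"] nu by simp
qed

lemma angular_moment_even:
  assumes nu: "\<nu> > - 1 / 2"
  shows "(LINT \<theta>|angular_measure \<nu>. cos \<theta> ^ (2 * k)) = pochhammer (1 / 2) k / pochhammer (\<nu> + 1) k"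
proof (induction k)
  case 0
  interpret prob_space "angular_measure \<nu>" by (rule angular_measure_prob_space[OF nu])
  show ?case using prob_space by simp
next
  case (Suc k)
  have "(LINT \<theta>|angular_measure \<nu>. cos \<theta> ^ (2 * Suc k))
      = (1 / 2 + k) / (\<nu> + 1 + k) * (LINT \<theta>|angular_measure \<nu>. cos \<theta> ^ (2 * k))"
    using angular_moment_step[OF nu, of "2 * k"] nu by (simp add: field_simps)
  thus ?case unfolding Suc by (simp add: pochhammer_Suc mult.commute)
qed

section \<open>The Bessel translation as an angular mean\<close>

text \<open>The third side of a triangle with sides \<open>x\<close> and \<open>y\<close> enclosing the angle \<open>\<theta>\<close>.\<close>

definition bessel_radius :: "real \<Rightarrow> real \<Rightarrow> real \<Rightarrow> real" where
  "bessel_radius x y \<theta> = sqrt (x\<^sup>2 + y\<^sup>2 - 2 * x * y * cos \<theta>)"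

text \<open>The squared distance of \<open>(x cos \<theta>, x sin \<theta>)\<close> from \<open>(y, 0)\<close>. This form shows that the radicand is
  nonnegative, and that it vanishes only if \<open>x * sin \<theta> = 0\<close>.\<close>

lemma bessel_radius_polar:
  fixes x y \<theta> :: real
  shows "x\<^sup>2 + y\<^sup>2 - 2 * x * y * cos \<theta> = (y - x * cos \<theta>)\<^sup>2 + (x * sin \<theta>)\<^sup>2"
proof -
  have "(y - x * cos \<theta>)\<^sup>2 + (x * sin \<theta>)\<^sup>2 = y\<^sup>2 - 2 * x * y * cos \<theta> + x\<^sup>2 * ((cos \<theta>)\<^sup>2 + (sin \<theta>)\<^sup>2)"
    by algebra
  also have "\<dots> = y\<^sup>2 - 2 * x * y * cos \<theta> + x\<^sup>2" by (simp only: sin_cos_squared_add2 mult_1_right)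
  finally show ?thesis by simp
qed

lemma bessel_radius_square: "(bessel_radius x y \<theta>)\<^sup>2 = x\<^sup>2 + y\<^sup>2 - 2 * x * y * cos \<theta>"
  unfolding bessel_radius_def by (subst real_sqrt_pow2) (auto simp: bessel_radius_polar)

lemma bessel_radius_nonneg [simp]: "0 \<le> bessel_radius x y \<theta>"
  unfolding bessel_radius_def bessel_radius_polar by simp

lemma bessel_radius_le: "bessel_radius x y \<theta> \<le> \<bar>x\<bar> + \<bar>y\<bar>"
proof (rule power2_le_imp_le)
  have "- (2 * x * y * cos \<theta>) \<le> \<bar>2 * x * y\<bar> * \<bar>cos \<theta>\<bar>"
    by (metis abs_ge_minus_self abs_mult)
  also have "\<dots> \<le> \<bar>2 * x * y\<bar> * 1" by (intro mult_left_mono) auto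
  finally show "(bessel_radius x y \<theta>)\<^sup>2 \<le> (\<bar>x\<bar> + \<bar>y\<bar>)\<^sup>2"
    unfolding bessel_radius_square by (simp add: power2_sum abs_mult)
qed auto

lemma bessel_radius_ge:
  assumes "x \<ge> 0" "y \<ge> 0"
  shows "\<bar>x - y\<bar> \<le> bessel_radius x y \<theta>"
proof (rule power2_le_imp_le)
  have "2 * x * y * cos \<theta> \<le> 2 * x * y * 1" using assms by (intro mult_left_mono) auto
  thus "\<bar>x - y\<bar>\<^sup>2 \<le> (bessel_radius x y \<theta>)\<^sup>2"
    unfolding bessel_radius_square by (simp add: power2_diff)
qed auto

lemma bessel_radius_0: "bessel_radius 0 y \<theta> = \<bar>y\<bar>"
  by (simp add: bessel_radius_def)

lemma continuous_on_bessel_radius [continuous_intros]: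
  fixes f g h :: "'a::t2_space \<Rightarrow> real"
  assumes "continuous_on S f" "continuous_on S g" "continuous_on S h"
  shows "continuous_on S (\<lambda>p. bessel_radius (f p) (g p) (h p))"
  unfolding bessel_radius_def by (intro continuous_intros assms)

lemma continuous_on_UNIV_compose:
  assumes "continuous_on UNIV f" "continuous_on S g"
  shows "continuous_on S (\<lambda>p. f (g p))"
  using continuous_on_compose[OF assms(2) continuous_on_subset[OF assms(1)]] by (auto simp: o_def)

lemma bessel_translation_eq_angular:
  assumes nu: "\<nu> > - 1 / 2" and f: "continuous_on UNIV f"
  shows "bessel_translation \<nu> x f y = (LINT \<theta>|angular_measure \<nu>. f (bessel_radius x y \<theta>))"
proof -
  have [measurable]: "(\<lambda>\<theta>. f (bessel_radius x y \<theta>)) \<in> borel_measurable borel"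
    by (intro borel_measurable_continuous_onI continuous_on_UNIV_compose[OF f] continuous_intros)
  have "(LINT \<theta>|angular_measure \<nu>. f (bessel_radius x y \<theta>))
      = (LINT \<theta>|lborel. angular_density \<nu> \<theta> *\<^sub>R f (bessel_radius x y \<theta>))"
    unfolding angular_measure_def
    by (subst integral_density) (auto simp: angular_density_nonneg[OF nu])
  also have "\<dots> = (LINT \<theta>|lborel. complex_of_real (bessel_const \<nu>) *
      (indicator {0..pi} \<theta> *\<^sub>R (f (bessel_radius x y \<theta>) * complex_of_real (sin \<theta> powr (2 * \<nu>)))))"
    by (intro Bochner_Integration.integral_cong) (auto simp: angular_density_def scaleR_conv_of_real mult_ac)
  also have "\<dots> = complex_of_real (bessel_const \<nu>) * (LINT \<theta>|lborel.
      indicator {0..pi} \<theta> *\<^sub>R (f (bessel_radius x y \<theta>) * complex_of_real (sin \<theta> powr (2 * \<nu>))))"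
    by (rule integral_mult_right_zero)
  finally show ?thesis
    by (simp add: bessel_translation_def set_lebesgue_integral_def bessel_radius_def)
qed

lemma continuous_bounded_on_strip:
  fixes F :: "real \<times> real \<Rightarrow> 'b::euclidean_space"
  assumes "continuous_on UNIV F"
  obtains C where "C > 0" "\<And>y \<theta>. \<bar>y\<bar> \<le> R \<Longrightarrow> \<theta> \<in> {0<..<pi} \<Longrightarrow> norm (F (y, \<theta>)) \<le> C"
proof -
  have "compact (F ` ({-R..R} \<times> {0..pi}))"
    by (intro compact_continuous_image continuous_on_subset[OF assms] compact_Times) auto
  hence "bounded (F ` ({-R..R} \<times> {0..pi}))" by (rule compact_imp_bounded)
  then obtain C where C: "C > 0" "\<forall>v\<in>F ` ({-R..R} \<times> {0..pi}). norm v \<le> C"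
    unfolding bounded_pos by blast
  show ?thesis
  proof (rule that[OF C(1)])
    fix y \<theta> :: real assume "\<bar>y\<bar> \<le> R" "\<theta> \<in> {0<..<pi}"
    thus "norm (F (y, \<theta>)) \<le> C" by (intro C(2)[rule_format] imageI) auto
  qed
qed

lemma tendsto_angular_integral:
  fixes F :: "nat \<Rightarrow> real \<Rightarrow> 'b::euclidean_space"
  assumes nu: "\<nu> > - 1 / 2"
    and F: "\<And>n. F n \<in> borel_measurable borel" and G: "G \<in> borel_measurable borel"
    and lim: "\<And>\<theta>. \<theta> \<in> {0<..<pi} \<Longrightarrow> (\<lambda>n. F n \<theta>) \<longlonglongrightarrow> G \<theta>"
    and le: "\<And>n \<theta>. \<theta> \<in> {0<..<pi} \<Longrightarrow> norm (F n \<theta>) \<le> C"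
  shows "(\<lambda>n. LINT \<theta>|angular_measure \<nu>. F n \<theta>) \<longlonglongrightarrow> (LINT \<theta>|angular_measure \<nu>. G \<theta>)"
proof -
  interpret prob_space "angular_measure \<nu>" by (rule angular_measure_prob_space[OF nu])
  note [measurable] = F G
  show ?thesis
  proof (rule integral_dominated_convergence[where w="\<lambda>_. C"])
    show "AE \<theta> in angular_measure \<nu>. (\<lambda>n. F n \<theta>) \<longlonglongrightarrow> G \<theta>"
      using AE_angular_measure[OF nu] by eventually_elim (rule lim)
    show "AE \<theta> in angular_measure \<nu>. norm (F n \<theta>) \<le> C" for n
      using AE_angular_measure[OF nu] by eventually_elim (rule le)
  qed auto
qed

lemma continuous_on_angular_integral:
  fixes F :: "real \<times> real \<Rightarrow> 'b::euclidean_space"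
  assumes nu: "\<nu> > - 1 / 2" and F: "continuous_on UNIV F"
  shows "continuous_on UNIV (\<lambda>y. LINT \<theta>|angular_measure \<nu>. F (y, \<theta>))"
proof -
  have m: "(\<lambda>\<theta>. F (y, \<theta>)) \<in> borel_measurable borel" for y
    by (intro borel_measurable_continuous_onI continuous_on_UNIV_compose[OF F] continuous_intros)
  show ?thesis
  proof (subst continuous_on_sequentially, intro ballI allI impI)
    fix u :: "nat \<Rightarrow> real" and a assume "a \<in> UNIV" "(\<forall>n. u n \<in> UNIV) \<and> u \<longlonglongrightarrow> a"
    hence u: "u \<longlonglongrightarrow> a" by simp
    hence "Bseq u" using convergentI Bseq_conv_Bfun convergent_imp_Bseq by blast
    then obtain R where R: "\<And>n. \<bar>u n\<bar> \<le> R" by (auto simp: Bseq_def)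
    obtain C where "\<And>y \<theta>. \<bar>y\<bar> \<le> R \<Longrightarrow> \<theta> \<in> {0<..<pi} \<Longrightarrow> norm (F (y, \<theta>)) \<le> C"
      using continuous_bounded_on_strip[OF F] by blast
    hence "(\<lambda>n. LINT \<theta>|angular_measure \<nu>. F (u n, \<theta>)) \<longlonglongrightarrow> (LINT \<theta>|angular_measure \<nu>. F (a, \<theta>))"
      using R u
      by (intro tendsto_angular_integral[OF nu m m, where C=C]
           continuous_on_tendsto_compose[OF F] tendsto_Pair tendsto_const) auto
    thus "((\<lambda>y. LINT \<theta>|angular_measure \<nu>. F (y, \<theta>)) \<circ> u) \<longlonglongrightarrow> (LINT \<theta>|angular_measure \<nu>. F (a, \<theta>))"
      by (simp add: o_def)
  qed
qed

lemma has_vector_derivative_iff_slope: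
  fixes f :: "real \<Rightarrow> 'a::real_normed_vector"
  shows "(f has_vector_derivative D) (at a) \<longleftrightarrow> ((\<lambda>h. (f (a + h) - f a) /\<^sub>R h) \<longlongrightarrow> D) (at 0)"
proof -
  have "norm (f (a + h) - f a - h *\<^sub>R D) / norm h = norm ((f (a + h) - f a) /\<^sub>R h - D)" if "h \<noteq> 0" for h
  proof -
    have "(f (a + h) - f a) /\<^sub>R h - D = (f (a + h) - f a - h *\<^sub>R D) /\<^sub>R h"
      using that by (simp add: scaleR_diff_right)
    thus ?thesis by (simp add: divide_inverse mult.commute)
  qed
  hence "\<forall>\<^sub>F h in at 0. norm (f (a + h) - f a - h *\<^sub>R D) / norm h = norm ((f (a + h) - f a) /\<^sub>R h - D)"
    by (auto simp: eventually_at_filter)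
  from tendsto_cong[OF this, of 0] show ?thesis
    by (simp add: has_vector_derivative_def has_derivative_at bounded_linear_scaleR_left tendsto_norm_zero_iff LIM_zero_iff)
qed

text \<open>Differentiation under the integral sign: by the mean value inequality the difference quotients are
  bounded by the supremum of \<open>F'\<close> on a compact strip, so dominated convergence applies.\<close>

lemma has_vector_derivative_angular_integral:
  fixes F F' :: "real \<times> real \<Rightarrow> 'b::euclidean_space"
  assumes nu: "\<nu> > - 1 / 2" and F: "continuous_on UNIV F" and F': "continuous_on UNIV F'"
    and d: "\<And>y \<theta>. \<theta> \<in> {0<..<pi} \<Longrightarrow> ((\<lambda>y. F (y, \<theta>)) has_vector_derivative F' (y, \<theta>)) (at y)"
  shows "((\<lambda>y. LINT \<theta>|angular_measure \<nu>. F (y, \<theta>)) has_vector_derivative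
           (LINT \<theta>|angular_measure \<nu>. F' (a, \<theta>))) (at a)"
proof -
  have cF: "continuous_on UNIV (\<lambda>\<theta>. F (y, \<theta>))" and cF': "continuous_on UNIV (\<lambda>\<theta>. F' (y, \<theta>))" for y
    by (intro continuous_on_UNIV_compose[OF F] continuous_on_UNIV_compose[OF F'] continuous_intros)+
  note int = integrable_angular_measure_continuous[OF nu cF]
  obtain C where C: "\<And>y \<theta>. \<bar>y\<bar> \<le> \<bar>a\<bar> + 1 \<Longrightarrow> \<theta> \<in> {0<..<pi} \<Longrightarrow> norm (F' (y, \<theta>)) \<le> C"
    using continuous_bounded_on_strip[OF F'] by blast
  let ?Q = "\<lambda>h \<theta>. (F (a + h, \<theta>) - F (a, \<theta>)) /\<^sub>R h"
  have Q: "norm (?Q h \<theta>) \<le> C" if h: "\<bar>h\<bar> \<le> 1" "h \<noteq> 0" and th: "\<theta> \<in> {0<..<pi}" for h \<theta>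
  proof -
    have "norm (F (a + h, \<theta>) - F (a, \<theta>)) \<le> C * norm (a + h - a)"
    proof (rule differentiable_bound[where f="\<lambda>y. F (y, \<theta>)" and f'="\<lambda>y t. t *\<^sub>R F' (y, \<theta>)"
          and S="{- \<bar>a\<bar> - 1..\<bar>a\<bar> + 1}"])
      fix y assume y: "y \<in> {- \<bar>a\<bar> - 1..\<bar>a\<bar> + 1}"
      show "((\<lambda>y. F (y, \<theta>)) has_derivative (\<lambda>t. t *\<^sub>R F' (y, \<theta>))) (at y within {- \<bar>a\<bar> - 1..\<bar>a\<bar> + 1})"
        using d[OF th, of y] unfolding has_vector_derivative_def by (rule has_derivative_at_withinI)
      have "norm (F' (y, \<theta>)) \<le> C" using y by (intro C th) auto
      hence "norm (t *\<^sub>R F' (y, \<theta>)) \<le> C * norm t" for t :: real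
        using mult_right_mono[of "norm (F' (y, \<theta>))" C "norm t"] by (simp add: mult.commute)
      thus "onorm (\<lambda>t. t *\<^sub>R F' (y, \<theta>)) \<le> C" by (rule onorm_le)
    qed (use h in auto)
    thus ?thesis using h by (simp add: divide_simps mult.commute)
  qed
  have lim: "((\<lambda>h. LINT \<theta>|angular_measure \<nu>. ?Q h \<theta>) \<longlongrightarrow> (LINT \<theta>|angular_measure \<nu>. F' (a, \<theta>))) (at 0)"
  proof (subst tendsto_at_iff_sequentially, intro allI impI)
    fix u :: "nat \<Rightarrow> real" assume u: "\<forall>i. u i \<in> UNIV - {0}" "u \<longlonglongrightarrow> 0"
    have "\<forall>\<^sub>F n in sequentially. \<bar>u n\<bar> < 1" using tendstoD[OF u(2), of 1] by simp
    then obtain N where N: "\<And>n. n \<ge> N \<Longrightarrow> \<bar>u n\<bar> < 1" by (auto simp: eventually_sequentially)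
    have "(\<lambda>n. LINT \<theta>|angular_measure \<nu>. ?Q (u (n + N)) \<theta>) \<longlonglongrightarrow> (LINT \<theta>|angular_measure \<nu>. F' (a, \<theta>))"
    proof (rule tendsto_angular_integral[OF nu, where C=C])
      show "(\<lambda>\<theta>. F' (a, \<theta>)) \<in> borel_measurable borel"
        by (rule borel_measurable_continuous_onI[OF cF'])
      show "(\<lambda>\<theta>. ?Q (u (n + N)) \<theta>) \<in> borel_measurable borel" for n
        by (intro borel_measurable_continuous_onI continuous_intros cF)
      fix \<theta> assume th: "\<theta> \<in> {0<..<pi}"
      have "((\<lambda>h. ?Q h \<theta>) \<longlongrightarrow> F' (a, \<theta>)) (at 0)"
        using d[OF th, of a] unfolding has_vector_derivative_iff_slope .
      moreover have "(\<lambda>n. u (n + N)) \<longlonglongrightarrow> 0" using u(2) by (rule LIMSEQ_ignore_initial_segment)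
      ultimately show "(\<lambda>n. ?Q (u (n + N)) \<theta>) \<longlonglongrightarrow> F' (a, \<theta>)"
        using u(1) by (simp add: tendsto_at_iff_sequentially o_def)
      show "norm (?Q (u (n + N)) \<theta>) \<le> C" for n
        using N[of "n + N"] u(1) th by (intro Q) auto
    qed
    thus "((\<lambda>h. LINT \<theta>|angular_measure \<nu>. ?Q h \<theta>) \<circ> u) \<longlonglongrightarrow> (LINT \<theta>|angular_measure \<nu>. F' (a, \<theta>))"
      unfolding o_def by (rule LIMSEQ_offset)
  qed
  have eq: "(LINT \<theta>|angular_measure \<nu>. ?Q h \<theta>)
      = ((LINT \<theta>|angular_measure \<nu>. F (a + h, \<theta>)) - (LINT \<theta>|angular_measure \<nu>. F (a, \<theta>))) /\<^sub>R h" for h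
    by (simp add: Bochner_Integration.integral_diff[OF int int])
  have "((\<lambda>h. ((LINT \<theta>|angular_measure \<nu>. F (a + h, \<theta>)) - (LINT \<theta>|angular_measure \<nu>. F (a, \<theta>))) /\<^sub>R h)
      \<longlongrightarrow> (LINT \<theta>|angular_measure \<nu>. F' (a, \<theta>))) (at 0)" using lim unfolding eq .
  thus ?thesis unfolding has_vector_derivative_iff_slope .
qed

lemma bessel_translation_bound:
  assumes nu: "\<nu> > - 1 / 2" and f: "continuous_on UNIV f" and "0 \<le> C"
    and le: "\<And>t. 0 \<le> t \<Longrightarrow> t \<le> \<bar>x\<bar> + \<bar>y\<bar> \<Longrightarrow> norm (f t) \<le> C"
  shows "norm (bessel_translation \<nu> x f y) \<le> C"
  unfolding bessel_translation_eq_angular[OF nu f]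
  by (rule norm_integral_angular_le[OF nu \<open>0 \<le> C\<close> le[OF bessel_radius_nonneg bessel_radius_le]])

lemma integrable_angular_radius:
  fixes f :: "real \<Rightarrow> 'b::euclidean_space"
  assumes nu: "\<nu> > - 1 / 2" and f: "continuous_on UNIV f"
  shows "integrable (angular_measure \<nu>) (\<lambda>\<theta>. f (bessel_radius x y \<theta>))"
  by (intro integrable_angular_measure_continuous[OF nu] continuous_on_UNIV_compose[OF f] continuous_intros)

lemma bessel_translation_linear:
  assumes nu: "\<nu> > - 1 / 2" and f: "continuous_on UNIV f" and g: "continuous_on UNIV g"
  shows "bessel_translation \<nu> x (\<lambda>t. l * f t + g t) y
           = l * bessel_translation \<nu> x f y + bessel_translation \<nu> x g y"
proof -
  have "continuous_on UNIV (\<lambda>t. l * f t + g t)" by (intro continuous_intros f g)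
  thus ?thesis
    by (simp add: bessel_translation_eq_angular[OF nu] f g integrable_angular_radius[OF nu])
qed

lemma bessel_translation_diff:
  assumes nu: "\<nu> > - 1 / 2" and f: "continuous_on UNIV f" and g: "continuous_on UNIV g"
  shows "bessel_translation \<nu> x (\<lambda>t. f t - g t) y
           = bessel_translation \<nu> x f y - bessel_translation \<nu> x g y"
  using bessel_translation_linear[OF nu g f, of x "-1" y] by simp

lemma bessel_translation_sum:
  assumes nu: "\<nu> > - 1 / 2" and f: "\<And>i. continuous_on UNIV (f i)"
  shows "bessel_translation \<nu> x (\<lambda>t. \<Sum>i\<in>I. c i * f i t) y = (\<Sum>i\<in>I. c i * bessel_translation \<nu> x (f i) y)"
proof -
  have "continuous_on UNIV (\<lambda>t. \<Sum>i\<in>I. c i * f i t)" by (intro continuous_intros f)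
  thus ?thesis
    by (simp add: bessel_translation_eq_angular[OF nu] f integrable_angular_radius[OF nu])
qed

lemma continuous_on_bessel_translation:
  assumes nu: "\<nu> > - 1 / 2" and f: "continuous_on UNIV f"
  shows "continuous_on UNIV (bessel_translation \<nu> x f)"
proof -
  have "continuous_on UNIV (\<lambda>y. LINT \<theta>|angular_measure \<nu>. (\<lambda>(y, \<theta>). f (bessel_radius x y \<theta>)) (y, \<theta>))"
    by (intro continuous_on_angular_integral[OF nu])
       (auto simp: case_prod_unfold intro!: continuous_on_UNIV_compose[OF f] continuous_intros)
  thus ?thesis by (simp add: bessel_translation_eq_angular[OF nu f] cong: continuous_on_cong)
qed

section \<open>Monomials\<close>

text \<open>Up to the factor \<open>(-4) ^ n\<close>, the denominators in the power series of \<open>j\<^sub>\<nu>\<close>. With these weights the translate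
  of a monomial has coefficients one.\<close>

definition bessel_factorial :: "real \<Rightarrow> nat \<Rightarrow> real" where
  "bessel_factorial \<nu> n = fact n * pochhammer (\<nu> + 1) n"

lemma pochhammer_nu_pos: "(\<nu>::real) > - 1 / 2 \<Longrightarrow> pochhammer (\<nu> + 1) n > 0"
  by (intro pochhammer_pos) auto

lemma bessel_factorial_pos: "\<nu> > - 1 / 2 \<Longrightarrow> bessel_factorial \<nu> n > 0"
  by (simp add: bessel_factorial_def pochhammer_nu_pos)

text \<open>The Vandermonde convolution of the binomial coefficients with upper entries \<open>i\<close> and \<open>\<nu> + j\<close>, written
  with rising factorials.\<close>

lemma pochhammer_Vandermonde:
  assumes nu: "\<nu> > - 1 / 2"
  shows "(\<Sum>k\<le>j. real (i choose k) / (fact (j - k) * pochhammer (\<nu> + 1) k))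
    = pochhammer (\<nu> + 1) (i + j) / (fact j * pochhammer (\<nu> + 1) i * pochhammer (\<nu> + 1) j)"
proof -
  have p: "pochhammer (\<nu> + 1) n \<noteq> 0" for n using pochhammer_nu_pos[OF nu, of n] by simp
  have summand: "real (i choose k) / (fact (j - k) * pochhammer (\<nu> + 1) k)
      = (real i gchoose k) * ((\<nu> + j) gchoose (j - k)) / pochhammer (\<nu> + 1) j" if "k \<le> j" for k
  proof -
    have "pochhammer (\<nu> + 1) j = pochhammer (\<nu> + 1) k * pochhammer (\<nu> + 1 + k) (j - k)"
      using that by (rule pochhammer_product)
    moreover have "((\<nu> + j) gchoose (j - k)) = pochhammer (\<nu> + 1 + k) (j - k) / fact (j - k)"
      using that by (simp add: gbinomial_pochhammer' of_nat_diff algebra_simps)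
    ultimately show ?thesis using p[of j] p[of k] by (simp add: binomial_gbinomial field_simps)
  qed
  have "(\<Sum>k\<le>j. real (i choose k) / (fact (j - k) * pochhammer (\<nu> + 1) k))
      = (\<Sum>k\<le>j. (real i gchoose k) * ((\<nu> + j) gchoose (j - k)) / pochhammer (\<nu> + 1) j)"
    by (intro sum.cong refl summand) auto
  also have "\<dots> = ((real i + (\<nu> + j)) gchoose j) / pochhammer (\<nu> + 1) j"
    using gbinomial_Vandermonde[of "real i" "\<nu> + j" j]
    by (simp add: sum_divide_distrib[symmetric] atLeast0AtMost)
  also have "((real i + (\<nu> + j)) gchoose j) = pochhammer (\<nu> + 1 + i) j / fact j"
    by (simp add: gbinomial_pochhammer' algebra_simps)
  also have "pochhammer (\<nu> + 1) (i + j) = pochhammer (\<nu> + 1) i * pochhammer (\<nu> + 1 + i) j"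
    by (rule pochhammer_product')
  hence "pochhammer (\<nu> + 1 + i) j = pochhammer (\<nu> + 1) (i + j) / pochhammer (\<nu> + 1) i"
    using p[of i] by (simp add: field_simps)
  finally show ?thesis by (simp add: field_simps)
qed

text \<open>Removes the odd moments of the cosine from a binomial expansion. The even indices may run up to \<open>n\<close>
  rather than \<open>n div 2\<close>, as the binomial coefficients vanish beyond \<open>n\<close>.\<close>

lemma sum_even_indices:
  fixes g :: "nat \<Rightarrow> real"
  assumes "\<And>k. g (2 * k + 1) = 0" "\<And>l. l > n \<Longrightarrow> g l = 0"
  shows "(\<Sum>l\<le>n. g l) = (\<Sum>k\<le>n. g (2 * k))"
proof -
  have "(\<Sum>l\<le>n. g l) = (\<Sum>l\<le>2 * n. g l)"
    by (rule sum.mono_neutral_left) (auto intro: assms(2))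
  also have "(\<Sum>l\<le>2 * n. g l) = (\<Sum>k\<le>n. g (2 * k))"
    by (induction n) (use assms(1) in auto)
  finally show ?thesis .
qed

text \<open>The sum extends over the whole range of \<open>j\<close>, independent of \<open>k\<close>, so that the sums over \<open>k\<close> and \<open>j\<close> can be
  interchanged in the proof of the addition formula.\<close>

lemma shifted_binomial_expansion:
  fixes X Y :: real
  assumes "2 * k \<le> n"
  shows "(X + Y) ^ (n - 2 * k) * (X * Y) ^ k
    = (\<Sum>j\<le>n. (if k \<le> j \<and> k \<le> n - j then real ((n - 2 * k) choose (j - k)) else 0) * X ^ j * Y ^ (n - j))"
proof -
  have "(X + Y) ^ (n - 2 * k) * (X * Y) ^ k
      = (\<Sum>i\<le>n - 2 * k. real ((n - 2 * k) choose i) * X ^ i * Y ^ (n - 2 * k - i) * (X * Y) ^ k)"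
    by (simp add: binomial_ring sum_distrib_right)
  also have "\<dots> = (\<Sum>j\<in>{k..n - k}. real ((n - 2 * k) choose (j - k)) * X ^ j * Y ^ (n - j))"
  proof (rule sum.reindex_bij_witness[where i="\<lambda>j. j - k" and j="\<lambda>i. i + k"])
    fix i assume i: "i \<in> {..n - 2 * k}"
    hence "n - (i + k) = (n - 2 * k - i) + k" using assms by auto
    thus "real (n - 2 * k choose (i + k - k)) * X ^ (i + k) * Y ^ (n - (i + k))
        = real (n - 2 * k choose i) * X ^ i * Y ^ (n - 2 * k - i) * (X * Y) ^ k"
      by (simp add: power_add power_mult_distrib)
  qed (use assms in auto)
  also have "\<dots> = (\<Sum>j\<le>n. (if k \<le> j \<and> k \<le> n - j then real ((n - 2 * k) choose (j - k)) else 0) * X ^ j * Y ^ (n - j))"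
    by (rule sum.mono_neutral_cong_left) (use assms in auto)
  finally show ?thesis .
qed

text \<open>The addition formula for monomials. Expand \<open>(X + Y - 2 x y cos \<theta>) ^ n\<close> with \<open>X = x\<^sup>2\<close> and \<open>Y = y\<^sup>2\<close>, and
  integrate by means of the moments of the cosine. The coefficient of \<open>X ^ j * Y ^ (n - j)\<close> is then a
  sum over the even moments, which is evaluated by the Vandermonde identity.\<close>

lemma angular_integral_radius_power:
  assumes nu: "\<nu> > - 1 / 2"
  shows "(LINT \<theta>|angular_measure \<nu>. bessel_radius x y \<theta> ^ (2 * n)) / bessel_factorial \<nu> n
    = (\<Sum>j\<le>n. (x ^ (2 * j) / bessel_factorial \<nu> j) * (y ^ (2 * (n - j)) / bessel_factorial \<nu> (n - j)))"
proof -
  let ?M = "angular_measure \<nu>"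
  define X where "X = x\<^sup>2"
  define Y where "Y = y\<^sup>2"
  define p where "p = pochhammer (\<nu> + 1)"
  have p: "p k > 0" for k unfolding p_def by (rule pochhammer_nu_pos[OF nu])
  define m where "m = (\<lambda>k. LINT \<theta>|?M. cos \<theta> ^ k)"
  \<comment> \<open>the contribution of the moment of order \<open>2 k\<close> to the coefficient of \<open>X ^ j * Y ^ (n - j)\<close>; it is
    zero for \<open>k > n - j\<close>, so only the condition \<open>k \<le> j\<close> has to be kept in the sums\<close>
  define T where "T = (\<lambda>j k. fact n / fact (n - j) * (real ((n - j) choose k) / (fact (j - k) * p k)))"
  have "(LINT \<theta>|?M. bessel_radius x y \<theta> ^ (2 * n))
      = (LINT \<theta>|?M. (\<Sum>l\<le>n. (real (n choose l) * (- 2 * x * y) ^ l * (X + Y) ^ (n - l)) * cos \<theta> ^ l))"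
  proof (rule Bochner_Integration.integral_cong[OF refl])
    fix \<theta>
    have "bessel_radius x y \<theta> ^ (2 * n) = ((- 2 * x * y * cos \<theta>) + (X + Y)) ^ n"
      unfolding power_mult bessel_radius_square X_def Y_def by (simp add: algebra_simps)
    also have "\<dots> = (\<Sum>l\<le>n. (real (n choose l) * (- 2 * x * y) ^ l * (X + Y) ^ (n - l)) * cos \<theta> ^ l)"
      by (subst binomial_ring, intro sum.cong refl)
         (simp add: power_mult_distrib[of "- 2 * x * y" "cos \<theta>", simplified])
    finally show "bessel_radius x y \<theta> ^ (2 * n)
      = (\<Sum>l\<le>n. (real (n choose l) * (- 2 * x * y) ^ l * (X + Y) ^ (n - l)) * cos \<theta> ^ l)" .
  qed
  also have "\<dots> = (\<Sum>l\<le>n. (real (n choose l) * (- 2 * x * y) ^ l * (X + Y) ^ (n - l)) * m l)"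
    unfolding m_def
    by (subst Bochner_Integration.integral_sum)
       (auto intro!: integrable_angular_measure_continuous[OF nu] continuous_intros)
  also have "\<dots> = (\<Sum>k\<le>n. (real (n choose (2 * k)) * (- 2 * x * y) ^ (2 * k) * (X + Y) ^ (n - 2 * k)) * m (2 * k))"
    by (rule sum_even_indices) (use angular_moment_odd[OF nu] in \<open>auto simp: m_def\<close>)
  also have "\<dots> = (\<Sum>k\<le>n. \<Sum>j\<le>n. (if k \<le> j then T j k else 0) * X ^ j * Y ^ (n - j))"
  proof (rule sum.cong[OF refl])
    fix k assume "k \<in> {..n}"
    show "(real (n choose (2 * k)) * (- 2 * x * y) ^ (2 * k) * (X + Y) ^ (n - 2 * k)) * m (2 * k)
        = (\<Sum>j\<le>n. (if k \<le> j then T j k else 0) * X ^ j * Y ^ (n - j))"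
    proof (cases "2 * k \<le> n")
      case True
      have mk: "m (2 * k) = pochhammer (1 / 2) k / p k"
        unfolding m_def p_def by (rule angular_moment_even[OF nu])
      have f2k: "(fact (2 * k) :: real) = 4 ^ k * pochhammer (1 / 2) k * fact k"
        using fact_double[of k, where 'a=real] by (simp add: power_mult)
      have ph: "pochhammer (1 / 2 :: real) k > 0" by (intro pochhammer_pos) auto
      have "(- 2 * x * y) ^ (2 * k) = 4 ^ k * (X * Y) ^ k"
        by (simp add: X_def Y_def power_mult power_mult_distrib)
      hence "(real (n choose (2 * k)) * (- 2 * x * y) ^ (2 * k) * (X + Y) ^ (n - 2 * k)) * m (2 * k)
          = fact n / (fact (n - 2 * k) * fact k * p k) * ((X + Y) ^ (n - 2 * k) * (X * Y) ^ k)"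
        unfolding mk binomial_fact[OF True] f2k using ph p[of k] by (simp add: field_simps)
      also have "\<dots> = (\<Sum>j\<le>n. (if k \<le> j then T j k else 0) * X ^ j * Y ^ (n - j))"
        unfolding shifted_binomial_expansion[OF True] sum_distrib_left
      proof (rule sum.cong[OF refl])
        fix j assume j: "j \<in> {..n}"
        have Tjk: "fact n / (fact (n - 2 * k) * fact k * p k) * real (n - 2 * k choose (j - k)) = T j k"
          if kj: "k \<le> j" "k \<le> n - j"
        proof -
          have n: "n - 2 * k - (j - k) = n - j - k" using kj by simp
          have b1: "real (n - 2 * k choose (j - k)) = fact (n - 2 * k) / (fact (j - k) * fact (n - 2 * k - (j - k)))"
            using kj j by (intro binomial_fact) auto
          have b2: "real (n - j choose k) = fact (n - j) / (fact k * fact (n - j - k))"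
            using kj by (rule_tac binomial_fact) auto
          show ?thesis unfolding T_def b1 b2 n using p[of k] by (simp add: field_simps)
        qed
        have T0: "T j k = 0" if "\<not> k \<le> n - j" using that by (simp add: T_def)
        show "fact n / (fact (n - 2 * k) * fact k * p k) *
            ((if k \<le> j \<and> k \<le> n - j then real (n - 2 * k choose (j - k)) else 0) * X ^ j * Y ^ (n - j))
          = (if k \<le> j then T j k else 0) * X ^ j * Y ^ (n - j)"
        proof (cases "k \<le> j \<and> k \<le> n - j")
          case True
          have "fact n / (fact (n - 2 * k) * fact k * p k) * (r * u * v) = T j k * u * v"
            if "r = real (n - 2 * k choose (j - k))" for r u v
            using True that by (simp add: Tjk[symmetric])
          thus ?thesis using True by simp
        qed (auto simp: T0)
      qed
      finally show ?thesis .
    next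
      case False
      hence "T j k = 0" if "k \<le> j" for j using that by (auto simp: T_def)
      hence "(\<Sum>j\<le>n. (if k \<le> j then T j k else 0) * X ^ j * Y ^ (n - j)) = 0"
        by (intro sum.neutral) auto
      moreover have "n choose (2 * k) = 0" using False by (intro binomial_eq_0) auto
      ultimately show ?thesis by simp
    qed
  qed
  also have "\<dots> = (\<Sum>j\<le>n. (\<Sum>k\<le>n. if k \<le> j then T j k else 0) * X ^ j * Y ^ (n - j))"
    by (subst sum.swap) (simp add: sum_distrib_right)
  also have "\<dots> = (\<Sum>j\<le>n. bessel_factorial \<nu> n *
      ((x ^ (2 * j) / bessel_factorial \<nu> j) * (y ^ (2 * (n - j)) / bessel_factorial \<nu> (n - j))))"
  proof (rule sum.cong[OF refl])
    fix j assume j: "j \<in> {..n}"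
    have "(\<Sum>k\<le>n. if k \<le> j then T j k else 0) = (\<Sum>k\<le>j. T j k)"
      by (rule sum.mono_neutral_cong_right) (use j in auto)
    also have "\<dots> = fact n / fact (n - j) * (p (n - j + j) / (fact j * p (n - j) * p j))"
      unfolding T_def sum_distrib_left[symmetric] p_def pochhammer_Vandermonde[OF nu] ..
    also have "\<dots> = bessel_factorial \<nu> n / (bessel_factorial \<nu> j * bessel_factorial \<nu> (n - j))"
      using j by (simp add: bessel_factorial_def p_def)
    finally show "(\<Sum>k\<le>n. if k \<le> j then T j k else 0) * X ^ j * Y ^ (n - j) = bessel_factorial \<nu> n *
      ((x ^ (2 * j) / bessel_factorial \<nu> j) * (y ^ (2 * (n - j)) / bessel_factorial \<nu> (n - j)))"
      by (simp add: X_def Y_def power_mult)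
  qed
  finally have *: "(LINT \<theta>|?M. bessel_radius x y \<theta> ^ (2 * n)) = bessel_factorial \<nu> n *
      (\<Sum>j\<le>n. (x ^ (2 * j) / bessel_factorial \<nu> j) * (y ^ (2 * (n - j)) / bessel_factorial \<nu> (n - j)))"
    unfolding sum_distrib_left[symmetric] .
  show ?thesis
    unfolding * using bessel_factorial_pos[OF nu, of n] by (intro nonzero_mult_div_cancel_left) simp
qed

section \<open>The product formula\<close>

definition bessel_term :: "real \<Rightarrow> real \<Rightarrow> nat \<Rightarrow> real" where
  "bessel_term \<nu> s n = (-1) ^ n * (s / 2) ^ (2 * n) / bessel_factorial \<nu> n"

text \<open>Every factor of the rising factorial is at least \<open>1 / 2\<close>; this dominates the Bessel series by an
  exponential series.\<close>

lemma bessel_factorial_ge: "\<nu> > - 1 / 2 \<Longrightarrow> fact n * (1 / 2) ^ n \<le> bessel_factorial \<nu> n"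
  unfolding bessel_factorial_def
proof (rule mult_left_mono)
  assume nu: "\<nu> > - 1 / 2"
  show "(1 / 2) ^ n \<le> pochhammer (\<nu> + 1) n"
  proof (induction n)
    case (Suc n)
    have "(1 / 2) ^ n * (1 / 2) \<le> pochhammer (\<nu> + 1) n * (\<nu> + 1 + real n)"
      using Suc nu pochhammer_nu_pos[OF nu, of n] by (intro mult_mono) auto
    thus ?case by (simp add: pochhammer_Suc)
  qed simp
qed simp

lemma summable_norm_bessel_term:
  assumes nu: "\<nu> > - 1 / 2"
  shows "summable (\<lambda>n. norm (bessel_term \<nu> s n))"
proof (rule summable_comparison_test')
  show "summable (\<lambda>n. inverse (fact n) * (s\<^sup>2 / 2) ^ n)" by (rule summable_exp)
  fix n :: nat
  have p: "bessel_factorial \<nu> n > 0" by (rule bessel_factorial_pos[OF nu])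
  have "norm (bessel_term \<nu> s n) = (s\<^sup>2 / 4) ^ n / bessel_factorial \<nu> n"
    using p by (simp add: bessel_term_def abs_mult power_mult power_divide)
  also have "\<dots> \<le> (s\<^sup>2 / 4) ^ n / (fact n * (1 / 2) ^ n)"
    by (intro divide_left_mono bessel_factorial_ge[OF nu] mult_pos_pos p) auto
  also have "\<dots> = inverse (fact n) * (s\<^sup>2 / 2) ^ n"
  proof -
    have "s\<^sup>2 / 4 = s\<^sup>2 / 2 * (1 / 2)" by simp
    hence e4: "(s\<^sup>2 / 4) ^ n = (s\<^sup>2 / 2) ^ n * (1 / 2) ^ n" by (simp only: power_mult_distrib)
    have cancel: "a * h / (F * h) = inverse F * a" if "h \<noteq> 0" for a h F :: real
      using that by (simp add: divide_inverse mult.commute)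
    show ?thesis unfolding e4 by (rule cancel) simp
  qed
  finally show "norm (norm (bessel_term \<nu> s n)) \<le> inverse (fact n) * (s\<^sup>2 / 2) ^ n" by simp
qed

lemma normalized_bessel_eq_suminf:
  assumes nu: "\<nu> > - 1 / 2"
  shows "normalized_bessel \<nu> s = (\<Sum>n. bessel_term \<nu> s n)"
proof -
  have "Gamma (\<nu> + 1) / (fact n * Gamma (real n + \<nu> + 1)) = 1 / bessel_factorial \<nu> n" for n
  proof -
    have "\<nu> + 1 \<notin> \<int>\<^sub>\<le>\<^sub>0" using nu by (auto elim!: nonpos_Ints_cases)
    hence "pochhammer (\<nu> + 1) n = Gamma (\<nu> + 1 + real n) / Gamma (\<nu> + 1)"
      by (rule pochhammer_Gamma)
    thus ?thesis by (simp add: bessel_factorial_def add_ac)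
  qed
  thus ?thesis unfolding normalized_bessel_def bessel_term_def by simp
qed

lemma sums_angular_integral:
  fixes f :: "nat \<Rightarrow> real \<Rightarrow> real"
  assumes nu: "\<nu> > - 1 / 2" and f: "\<And>n. continuous_on UNIV (f n)"
    and le: "\<And>n \<theta>. norm (f n \<theta>) \<le> K n" and K: "summable K"
  shows "(\<lambda>n. LINT \<theta>|angular_measure \<nu>. f n \<theta>) sums (LINT \<theta>|angular_measure \<nu>. (\<Sum>n. f n \<theta>))"
proof (rule sums_integral)
  show "integrable (angular_measure \<nu>) (f n)" for n
    by (rule integrable_angular_measure_continuous[OF nu f])
  show "AE \<theta> in angular_measure \<nu>. summable (\<lambda>n. norm (f n \<theta>))"
    by (intro AE_I2 summable_comparison_test'[OF K, where N=0]) (use le in simp)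
  have "norm (LINT \<theta>|angular_measure \<nu>. norm (f n \<theta>)) \<le> K n" for n
    by (rule norm_integral_angular_le[OF nu]) (use le[of n] order_trans[OF norm_ge_zero le[of n]] in auto)
  thus "summable (\<lambda>n. LINT \<theta>|angular_measure \<nu>. norm (f n \<theta>))"
    by (intro summable_comparison_test'[OF K, where N=0])
qed

text \<open>The addition formula turns the \<open>n\<close>-th term of the series, integrated over the angle, into the \<open>n\<close>-th
  term of the Cauchy product of the two series on the right.\<close>

lemma normalized_bessel_product:
  assumes nu: "\<nu> > - 1 / 2"
  shows "(LINT \<theta>|angular_measure \<nu>. normalized_bessel \<nu> (l * bessel_radius x y \<theta>))
    = normalized_bessel \<nu> (l * x) * normalized_bessel \<nu> (l * y)"
proof -
  let ?f = "\<lambda>n \<theta>. bessel_term \<nu> (l * bessel_radius x y \<theta>) n"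
  have "(\<lambda>n. LINT \<theta>|angular_measure \<nu>. ?f n \<theta>) sums (LINT \<theta>|angular_measure \<nu>. (\<Sum>n. ?f n \<theta>))"
  proof (rule sums_angular_integral[OF nu])
    show "continuous_on UNIV (?f n)" for n
      unfolding bessel_term_def divide_inverse by (intro continuous_intros)
    show "norm (?f n \<theta>) \<le> norm (bessel_term \<nu> (l * (\<bar>x\<bar> + \<bar>y\<bar>)) n)" for n \<theta>
      using bessel_factorial_pos[OF nu, of n]
      unfolding bessel_term_def norm_divide norm_mult power_mult_distrib power_divide norm_power
      by (intro divide_right_mono mult_left_mono power_mono)
         (auto simp: bessel_radius_le order_trans[OF bessel_radius_nonneg bessel_radius_le])
    show "summable (\<lambda>n. norm (bessel_term \<nu> (l * (\<bar>x\<bar> + \<bar>y\<bar>)) n))"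
      by (rule summable_norm_bessel_term[OF nu])
  qed
  also have "(\<lambda>n. LINT \<theta>|angular_measure \<nu>. ?f n \<theta>)
      = (\<lambda>n. \<Sum>j\<le>n. bessel_term \<nu> (l * x) j * bessel_term \<nu> (l * y) (n - j))"
  proof
    fix n
    have "(LINT \<theta>|angular_measure \<nu>. ?f n \<theta>) = (LINT \<theta>|angular_measure \<nu>.
        (-1) ^ n * (l / 2) ^ (2 * n) / bessel_factorial \<nu> n * bessel_radius x y \<theta> ^ (2 * n))"
      unfolding bessel_term_def
      by (intro Bochner_Integration.integral_cong refl) (simp add: power_mult_distrib power_divide)
    also have "\<dots> = (-1) ^ n * (l / 2) ^ (2 * n) *
        ((LINT \<theta>|angular_measure \<nu>. bessel_radius x y \<theta> ^ (2 * n)) / bessel_factorial \<nu> n)"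
      by simp
    also have "\<dots> = (\<Sum>j\<le>n. bessel_term \<nu> (l * x) j * bessel_term \<nu> (l * y) (n - j))"
      unfolding angular_integral_radius_power[OF nu] sum_distrib_left
    proof (rule sum.cong[OF refl])
      fix j assume "j \<in> {..n}"
      then obtain i where n: "n = j + i" by (auto simp: le_iff_add)
      show "(- 1) ^ n * (l / 2) ^ (2 * n) *
          (x ^ (2 * j) / bessel_factorial \<nu> j * (y ^ (2 * (n - j)) / bessel_factorial \<nu> (n - j)))
        = bessel_term \<nu> (l * x) j * bessel_term \<nu> (l * y) (n - j)"
        by (simp add: n bessel_term_def power_add power_mult_distrib power_divide add_mult_distrib2 mult_ac)
    qed
    finally show "(LINT \<theta>|angular_measure \<nu>. ?f n \<theta>)
      = (\<Sum>j\<le>n. bessel_term \<nu> (l * x) j * bessel_term \<nu> (l * y) (n - j))" .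
  qed
  finally have "(\<lambda>n. \<Sum>j\<le>n. bessel_term \<nu> (l * x) j * bessel_term \<nu> (l * y) (n - j)) sums
     (LINT \<theta>|angular_measure \<nu>. normalized_bessel \<nu> (l * bessel_radius x y \<theta>))"
    by (simp add: normalized_bessel_eq_suminf[OF nu])
  moreover have "(\<lambda>n. \<Sum>j\<le>n. bessel_term \<nu> (l * x) j * bessel_term \<nu> (l * y) (n - j)) sums
     (normalized_bessel \<nu> (l * x) * normalized_bessel \<nu> (l * y))"
    unfolding normalized_bessel_eq_suminf[OF nu]
    by (intro Cauchy_product_sums summable_norm_bessel_term[OF nu])
  ultimately show ?thesis by (rule sums_unique2)
qed

text \<open>The coefficients agree because the even moments of the cosine are quotients of rising factorials.
  The bound \<open>\<bar>normalized_bessel \<nu> s\<bar> \<le> 1\<close>, which is not visible in the power series, follows from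
  this representation.\<close>

lemma normalized_bessel_Poisson:
  assumes nu: "\<nu> > - 1 / 2"
  shows "normalized_bessel \<nu> s = (LINT \<theta>|angular_measure \<nu>. cos (s * cos \<theta>))"
proof -
  let ?f = "\<lambda>n \<theta>. (-1) ^ n * s ^ (2 * n) / fact (2 * n) * cos \<theta> ^ (2 * n)"
  have fsums: "(\<lambda>n. ?f n \<theta>) sums cos (s * cos \<theta>)" for \<theta>
    using cos_paired[of "s * cos \<theta>"] by (simp add: power_mult_distrib mult_ac)
  have "(\<lambda>n. LINT \<theta>|angular_measure \<nu>. ?f n \<theta>) sums (LINT \<theta>|angular_measure \<nu>. (\<Sum>n. ?f n \<theta>))"
  proof (rule sums_angular_integral[OF nu])
    show "continuous_on UNIV (?f n)" for n by (intro continuous_intros) auto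
    show "norm (?f n \<theta>) \<le> norm (\<bar>s\<bar> ^ (2 * n) / fact (2 * n))" for n \<theta>
    proof -
      have "\<bar>cos \<theta>\<bar> ^ (2 * n) \<le> 1" by (rule power_le_one) auto
      hence "\<bar>s\<bar> ^ (2 * n) / fact (2 * n) * \<bar>cos \<theta>\<bar> ^ (2 * n) \<le> \<bar>s\<bar> ^ (2 * n) / fact (2 * n) * 1"
        by (intro mult_left_mono) auto
      thus ?thesis by (simp add: abs_mult power_abs)
    qed
    have "summable (\<lambda>n. norm (inverse (fact n) * \<bar>s\<bar> ^ n))"
      using summable_exp[of "\<bar>s\<bar>"] by simp
    hence "summable ((\<lambda>n. norm (inverse (fact n) * \<bar>s\<bar> ^ n)) \<circ> (\<lambda>n. 2 * n))"
      by (rule summable_reindex) (auto simp: inj_def)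
    thus "summable (\<lambda>n. norm (\<bar>s\<bar> ^ (2 * n) / fact (2 * n)))"
      by (simp add: o_def divide_inverse mult.commute)
  qed
  moreover have "(LINT \<theta>|angular_measure \<nu>. ?f n \<theta>) = bessel_term \<nu> s n" for n
  proof -
    have f2n: "(fact (2 * n) :: real) = 4 ^ n * pochhammer (1 / 2) n * fact n"
      using fact_double[of n, where 'a=real] by (simp add: power_mult)
    have four: "(4 :: real) ^ n = (2 ^ n)\<^sup>2"
      by (simp add: power2_eq_square flip: power_mult_distrib)
    have ph: "pochhammer (1 / 2 :: real) n > 0" by (intro pochhammer_pos) auto
    have "(LINT \<theta>|angular_measure \<nu>. ?f n \<theta>)
        = (-1) ^ n * s ^ (2 * n) / fact (2 * n) * (LINT \<theta>|angular_measure \<nu>. cos \<theta> ^ (2 * n))"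
      by simp
    also have "\<dots> = bessel_term \<nu> s n"
      unfolding angular_moment_even[OF nu] f2n four bessel_term_def bessel_factorial_def
      using ph pochhammer_nu_pos[OF nu, of n] by (simp add: power_divide power_mult field_simps)
    finally show ?thesis .
  qed
  moreover have "(\<Sum>n. ?f n \<theta>) = cos (s * cos \<theta>)" for \<theta>
    using fsums by (rule sums_unique[symmetric])
  ultimately have "bessel_term \<nu> s sums (LINT \<theta>|angular_measure \<nu>. cos (s * cos \<theta>))" by simp
  thus ?thesis unfolding normalized_bessel_eq_suminf[OF nu] by (rule sums_unique[symmetric])
qed

lemma abs_normalized_bessel_le_1: "\<nu> > - 1 / 2 \<Longrightarrow> \<bar>normalized_bessel \<nu> s\<bar> \<le> 1"
  using norm_integral_angular_le[of \<nu> 1 "\<lambda>\<theta>. cos (s * cos \<theta>)"]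
  by (simp add: normalized_bessel_Poisson)

lemma normalized_bessel_minus: "normalized_bessel \<nu> (- s) = normalized_bessel \<nu> s"
  by (simp add: normalized_bessel_def)

lemma continuous_on_normalized_bessel:
  assumes nu: "\<nu> > - 1 / 2"
  shows "continuous_on UNIV (normalized_bessel \<nu>)"
proof -
  have "continuous_on UNIV (\<lambda>s. LINT \<theta>|angular_measure \<nu>. (\<lambda>(s, \<theta>). cos (s * cos \<theta>)) (s, \<theta>))"
    by (intro continuous_on_angular_integral[OF nu]) (auto simp: case_prod_unfold intro!: continuous_intros)
  thus ?thesis by (simp add: normalized_bessel_Poisson[OF nu] cong: continuous_on_cong)
qed

lemma bessel_translation_normalized_bessel:
  assumes nu: "\<nu> > - 1 / 2"
  shows "bessel_translation \<nu> x (\<lambda>s. complex_of_real (normalized_bessel \<nu> (l * s))) y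
    = complex_of_real (normalized_bessel \<nu> (l * x) * normalized_bessel \<nu> (l * y))"
proof -
  have "continuous_on UNIV (\<lambda>s. complex_of_real (normalized_bessel \<nu> (l * s)))"
    by (intro continuous_intros continuous_on_UNIV_compose[OF continuous_on_normalized_bessel[OF nu]])
  thus ?thesis
    by (simp add: bessel_translation_eq_angular[OF nu] normalized_bessel_product[OF nu] del: of_real_mult)
qed

section \<open>Commutativity\<close>

definition bessel_monomial :: "real \<Rightarrow> nat \<Rightarrow> real \<Rightarrow> complex" where
  "bessel_monomial \<nu> n t = complex_of_real (t ^ (2 * n) / bessel_factorial \<nu> n)"

lemma continuous_on_bessel_monomial: "continuous_on UNIV (bessel_monomial \<nu> n)"
  unfolding bessel_monomial_def divide_inverse by (intro continuous_intros)

lemma bessel_translation_monomial: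
  assumes nu: "\<nu> > - 1 / 2"
  shows "bessel_translation \<nu> x (bessel_monomial \<nu> n) y
    = (\<Sum>k\<le>n. bessel_monomial \<nu> k x * bessel_monomial \<nu> (n - k) y)"
proof -
  have "bessel_translation \<nu> x (bessel_monomial \<nu> n) y
      = (LINT \<theta>|angular_measure \<nu>. complex_of_real (bessel_radius x y \<theta> ^ (2 * n) / bessel_factorial \<nu> n))"
    unfolding bessel_translation_eq_angular[OF nu continuous_on_bessel_monomial]
    by (simp add: bessel_monomial_def)
  also have "\<dots> = complex_of_real ((LINT \<theta>|angular_measure \<nu>. bessel_radius x y \<theta> ^ (2 * n)) / bessel_factorial \<nu> n)"
    by (simp only: integral_complex_of_real integral_divide_zero)
  finally show ?thesis
    unfolding angular_integral_radius_power[OF nu] by (simp add: bessel_monomial_def)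
qed

text \<open>By the addition formula the iterated translate is the \<open>n\<close>-th coefficient of the product of three
  generating series, one for each of \<open>x\<close>, \<open>y\<close> and \<open>z\<close>, and this product is commutative.\<close>

lemma bessel_translation_monomial_commute:
  assumes nu: "\<nu> > - 1 / 2"
  shows "bessel_translation \<nu> x (bessel_translation \<nu> y (bessel_monomial \<nu> n)) z
    = bessel_translation \<nu> y (bessel_translation \<nu> x (bessel_monomial \<nu> n)) z"
proof -
  define W where "W = (\<lambda>x. Abs_fps (\<lambda>n. bessel_monomial \<nu> n x))"
  have "bessel_translation \<nu> x (bessel_translation \<nu> y (bessel_monomial \<nu> n)) z
      = fps_nth (W y * (W x * W z)) n" for x y
  proof -
    have "bessel_translation \<nu> y (bessel_monomial \<nu> n)
        = (\<lambda>t. \<Sum>k\<le>n. bessel_monomial \<nu> k y * bessel_monomial \<nu> (n - k) t)"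
      by (rule ext) (rule bessel_translation_monomial[OF nu])
    hence "bessel_translation \<nu> x (bessel_translation \<nu> y (bessel_monomial \<nu> n)) z
        = (\<Sum>k\<le>n. bessel_monomial \<nu> k y * bessel_translation \<nu> x (bessel_monomial \<nu> (n - k)) z)"
      by (simp add: bessel_translation_sum[OF nu continuous_on_bessel_monomial])
    also have "\<dots> = fps_nth (W y * (W x * W z)) n"
      by (simp add: bessel_translation_monomial[OF nu] W_def fps_mult_nth atLeast0AtMost)
    finally show ?thesis .
  qed
  thus ?thesis by (simp add: mult.left_commute)
qed

text \<open>The Weierstrass theorem for the function \<open>u \<mapsto> f (sqrt u)\<close>. Only the values on the nonnegative half-line
  enter a Bessel translation, which is why even polynomials suffice.\<close>

lemma even_polynomial_approximation:
  fixes f :: "real \<Rightarrow> complex"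
  assumes nu: "\<nu> > - 1 / 2" and f: "continuous_on UNIV f" and e: "e > 0"
  obtains c and N :: nat where
    "\<And>t. 0 \<le> t \<Longrightarrow> t \<le> R \<Longrightarrow> norm (f t - (\<Sum>n\<le>N. c n * bessel_monomial \<nu> n t)) \<le> e"
proof -
  let ?S = "{0..R\<^sup>2}"
  let ?b = "bessel_factorial \<nu>"
  have cs: "continuous_on ?S (\<lambda>u. f (sqrt u))"
    by (intro continuous_on_UNIV_compose[OF f] continuous_intros)
  obtain p where p: "real_polynomial_function p" "\<And>u. u \<in> ?S \<Longrightarrow> \<bar>Re (f (sqrt u)) - p u\<bar> < e / 2"
    by (rule Stone_Weierstrass_real_polynomial_function[of ?S "\<lambda>u. Re (f (sqrt u))" "e / 2"])
       (use e in \<open>auto intro!: continuous_intros cs\<close>)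
  obtain q where q: "real_polynomial_function q" "\<And>u. u \<in> ?S \<Longrightarrow> \<bar>Im (f (sqrt u)) - q u\<bar> < e / 2"
    by (rule Stone_Weierstrass_real_polynomial_function[of ?S "\<lambda>u. Im (f (sqrt u))" "e / 2"])
       (use e in \<open>auto intro!: continuous_intros cs\<close>)
  from p(1) obtain a m where a: "p = (\<lambda>u. \<Sum>i\<le>m. a i * u ^ i)"
    unfolding real_polynomial_function_iff_sum by blast
  from q(1) obtain a' m' where a': "q = (\<lambda>u. \<Sum>i\<le>m'. a' i * u ^ i)"
    unfolding real_polynomial_function_iff_sum by blast
  define N where "N = max m m'"
  \<comment> \<open>the factor \<open>?b n\<close> undoes the weight in \<open>bessel_monomial\<close>\<close>
  define c where "c = (\<lambda>n. complex_of_real (?b n) * Complex (if n \<le> m then a n else 0) (if n \<le> m' then a' n else 0))"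
  have sum_c: "(\<Sum>n\<le>N. c n * bessel_monomial \<nu> n t) = Complex (p (t\<^sup>2)) (q (t\<^sup>2))" for t
  proof (rule complex_eqI)
    have t: "c n * bessel_monomial \<nu> n t
        = Complex ((if n \<le> m then a n else 0) * (t\<^sup>2) ^ n) ((if n \<le> m' then a' n else 0) * (t\<^sup>2) ^ n)" for n
      using bessel_factorial_pos[OF nu, of n]
      by (simp add: c_def bessel_monomial_def complex_eq_iff power_mult)
    show "Re (\<Sum>n\<le>N. c n * bessel_monomial \<nu> n t) = Re (Complex (p (t\<^sup>2)) (q (t\<^sup>2)))"
      unfolding t Re_sum complex.sel a
      by (rule sum.mono_neutral_cong_right) (auto simp: N_def)
    show "Im (\<Sum>n\<le>N. c n * bessel_monomial \<nu> n t) = Im (Complex (p (t\<^sup>2)) (q (t\<^sup>2)))"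
      unfolding t Im_sum complex.sel a'
      by (rule sum.mono_neutral_cong_right) (auto simp: N_def)
  qed
  show ?thesis
  proof (rule that[of c N])
    fix t :: real assume t: "0 \<le> t" "t \<le> R"
    hence "t\<^sup>2 \<in> ?S" by (auto intro: power_mono)
    from p(2)[OF this] q(2)[OF this]
    have *: "\<bar>Re (f t - Complex (p (t\<^sup>2)) (q (t\<^sup>2)))\<bar> < e / 2" "\<bar>Im (f t - Complex (p (t\<^sup>2)) (q (t\<^sup>2)))\<bar> < e / 2"
      using t by auto
    show "norm (f t - (\<Sum>n\<le>N. c n * bessel_monomial \<nu> n t)) \<le> e"
      unfolding sum_c using cmod_le[of "f t - Complex (p (t\<^sup>2)) (q (t\<^sup>2))"] * by linarith
  qed
qed

text \<open>The supremum of the modulus of a translate over \<open>[0, R]\<close> is at most that of the function over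
  \<open>[0, R + \<bar>x\<bar>]\<close>. The identity therefore passes from even polynomials to their uniform limits.\<close>

lemma bessel_translation_commute:
  assumes nu: "\<nu> > - 1 / 2" and f: "continuous_on UNIV f"
  shows "bessel_translation \<nu> x (bessel_translation \<nu> y f) z
    = bessel_translation \<nu> y (bessel_translation \<nu> x f) z"
proof -
  note ct = continuous_on_bessel_translation[OF nu]
  have "norm (bessel_translation \<nu> x (bessel_translation \<nu> y f) z
    - bessel_translation \<nu> y (bessel_translation \<nu> x f) z) \<le> e" if e: "e > 0" for e
  proof -
    obtain c N where cN: "\<And>t. 0 \<le> t \<Longrightarrow> t \<le> \<bar>x\<bar> + \<bar>y\<bar> + \<bar>z\<bar>
        \<Longrightarrow> norm (f t - (\<Sum>n\<le>N. c n * bessel_monomial \<nu> n t)) \<le> e / 2"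
      using even_polynomial_approximation[OF nu f, of "e / 2"] e by (metis half_gt_zero)
    define p where "p = (\<lambda>t. \<Sum>n\<le>N. c n * bessel_monomial \<nu> n t)"
    have p: "continuous_on UNIV p"
      unfolding p_def by (intro continuous_intros continuous_on_bessel_monomial)
    have pp: "bessel_translation \<nu> x (bessel_translation \<nu> y p) z
        = (\<Sum>n\<le>N. c n * bessel_translation \<nu> x (bessel_translation \<nu> y (bessel_monomial \<nu> n)) z)" for x y
    proof -
      have "bessel_translation \<nu> y p = (\<lambda>t. \<Sum>n\<le>N. c n * bessel_translation \<nu> y (bessel_monomial \<nu> n) t)"
        unfolding p_def by (rule ext) (rule bessel_translation_sum[OF nu continuous_on_bessel_monomial])
      thus ?thesis by (simp add: bessel_translation_sum[OF nu ct[OF continuous_on_bessel_monomial]])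
    qed
    have approx: "norm (bessel_translation \<nu> u (bessel_translation \<nu> v f) z
        - bessel_translation \<nu> u (bessel_translation \<nu> v p) z) \<le> e / 2"
      if uv: "\<bar>u\<bar> + \<bar>v\<bar> = \<bar>x\<bar> + \<bar>y\<bar>" for u v
      unfolding bessel_translation_diff[OF nu ct[OF f] ct[OF p], symmetric]
    proof (rule bessel_translation_bound[OF nu])
      show "continuous_on UNIV (\<lambda>t. bessel_translation \<nu> v f t - bessel_translation \<nu> v p t)"
        by (intro continuous_intros ct f p)
      fix t :: real assume t: "0 \<le> t" "t \<le> \<bar>u\<bar> + \<bar>z\<bar>"
      show "norm (bessel_translation \<nu> v f t - bessel_translation \<nu> v p t) \<le> e / 2"
        unfolding bessel_translation_diff[OF nu f p, symmetric]
      proof (rule bessel_translation_bound[OF nu])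
        show "continuous_on UNIV (\<lambda>t. f t - p t)" by (intro continuous_intros f p)
        fix s :: real assume "0 \<le> s" "s \<le> \<bar>v\<bar> + \<bar>t\<bar>"
        thus "norm (f s - p s) \<le> e / 2" unfolding p_def using t uv by (intro cN) auto
      qed (use e in simp)
    qed (use e in simp)
    have "bessel_translation \<nu> x (bessel_translation \<nu> y p) z = bessel_translation \<nu> y (bessel_translation \<nu> x p) z"
      unfolding pp by (simp only: bessel_translation_monomial_commute[OF nu, of x y])
    hence "bessel_translation \<nu> x (bessel_translation \<nu> y f) z
          - bessel_translation \<nu> y (bessel_translation \<nu> x f) z
        = (bessel_translation \<nu> x (bessel_translation \<nu> y f) z - bessel_translation \<nu> x (bessel_translation \<nu> y p) z)
          - (bessel_translation \<nu> y (bessel_translation \<nu> x f) z - bessel_translation \<nu> y (bessel_translation \<nu> x p) z)"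
      by simp
    also have "norm \<dots> \<le> e / 2 + e / 2"
      by (rule order_trans[OF norm_triangle_ineq4], rule add_mono; rule approx) simp_all
    finally show ?thesis by simp
  qed
  hence "norm (bessel_translation \<nu> x (bessel_translation \<nu> y f) z
    - bessel_translation \<nu> y (bessel_translation \<nu> x f) z) \<le> 0"
    by (rule field_le_epsilon[where y=0, simplified add_0])
  thus ?thesis by simp
qed

section \<open>Smooth functions and bounds on their derivatives\<close>

definition smooth :: "(real \<Rightarrow> complex) \<Rightarrow> bool" where
  "smooth f \<longleftrightarrow> (\<forall>k. iter_deriv k f differentiable_on UNIV)"

lemma even_smooth_functions_iff: "f \<in> even_smooth_functions \<longleftrightarrow> even_function f \<and> smooth f"
  by (simp add: even_smooth_functions_def smooth_def)

lemma iter_deriv_0 [simp]: "iter_deriv 0 f = f"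
  by (simp add: iter_deriv_def)

lemma iter_deriv_Suc: "iter_deriv (Suc k) f = iter_deriv k (iter_deriv 1 f)"
  unfolding iter_deriv_def by (simp only: funpow_Suc_right One_nat_def o_apply funpow_0)

lemma iter_deriv_2: "iter_deriv 2 f = iter_deriv 1 (iter_deriv 1 f)"
  using iter_deriv_Suc[of 1 f] by (simp add: numeral_2_eq_2)

lemma iter_deriv_1_eqI: "(\<And>t. (f has_vector_derivative g t) (at t)) \<Longrightarrow> iter_deriv 1 f = g"
  by (auto simp: iter_deriv_def fun_eq_iff intro!: vector_derivative_at)

lemma smooth_differentiable: "smooth f \<Longrightarrow> f differentiable_on UNIV"
  unfolding smooth_def by (metis iter_deriv_0)

lemma smooth_deriv: "smooth f \<Longrightarrow> smooth (iter_deriv 1 f)"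
  unfolding smooth_def by (metis iter_deriv_Suc)

lemma smooth_has_deriv:
  assumes "smooth f"
  shows "(f has_vector_derivative iter_deriv 1 f t) (at t)"
proof -
  have "f differentiable (at t)"
    using smooth_differentiable[OF assms] by (auto simp: differentiable_on_def)
  thus ?thesis by (simp add: vector_derivative_works[symmetric] iter_deriv_def)
qed

lemma smooth_continuous: "smooth f \<Longrightarrow> continuous_on UNIV f"
  using smooth_differentiable differentiable_imp_continuous_on by blast

lemma smooth_iter_deriv: "smooth f \<Longrightarrow> smooth (iter_deriv k f)"
  by (induction k arbitrary: f) (simp_all only: iter_deriv_0 iter_deriv_Suc smooth_deriv)

lemma iter_deriv_diff:
  assumes "smooth f" "smooth g"
  shows "iter_deriv k (\<lambda>t. f t - g t) = (\<lambda>t. iter_deriv k f t - iter_deriv k g t)"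
  using assms
proof (induction k arbitrary: f g)
  case (Suc k)
  have "iter_deriv 1 (\<lambda>t. f t - g t) = (\<lambda>t. iter_deriv 1 f t - iter_deriv 1 g t)"
    by (intro iter_deriv_1_eqI has_vector_derivative_diff smooth_has_deriv Suc.prems)
  thus ?case unfolding iter_deriv_Suc using Suc.IH[OF smooth_deriv[OF Suc.prems(1)] smooth_deriv[OF Suc.prems(2)]] by simp
qed simp

lemma has_vector_derivative_complex_of_real: "(complex_of_real has_vector_derivative 1) (at t)"
  using has_vector_derivative_of_real[OF DERIV_ident] by simp

text \<open>The function has \<open>n\<close> derivatives, and these and the function itself are bounded by \<open>C\<close> on \<open>[-R, R]\<close>.
  The recursion on the order allows one induction to prove smoothness together with the estimates
  for the seminorms.\<close>

fun deriv_bound :: "nat \<Rightarrow> real \<Rightarrow> real \<Rightarrow> (real \<Rightarrow> complex) \<Rightarrow> bool" where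
  "deriv_bound 0 R C f \<longleftrightarrow> (\<forall>t. \<bar>t\<bar> \<le> R \<longrightarrow> norm (f t) \<le> C)"
| "deriv_bound (Suc n) R C f \<longleftrightarrow> (\<forall>t. \<bar>t\<bar> \<le> R \<longrightarrow> norm (f t) \<le> C) \<and>
     f differentiable_on UNIV \<and> deriv_bound n R C (iter_deriv 1 f)"

lemma deriv_bound_norm: "deriv_bound n R C f \<Longrightarrow> \<bar>t\<bar> \<le> R \<Longrightarrow> norm (f t) \<le> C"
  by (cases n) auto

lemma deriv_boundI:
  assumes d: "\<And>t. (f has_vector_derivative g t) (at t)"
    and "\<And>t. \<bar>t\<bar> \<le> R \<Longrightarrow> norm (f t) \<le> C" and "deriv_bound n R C g"
  shows "deriv_bound (Suc n) R C f"
proof -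
  have "f differentiable_on UNIV"
    using d by (auto simp: differentiable_on_def intro: differentiableI_vector)
  thus ?thesis using assms iter_deriv_1_eqI[OF d] by simp
qed

lemma deriv_bound_has_deriv:
  assumes "deriv_bound (Suc n) R C f"
  shows "(f has_vector_derivative iter_deriv 1 f t) (at t)"
proof -
  have "f differentiable (at t)"
    using assms by (auto simp: differentiable_on_def)
  thus ?thesis by (simp add: vector_derivative_works[symmetric] iter_deriv_def)
qed

lemma deriv_bound_mono: "deriv_bound n R C f \<Longrightarrow> C \<le> C' \<Longrightarrow> deriv_bound n R C' f"
  by (induction n arbitrary: f) force+

lemma deriv_bound_SucD: "deriv_bound (Suc n) R C f \<Longrightarrow> deriv_bound n R C f"
  by (induction n arbitrary: f) auto

lemma deriv_bound_iff:
  assumes "smooth f"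
  shows "deriv_bound n R C f \<longleftrightarrow> (\<forall>k\<le>n. \<forall>t. \<bar>t\<bar> \<le> R \<longrightarrow> norm (iter_deriv k f t) \<le> C)"
  using assms
proof (induction n arbitrary: f)
  case (Suc n)
  have "(\<forall>k\<le>Suc n. P k) \<longleftrightarrow> P 0 \<and> (\<forall>k\<le>n. P (Suc k))" for P
  proof safe
    fix k assume "P 0" "\<forall>k\<le>n. P (Suc k)" "k \<le> Suc n"
    thus "P k" by (cases k) auto
  qed auto
  from this[of "\<lambda>k. \<forall>t. \<bar>t\<bar> \<le> R \<longrightarrow> norm (iter_deriv k f t) \<le> C"]
  show ?case
    unfolding deriv_bound.simps Suc.IH[OF smooth_deriv[OF Suc.prems]] iter_deriv_Suc
    using smooth_differentiable[OF Suc.prems] by simp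
qed simp

lemma smoothI:
  assumes "\<And>n. \<exists>R C. deriv_bound n R C f"
  shows "smooth f"
  unfolding smooth_def
proof
  fix k
  obtain R C where "deriv_bound (Suc k) R C f" using assms by blast
  thus "iter_deriv k f differentiable_on UNIV"
  proof (induction k arbitrary: f)
    case (Suc k)
    hence "deriv_bound (Suc k) R C (iter_deriv 1 f)" by simp
    from Suc.IH[OF this] show ?case by (simp only: iter_deriv_Suc)
  qed simp
qed

lemma smooth_bounded_derivs:
  assumes "smooth f"
  obtains C where "C \<ge> 0" "deriv_bound n R C f"
proof -
  have bdd: "\<exists>C\<ge>0. \<forall>t. \<bar>t\<bar> \<le> R \<longrightarrow> norm (f t) \<le> C" if "smooth f" for f
  proof -
    have "bounded (f ` {-R..R})"
      by (intro compact_imp_bounded compact_continuous_image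
           continuous_on_subset[OF smooth_continuous[OF that]]) auto
    then obtain C where C: "C > 0" "\<forall>v\<in>f ` {-R..R}. norm v \<le> C" unfolding bounded_pos by blast
    show ?thesis by (intro exI[of _ C]) (use C in \<open>auto simp: abs_le_iff\<close>)
  qed
  from assms have "\<exists>C\<ge>0. deriv_bound n R C f"
  proof (induction n arbitrary: f)
    case 0
    thus ?case using bdd by simp
  next
    case (Suc n)
    obtain C where C: "C \<ge> 0" "\<forall>t. \<bar>t\<bar> \<le> R \<longrightarrow> norm (f t) \<le> C" using bdd[OF Suc.prems] by blast
    obtain C' where C': "C' \<ge> 0" "deriv_bound n R C' (iter_deriv 1 f)"
      using Suc.IH[OF smooth_deriv[OF Suc.prems]] by blast
    have "deriv_bound (Suc n) R (max C C') f"
      using C C'(2) by (intro deriv_boundI[OF smooth_has_deriv[OF Suc.prems]])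
        (auto intro: deriv_bound_mono order_trans[OF _ max.cobounded1])
    thus ?case using C(1) by (intro exI[of _ "max C C'"]) auto
  qed
  thus ?thesis using that by blast
qed

lemma deriv_bound_add:
  assumes "deriv_bound n R C f" "deriv_bound n R C' g"
  shows "deriv_bound n R (C + C') (\<lambda>t. f t + g t)"
  using assms
proof (induction n arbitrary: f g)
  case 0
  thus ?case by (auto intro: norm_triangle_mono)
next
  case (Suc n)
  show ?case
  proof (rule deriv_boundI)
    show "((\<lambda>t. f t + g t) has_vector_derivative iter_deriv 1 f t + iter_deriv 1 g t) (at t)" for t
      using Suc.prems by (intro has_vector_derivative_add deriv_bound_has_deriv)
    show "deriv_bound n R (C + C') (\<lambda>t. iter_deriv 1 f t + iter_deriv 1 g t)"
      using Suc.prems by (intro Suc.IH) auto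
  qed (use Suc.prems in \<open>auto intro: norm_triangle_mono\<close>)
qed

text \<open>By the Leibniz rule each differentiation doubles the number of terms, whence the factor \<open>2 ^ n\<close>.\<close>

lemma deriv_bound_mult:
  assumes "deriv_bound n R C f" "deriv_bound n R C' g"
  shows "deriv_bound n R (2 ^ n * (C * C')) (\<lambda>t. f t * g t)"
  using assms
proof (induction n arbitrary: f g)
  case 0
  thus ?case by (auto simp: norm_mult intro!: mult_mono intro: order_trans[OF norm_ge_zero])
next
  case (Suc n)
  show ?case
  proof (rule deriv_boundI)
    show "((\<lambda>t. f t * g t) has_vector_derivative f t * iter_deriv 1 g t + iter_deriv 1 f t * g t) (at t)" for t
      using Suc.prems by (intro has_vector_derivative_mult deriv_bound_has_deriv)
    have "deriv_bound n R (2 ^ n * (C * C') + 2 ^ n * (C * C'))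
        (\<lambda>t. f t * iter_deriv 1 g t + iter_deriv 1 f t * g t)"
      using Suc.prems deriv_bound_SucD[OF Suc.prems(1)] deriv_bound_SucD[OF Suc.prems(2)]
      by (intro deriv_bound_add Suc.IH) auto
    thus "deriv_bound n R (2 ^ Suc n * (C * C')) (\<lambda>t. f t * iter_deriv 1 g t + iter_deriv 1 f t * g t)"
      by (simp add: mult_ac)
    fix t assume t: "\<bar>t\<bar> \<le> R"
    have b: "norm (f t) \<le> C" "norm (g t) \<le> C'"
      using deriv_bound_norm[OF Suc.prems(1) t] deriv_bound_norm[OF Suc.prems(2) t] by auto
    hence nn: "0 \<le> C" "0 \<le> C'" using norm_ge_zero order_trans by blast+
    have "norm (f t * g t) \<le> 1 * (C * C')"
      using b nn by (simp add: norm_mult mult_mono)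
    also have "\<dots> \<le> 2 ^ Suc n * (C * C')"
      using nn one_le_power[of "2::real" "Suc n"] by (intro mult_right_mono) auto
    finally show "norm (f t * g t) \<le> 2 ^ Suc n * (C * C')" .
  qed
qed

lemma deriv_bound_const: "norm c \<le> C \<Longrightarrow> deriv_bound n R C (\<lambda>_. c)"
proof (induction n arbitrary: c)
  case (Suc n)
  have "0 \<le> C" using Suc.prems norm_ge_zero order_trans by blast
  thus ?case using Suc by (intro deriv_boundI[where g="\<lambda>_. 0"]) auto
qed simp

lemma deriv_bound_of_real: "deriv_bound n R (max \<bar>R\<bar> 1) complex_of_real"
proof (cases n)
  case (Suc m)
  have "deriv_bound (Suc m) R (max \<bar>R\<bar> 1) complex_of_real"
    by (rule deriv_boundI[where g="\<lambda>_. 1"])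
       (auto intro!: deriv_bound_const has_vector_derivative_complex_of_real)
  thus ?thesis using Suc by simp
qed auto

lemma smooth_const: "smooth (\<lambda>_. c)"
  by (rule smoothI) (blast intro: deriv_bound_const)

lemma smooth_mult: "smooth f \<Longrightarrow> smooth g \<Longrightarrow> smooth (\<lambda>t. f t * g t)"
  by (rule smoothI) (metis deriv_bound_mult smooth_bounded_derivs)

lemma smooth_add: "smooth f \<Longrightarrow> smooth g \<Longrightarrow> smooth (\<lambda>t. f t + g t)"
  by (rule smoothI) (metis deriv_bound_add smooth_bounded_derivs)

lemma smooth_diff: "smooth f \<Longrightarrow> smooth g \<Longrightarrow> smooth (\<lambda>t. f t - g t)"
  using smooth_add[of f "\<lambda>t. (-1) * g t"] smooth_mult[OF smooth_const[of "-1"], of g] by simp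

section \<open>Chirps\<close>

definition chirp :: "real \<Rightarrow> real \<Rightarrow> complex" where
  "chirp \<alpha> t = exp (\<i> / 2 * complex_of_real (\<alpha> * t\<^sup>2))"

lemma chirp_deriv: "(chirp \<alpha> has_vector_derivative \<i> * complex_of_real \<alpha> * (complex_of_real t * chirp \<alpha> t)) (at t)"
proof -
  have "((\<lambda>t. exp (\<i> / 2 * complex_of_real (\<alpha> * t\<^sup>2))) has_vector_derivative
      exp (\<i> / 2 * complex_of_real (\<alpha> * t\<^sup>2)) * (\<i> / 2 * complex_of_real (2 * \<alpha> * t))) (at t)"
  proof -
    have "((\<lambda>t. \<alpha> * t\<^sup>2) has_real_derivative 2 * \<alpha> * t) (at t)"
      by (auto intro!: derivative_eq_intros)
    from has_vector_derivative_mult_right[OF has_vector_derivative_of_real[OF this], of "\<i> / 2"]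
    have "((\<lambda>t. \<i> / 2 * complex_of_real (\<alpha> * t\<^sup>2)) has_vector_derivative \<i> / 2 * complex_of_real (2 * \<alpha> * t)) (at t)" .
    from field_vector_diff_chain_at[OF this DERIV_exp] show ?thesis
      by (simp add: o_def mult.commute)
  qed
  thus ?thesis unfolding chirp_def by (simp add: mult_ac)
qed

lemma smooth_chirp: "smooth (chirp \<alpha>)"
proof (rule smoothI)
  show "\<exists>R C. deriv_bound n R C (chirp \<alpha>)" for n
  proof -
    have "\<exists>C. deriv_bound n 1 C (chirp \<alpha>)"
    proof (induction n)
      case 0
      show ?case by (auto simp: chirp_def)
    next
      case (Suc n)
      then obtain C where "deriv_bound n 1 C (chirp \<alpha>)" by blast
      hence "deriv_bound n 1 (2 ^ n * (norm (\<i> * complex_of_real \<alpha>) * (2 ^ n * (max \<bar>1\<bar> 1 * C))))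
          (\<lambda>t. \<i> * complex_of_real \<alpha> * (complex_of_real t * chirp \<alpha> t))" (is "deriv_bound _ _ ?D _")
        by (intro deriv_bound_mult deriv_bound_const deriv_bound_of_real order_refl)
      hence "deriv_bound (Suc n) 1 (max 1 ?D) (chirp \<alpha>)"
        by (intro deriv_boundI[OF chirp_deriv]) (auto intro: deriv_bound_mono simp: chirp_def)
      thus ?case by blast
    qed
    thus ?thesis by blast
  qed
qed

lemma even_chirp: "even_function (chirp \<alpha>)"
  by (simp add: even_function_def chirp_def)

lemma chirp_minus_mult [simp]: "chirp \<alpha> t * (chirp (- \<alpha>) t * z) = z" "chirp (- \<alpha>) t * (chirp \<alpha> t * z) = z"
  by (simp_all add: chirp_def mult.assoc[symmetric] exp_add[symmetric])

lemma norm_chirp [simp]: "norm (chirp \<alpha> t) = 1"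
  by (simp add: chirp_def)

lemma continuous_on_chirp: "continuous_on UNIV (chirp \<alpha>)"
  by (rule smooth_continuous[OF smooth_chirp])

section \<open>The radial derivative\<close>

text \<open>For \<open>k = 0\<close> this is the difference quotient \<open>(G s - G 0) / s\<close> of a primitive \<open>G\<close> of \<open>g\<close>, in a form that is
  smooth at \<open>0\<close>. The weight \<open>t ^ k\<close> arises from \<open>k\<close> differentiations under the integral sign.\<close>

definition dilation_mean :: "nat \<Rightarrow> (real \<Rightarrow> complex) \<Rightarrow> real \<Rightarrow> complex" where
  "dilation_mean k g s = integral {0..1} (\<lambda>t. complex_of_real (t ^ k) * g (t * s))"

lemma dilation_mean_deriv:
  assumes g: "smooth g"
  shows "(dilation_mean k g has_vector_derivative dilation_mean (Suc k) (iter_deriv 1 g) s) (at s)"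
proof -
  note c = continuous_on_UNIV_compose[OF smooth_continuous[OF g]]
    continuous_on_UNIV_compose[OF smooth_continuous[OF smooth_deriv[OF g]]]
  have "((\<lambda>s. integral (cbox 0 1) (\<lambda>t. complex_of_real (t ^ k) * g (t * s))) has_vector_derivative
      integral (cbox 0 1) (\<lambda>t. complex_of_real (t ^ Suc k) * iter_deriv 1 g (t * s))) (at s within UNIV)"
  proof (rule leibniz_rule_vector_derivative)
    fix s t :: real
    have "((\<lambda>s. t * s) has_vector_derivative t) (at s)"
      unfolding has_real_derivative_iff_has_vector_derivative[symmetric] by (auto intro!: derivative_eq_intros)
    from vector_diff_chain_at[OF this smooth_has_deriv[OF g]]
    have "((\<lambda>s. g (t * s)) has_vector_derivative t *\<^sub>R iter_deriv 1 g (t * s)) (at s)"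
      by (simp add: o_def)
    from has_vector_derivative_mult[OF has_vector_derivative_const this, of "complex_of_real (t ^ k)"]
    show "((\<lambda>s. complex_of_real (t ^ k) * g (t * s)) has_vector_derivative
        complex_of_real (t ^ Suc k) * iter_deriv 1 g (t * s)) (at s within UNIV)"
      by (simp add: scaleR_conv_of_real mult_ac)
    show "(\<lambda>t. complex_of_real (t ^ k) * g (t * s)) integrable_on cbox 0 1"
      by (intro integrable_continuous continuous_intros c)
  qed (auto simp: case_prod_unfold simp del: One_nat_def intro!: continuous_intros c)
  thus ?thesis by (simp add: dilation_mean_def[abs_def])
qed

lemma norm_dilation_mean_le:
  assumes g: "continuous_on UNIV g" and le: "\<And>t. \<bar>t\<bar> \<le> \<bar>s\<bar> \<Longrightarrow> norm (g t) \<le> C"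
  shows "norm (dilation_mean k g s) \<le> C"
proof -
  have "norm (dilation_mean k g s) \<le> C * (1 - 0)"
    unfolding dilation_mean_def
  proof (rule integral_bound)
    show "continuous_on {0..1} (\<lambda>t. complex_of_real (t ^ k) * g (t * s))"
      by (intro continuous_intros continuous_on_UNIV_compose[OF g])
    fix t :: real assume t: "t \<in> {0..1}"
    have "norm (complex_of_real (t ^ k) * g (t * s)) \<le> 1 * norm (g (t * s))"
      unfolding norm_mult using t by (intro mult_right_mono) (auto simp: norm_power power_le_one)
    also have "norm (g (t * s)) \<le> C"
      using t by (intro le) (simp add: abs_mult mult_left_le_one_le)
    finally show "norm (complex_of_real (t ^ k) * g (t * s)) \<le> C" by simp
  qed simp
  thus ?thesis by simp
qed

lemma deriv_bound_dilation_mean: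
  assumes "smooth g" "deriv_bound n R C g"
  shows "deriv_bound n R C (dilation_mean k g)"
proof -
  have le: "norm (dilation_mean k g t) \<le> C" if "smooth g" "deriv_bound n R C g" "\<bar>t\<bar> \<le> R" for g k n t
    using that by (intro norm_dilation_mean_le smooth_continuous) (auto intro: deriv_bound_norm)
  from assms show ?thesis
  proof (induction n arbitrary: g k)
    case 0
    thus ?case using le[of g 0] by auto
  next
    case (Suc n)
    show ?case
      using Suc.prems smooth_deriv[OF Suc.prems(1)]
      by (intro deriv_boundI[OF dilation_mean_deriv] Suc.IH le[where n="Suc n"]) auto
  qed
qed

lemma smooth_dilation_mean: "smooth g \<Longrightarrow> smooth (dilation_mean k g)"
  by (rule smoothI) (metis deriv_bound_dilation_mean smooth_bounded_derivs)

text \<open>The quotient \<open>f' t / t\<close> of an even smooth function. Being a mean of \<open>f''\<close>, it is smooth at \<open>0\<close> and its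
  derivatives are bounded by those of \<open>f\<close>, two orders higher.\<close>

definition radial_deriv :: "(real \<Rightarrow> complex) \<Rightarrow> real \<Rightarrow> complex" where
  "radial_deriv f = dilation_mean 0 (iter_deriv 2 f)"

lemma deriv_reflect:
  assumes "smooth f" "\<And>t. f (- t) = c * f t"
  shows "iter_deriv 1 f (- t) = - c * iter_deriv 1 f t"
proof -
  have "((\<lambda>t. - t) has_vector_derivative - 1) (at t)"
    unfolding has_real_derivative_iff_has_vector_derivative[symmetric] by (auto intro!: derivative_eq_intros)
  from vector_diff_chain_at[OF this smooth_has_deriv[OF assms(1)]]
  have "((\<lambda>t. f (- t)) has_vector_derivative - iter_deriv 1 f (- t)) (at t)"
    by (simp add: o_def)
  moreover have "((\<lambda>t. f (- t)) has_vector_derivative c * iter_deriv 1 f t) (at t)"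
    unfolding assms(2)
    using has_vector_derivative_mult[OF has_vector_derivative_const smooth_has_deriv[OF assms(1)], of c] by simp
  ultimately show ?thesis
    using vector_derivative_unique_at by (metis minus_equation_iff mult_minus_left)
qed

lemma even_deriv_0: "f \<in> even_smooth_functions \<Longrightarrow> iter_deriv 1 f 0 = 0"
  using deriv_reflect[of f 1 0] by (simp add: even_smooth_functions_iff even_function_def)

lemma even_smooth_radial_deriv:
  assumes f: "f \<in> even_smooth_functions"
  shows "radial_deriv f \<in> even_smooth_functions"
proof -
  have s: "smooth f" and e: "\<And>t. f (- t) = f t"
    using f by (auto simp: even_smooth_functions_iff even_function_def)
  have "iter_deriv 1 f (- t) = - 1 * iter_deriv 1 f t" for t
    using deriv_reflect[OF s, of 1 t] e by simp
  hence "iter_deriv 2 f (- t) = iter_deriv 2 f t" for t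
    unfolding iter_deriv_2 using deriv_reflect[OF smooth_deriv[OF s], of "-1" t] by simp
  hence "even_function (radial_deriv f)"
    by (simp add: even_function_def radial_deriv_def dilation_mean_def)
  moreover have "smooth (radial_deriv f)"
    unfolding radial_deriv_def by (intro smooth_dilation_mean smooth_iter_deriv s)
  ultimately show ?thesis by (simp add: even_smooth_functions_iff)
qed

text \<open>The fundamental theorem of calculus on the segment from \<open>0\<close> to \<open>s\<close>; the derivative of an even function
  vanishes at \<open>0\<close>.\<close>

lemma deriv_eq_radial_deriv:
  assumes f: "f \<in> even_smooth_functions"
  shows "iter_deriv 1 f s = complex_of_real s * radial_deriv f s"
proof -
  have sm: "smooth f" using f by (simp add: even_smooth_functions_iff)
  have c: "continuous_on UNIV (iter_deriv 2 f)" by (intro smooth_continuous smooth_iter_deriv sm)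
  have "((\<lambda>t. s *\<^sub>R iter_deriv 2 f (t * s)) has_integral (iter_deriv 1 f (1 * s) - iter_deriv 1 f (0 * s))) {0..1}"
  proof (rule fundamental_theorem_of_calculus)
    fix t :: real
    have "((\<lambda>t. t * s) has_vector_derivative s) (at t)"
      unfolding has_real_derivative_iff_has_vector_derivative[symmetric] by (auto intro!: derivative_eq_intros)
    from vector_diff_chain_at[OF this smooth_has_deriv[OF smooth_deriv[OF sm]]]
    show "((\<lambda>t. iter_deriv 1 f (t * s)) has_vector_derivative s *\<^sub>R iter_deriv 2 f (t * s)) (at t within {0..1})"
      unfolding iter_deriv_2 by (simp add: o_def has_vector_derivative_at_within)
  qed simp
  from integral_unique[OF this]
  have "iter_deriv 1 f s = integral {0..1} (\<lambda>t. s *\<^sub>R iter_deriv 2 f (t * s))"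
    unfolding mult_1_left mult_zero_left even_deriv_0[OF f] diff_0_right by (rule sym)
  thus ?thesis by (simp add: radial_deriv_def dilation_mean_def scaleR_conv_of_real)
qed

lemma deriv2_eq_radial_deriv:
  assumes f: "f \<in> even_smooth_functions"
  shows "iter_deriv 2 f s = radial_deriv f s + complex_of_real (s\<^sup>2) * radial_deriv (radial_deriv f) s"
proof -
  have 1: "iter_deriv 1 f = (\<lambda>s. complex_of_real s * radial_deriv f s)"
    by (rule ext) (rule deriv_eq_radial_deriv[OF f])
  have sm: "smooth (radial_deriv f)" using even_smooth_radial_deriv[OF f] by (simp add: even_smooth_functions_iff)
  have "iter_deriv 2 f s = complex_of_real s * iter_deriv 1 (radial_deriv f) s + 1 * radial_deriv f s"
    unfolding iter_deriv_2 1
    by (rule fun_cong[OF iter_deriv_1_eqI])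
       (rule has_vector_derivative_mult[OF has_vector_derivative_complex_of_real smooth_has_deriv[OF sm]])
  thus ?thesis
    unfolding deriv_eq_radial_deriv[OF even_smooth_radial_deriv[OF f]] by (simp add: power2_eq_square)
qed

text \<open>Writing \<open>f' t = t * q t\<close> with a continuous \<open>q\<close> avoids a separate limit at \<open>0\<close>; the next lemma does the
  same for the quotient in the differential operator.\<close>

lemma radial_deriv_eqI:
  assumes f: "f \<in> even_smooth_functions" and q: "continuous_on UNIV q"
    and eq: "\<And>t. iter_deriv 1 f t = complex_of_real t * q t"
  shows "radial_deriv f = q"
proof
  have c: "continuous_on UNIV (radial_deriv f)"
    using even_smooth_radial_deriv[OF f] by (simp add: even_smooth_functions_iff smooth_continuous)
  have ne: "radial_deriv f t = q t" if "t \<noteq> 0" for t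
    using eq[of t] deriv_eq_radial_deriv[OF f, of t] that by simp
  have lim: "(radial_deriv f \<longlongrightarrow> radial_deriv f 0) (at 0)" "(q \<longlongrightarrow> q 0) (at 0)"
    using c q by (auto simp: continuous_on_def)
  have "\<forall>\<^sub>F t in at 0. q t = radial_deriv f t"
    using ne by (auto simp: eventually_at_filter)
  from tendsto_unique[OF trivial_limit_at lim(1) Lim_transform_eventually[OF lim(2) this]]
  have "radial_deriv f 0 = q 0" .
  thus "radial_deriv f t = q t" for t using ne by (cases "t = 0") auto
qed

lemma deriv_quotient_eqI:
  assumes q: "continuous_on UNIV q" and eq: "\<And>t. iter_deriv 1 g t = complex_of_real t * q t"
  shows "deriv_quotient g t = q t"
proof (cases "t = 0")
  case True
  have "(q \<longlongrightarrow> q 0) (at 0)" using q by (auto simp: continuous_on_def)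
  moreover have "\<forall>\<^sub>F t in at 0. q t = iter_deriv 1 g t / complex_of_real t"
    by (auto simp: eventually_at_filter eq simp del: One_nat_def)
  ultimately have "((\<lambda>t. iter_deriv 1 g t / complex_of_real t) \<longlongrightarrow> q 0) (at 0)"
    by (rule Lim_transform_eventually)
  hence "Lim (at 0) (\<lambda>t. iter_deriv 1 g t / complex_of_real t) = q 0"
    by (rule tendsto_Lim[OF trivial_limit_at])
  thus ?thesis using True by (simp add: deriv_quotient_def)
qed (simp add: deriv_quotient_def eq del: One_nat_def)

section \<open>Translates of smooth functions\<close>

lemma angular_integral_reflect:
  fixes g :: "real \<Rightarrow> 'b::euclidean_space"
  assumes nu: "\<nu> > - 1 / 2" and [measurable]: "g \<in> borel_measurable borel"
  shows "(LINT \<theta>|angular_measure \<nu>. g (pi - \<theta>)) = (LINT \<theta>|angular_measure \<nu>. g \<theta>)"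
proof -
  have "(LINT \<theta>|angular_measure \<nu>. g \<theta>) = (LINT \<theta>|lborel. angular_density \<nu> \<theta> *\<^sub>R g \<theta>)"
    unfolding angular_measure_def by (subst integral_density) (auto simp: angular_density_nonneg[OF nu])
  also have "\<dots> = (LINT \<theta>|lborel. angular_density \<nu> (pi - \<theta>) *\<^sub>R g (pi - \<theta>))"
    by (subst lborel_integral_real_affine[where c="-1" and t=pi]) auto
  also have "\<dots> = (LINT \<theta>|lborel. angular_density \<nu> \<theta> *\<^sub>R g (pi - \<theta>))"
    by (intro Bochner_Integration.integral_cong refl) (auto simp: angular_density_def indicator_def)
  also have "\<dots> = (LINT \<theta>|angular_measure \<nu>. g (pi - \<theta>))"
    unfolding angular_measure_def by (subst integral_density) (auto simp: angular_density_nonneg[OF nu])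
  finally show ?thesis by simp
qed

lemma bessel_translation_even:
  assumes nu: "\<nu> > - 1 / 2" and f: "continuous_on UNIV f"
  shows "even_function (bessel_translation \<nu> x f)"
  unfolding even_function_def
proof
  fix y
  have m: "(\<lambda>\<theta>. f (bessel_radius x y \<theta>)) \<in> borel_measurable borel"
    by (intro borel_measurable_continuous_onI continuous_on_UNIV_compose[OF f] continuous_intros)
  have "bessel_radius x (- y) \<theta> = bessel_radius x y (pi - \<theta>)" for \<theta>
    by (simp add: bessel_radius_def)
  thus "bessel_translation \<nu> x f (- y) = bessel_translation \<nu> x f y"
    using angular_integral_reflect[OF nu m] by (simp add: bessel_translation_eq_angular[OF nu f])
qed

text \<open>The Bessel translation is the case \<open>j = 0\<close>. The powers of the cosine make the family closed under
  differentiation in \<open>y\<close>.\<close>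

definition angular_average :: "real \<Rightarrow> real \<Rightarrow> nat \<Rightarrow> (real \<Rightarrow> complex) \<Rightarrow> real \<Rightarrow> complex" where
  "angular_average \<nu> x j f y =
     (LINT \<theta>|angular_measure \<nu>. f (bessel_radius x y \<theta>) * complex_of_real (cos \<theta> ^ j))"

lemma bessel_translation_eq_average:
  assumes "\<nu> > - 1 / 2" and "continuous_on UNIV f"
  shows "bessel_translation \<nu> x f = angular_average \<nu> x 0 f"
  by (rule ext) (simp add: bessel_translation_eq_angular[OF assms] angular_average_def)

lemma continuous_on_average_integrand:
  assumes "continuous_on UNIV f"
  shows "continuous_on UNIV (\<lambda>(y, \<theta>). f (bessel_radius x y \<theta>) * complex_of_real (cos \<theta> ^ j))"
  unfolding case_prod_unfold by (intro continuous_intros continuous_on_UNIV_compose[OF assms])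

lemma continuous_on_angular_average:
  assumes nu: "\<nu> > - 1 / 2" and f: "continuous_on UNIV f"
  shows "continuous_on UNIV (angular_average \<nu> x j f)"
  unfolding angular_average_def[abs_def]
  using continuous_on_angular_integral[OF nu continuous_on_average_integrand[OF f]] by simp

lemma integrable_average:
  assumes nu: "\<nu> > - 1 / 2" and f: "continuous_on UNIV f"
  shows "integrable (angular_measure \<nu>) (\<lambda>\<theta>. f (bessel_radius x y \<theta>) * complex_of_real (cos \<theta> ^ j))"
  by (intro integrable_angular_measure_continuous[OF nu] continuous_intros continuous_on_UNIV_compose[OF f])

lemma norm_angular_average_le:
  assumes nu: "\<nu> > - 1 / 2" and C: "0 \<le> C"
    and le: "\<And>t. \<bar>t\<bar> \<le> \<bar>x\<bar> + \<bar>y\<bar> \<Longrightarrow> norm (f t) \<le> C"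
  shows "norm (angular_average \<nu> x j f y) \<le> C"
  unfolding angular_average_def
proof (rule norm_integral_angular_le[OF nu C])
  fix \<theta> :: real
  have "norm (f (bessel_radius x y \<theta>) * complex_of_real (cos \<theta> ^ j)) \<le> C * 1"
    unfolding norm_mult using C
    by (intro mult_mono le) (auto simp: norm_power power_le_one bessel_radius_le)
  thus "norm (f (bessel_radius x y \<theta>) * complex_of_real (cos \<theta> ^ j)) \<le> C" by simp
qed

text \<open>Away from the zeros of the radius this is the chain rule. If \<open>x * sin \<theta> = 0\<close>, the radius is
  \<open>\<bar>y - x * cos \<theta>\<bar>\<close>, and evenness of \<open>f\<close> removes the absolute value.\<close>

lemma even_compose_radius_deriv:
  assumes f: "f \<in> even_smooth_functions"
  shows "((\<lambda>y. f (bessel_radius x y \<theta>)) has_vector_derivative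
           complex_of_real (y - x * cos \<theta>) * radial_deriv f (bessel_radius x y \<theta>)) (at y)"
proof -
  have sm: "smooth f" and ev: "\<And>t. f (- t) = f t"
    using f by (auto simp: even_smooth_functions_iff even_function_def)
  have ev': "radial_deriv f (- t) = radial_deriv f t" for t
    using even_smooth_radial_deriv[OF f] by (auto simp: even_smooth_functions_iff even_function_def)
  show ?thesis
  proof (cases "x * sin \<theta> = 0")
    case True
    have r: "bessel_radius x y \<theta> = \<bar>y - x * cos \<theta>\<bar>" for y
      unfolding bessel_radius_def bessel_radius_polar True by simp
    have "((\<lambda>y. y - x * cos \<theta>) has_vector_derivative 1) (at y)"
      unfolding has_real_derivative_iff_has_vector_derivative[symmetric]
      by (auto intro!: derivative_eq_intros)
    from vector_diff_chain_at[OF this smooth_has_deriv[OF sm]]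
    have "((\<lambda>y. f (y - x * cos \<theta>)) has_vector_derivative iter_deriv 1 f (y - x * cos \<theta>)) (at y)"
      by (simp add: o_def)
    moreover have "f \<bar>t\<bar> = f t" "radial_deriv f \<bar>t\<bar> = radial_deriv f t" for t
      by (auto simp: abs_if ev ev')
    ultimately show ?thesis by (simp only: r deriv_eq_radial_deriv[OF f])
  next
    case False
    hence pos: "x\<^sup>2 + y\<^sup>2 - 2 * x * y * cos \<theta> > 0"
      unfolding bessel_radius_polar by (intro add_nonneg_pos) auto
    hence rpos: "bessel_radius x y \<theta> > 0" by (simp add: bessel_radius_def)
    have "((\<lambda>y. bessel_radius x y \<theta>) has_vector_derivative (y - x * cos \<theta>) / bessel_radius x y \<theta>) (at y)"
      unfolding has_real_derivative_iff_has_vector_derivative[symmetric] bessel_radius_def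
      using pos by (auto intro!: derivative_eq_intros simp: divide_simps)
    from vector_diff_chain_at[OF this smooth_has_deriv[OF sm]]
    have "((\<lambda>y. f (bessel_radius x y \<theta>)) has_vector_derivative
      ((y - x * cos \<theta>) / bessel_radius x y \<theta>) *\<^sub>R (complex_of_real (bessel_radius x y \<theta>) * radial_deriv f (bessel_radius x y \<theta>))) (at y)"
      by (simp only: o_def deriv_eq_radial_deriv[OF f])
    moreover have "((y - x * cos \<theta>) / bessel_radius x y \<theta>) *\<^sub>R (complex_of_real (bessel_radius x y \<theta>) * w)
        = complex_of_real (y - x * cos \<theta>) * w" for w
      using rpos by (simp add: scaleR_conv_of_real)
    ultimately show ?thesis by simp
  qed
qed

lemma even_compose_radius_angle_deriv:
  assumes f: "f \<in> even_smooth_functions" and th: "\<theta> \<in> {0<..<pi}"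
  shows "((\<lambda>\<theta>. f (bessel_radius x y \<theta>)) has_vector_derivative
           complex_of_real (x * y * sin \<theta>) * radial_deriv f (bessel_radius x y \<theta>)) (at \<theta>)"
proof (cases "x = 0")
  case True
  thus ?thesis by (simp add: bessel_radius_0)
next
  case False
  have sm: "smooth f" using f by (simp add: even_smooth_functions_iff)
  have "sin \<theta> \<noteq> 0" using th sin_gt_zero[of \<theta>] by auto
  hence pos: "x\<^sup>2 + y\<^sup>2 - 2 * x * y * cos \<theta> > 0"
    unfolding bessel_radius_polar using False by (intro add_nonneg_pos) auto
  hence rpos: "bessel_radius x y \<theta> > 0" by (simp add: bessel_radius_def)
  have "((\<lambda>\<theta>. bessel_radius x y \<theta>) has_vector_derivative (x * y * sin \<theta>) / bessel_radius x y \<theta>) (at \<theta>)"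
    unfolding has_real_derivative_iff_has_vector_derivative[symmetric] bessel_radius_def
    using pos by (auto intro!: derivative_eq_intros simp: divide_simps)
  from vector_diff_chain_at[OF this smooth_has_deriv[OF sm]]
  have "((\<lambda>\<theta>. f (bessel_radius x y \<theta>)) has_vector_derivative
    ((x * y * sin \<theta>) / bessel_radius x y \<theta>) *\<^sub>R (complex_of_real (bessel_radius x y \<theta>) * radial_deriv f (bessel_radius x y \<theta>))) (at \<theta>)"
    by (simp only: o_def deriv_eq_radial_deriv[OF f])
  moreover have "((x * y * sin \<theta>) / bessel_radius x y \<theta>) *\<^sub>R (complex_of_real (bessel_radius x y \<theta>) * w)
      = complex_of_real (x * y * sin \<theta>) * w" for w
    using rpos by (simp add: scaleR_conv_of_real)
  ultimately show ?thesis by simp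
qed

lemma angular_average_deriv:
  assumes nu: "\<nu> > - 1 / 2" and f: "f \<in> even_smooth_functions"
  shows "(angular_average \<nu> x j f has_vector_derivative
     complex_of_real y * angular_average \<nu> x j (radial_deriv f) y
       - complex_of_real x * angular_average \<nu> x (Suc j) (radial_deriv f) y) (at y)"
proof -
  let ?D = "radial_deriv f"
  have c: "continuous_on UNIV f" and cD: "continuous_on UNIV ?D"
    using f even_smooth_radial_deriv[OF f] by (auto simp: even_smooth_functions_iff smooth_continuous)
  let ?F = "\<lambda>(y, \<theta>). f (bessel_radius x y \<theta>) * complex_of_real (cos \<theta> ^ j)"
  let ?F' = "\<lambda>(y, \<theta>). complex_of_real (y - x * cos \<theta>) * ?D (bessel_radius x y \<theta>) * complex_of_real (cos \<theta> ^ j)"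
  have "((\<lambda>y. LINT \<theta>|angular_measure \<nu>. ?F (y, \<theta>)) has_vector_derivative
      (LINT \<theta>|angular_measure \<nu>. ?F' (y, \<theta>))) (at y)"
  proof (rule has_vector_derivative_angular_integral[OF nu continuous_on_average_integrand[OF c]])
    show "continuous_on UNIV ?F'"
      unfolding case_prod_unfold by (intro continuous_intros continuous_on_UNIV_compose[OF cD])
    show "((\<lambda>y. ?F (y, \<theta>)) has_vector_derivative ?F' (y, \<theta>)) (at y)" for y \<theta>
      using has_vector_derivative_mult[OF even_compose_radius_deriv[OF f, of x \<theta> y]
          has_vector_derivative_const, of "complex_of_real (cos \<theta> ^ j)"] by simp
  qed
  moreover have "(LINT \<theta>|angular_measure \<nu>. ?F' (y, \<theta>))
      = complex_of_real y * angular_average \<nu> x j ?D y - complex_of_real x * angular_average \<nu> x (Suc j) ?D y"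
  proof -
    have "(LINT \<theta>|angular_measure \<nu>. ?F' (y, \<theta>)) = (LINT \<theta>|angular_measure \<nu>.
        complex_of_real y * (?D (bessel_radius x y \<theta>) * complex_of_real (cos \<theta> ^ j))
        - complex_of_real x * (?D (bessel_radius x y \<theta>) * complex_of_real (cos \<theta> ^ Suc j)))"
      by (intro Bochner_Integration.integral_cong refl) (simp add: algebra_simps)
    also have "\<dots> = complex_of_real y * angular_average \<nu> x j ?D y - complex_of_real x * angular_average \<nu> x (Suc j) ?D y"
      unfolding angular_average_def
      by (simp only: Bochner_Integration.integral_diff integral_mult_right_zero integrable_mult_right
          integrable_average[OF nu cD])
    finally show ?thesis .
  qed
  ultimately show ?thesis by (simp add: angular_average_def[abs_def])
qed

lemma deriv_bound_radial_deriv: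
  assumes f: "f \<in> even_smooth_functions" and b: "deriv_bound (Suc (Suc n)) R C f"
  shows "deriv_bound n R C (radial_deriv f)"
proof -
  have "smooth f" using f by (simp add: even_smooth_functions_iff)
  moreover have "deriv_bound n R C (iter_deriv 2 f)"
    using b unfolding iter_deriv_2 deriv_bound.simps by blast
  ultimately show ?thesis unfolding radial_deriv_def
    by (intro deriv_bound_dilation_mean smooth_iter_deriv)
qed

text \<open>Each derivative in \<open>y\<close> costs one radial derivative, that is two derivatives of \<open>f\<close>, and multiplies by \<open>y\<close>
  or by \<open>x\<close>. The interval grows by \<open>\<bar>x\<bar>\<close> because the radius is at most \<open>\<bar>x\<bar> + \<bar>y\<bar>\<close>. The constant
  must not depend on \<open>f\<close>, as this is the estimate behind the continuity of the translation.\<close>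

lemma angular_average_deriv_bound:
  assumes nu: "\<nu> > - 1 / 2" and R: "R \<ge> 0"
  shows "\<exists>K\<ge>0. \<forall>f\<in>even_smooth_functions. \<forall>j. \<forall>C\<ge>0. deriv_bound (2 * n) (R + \<bar>x\<bar>) C f \<longrightarrow>
           deriv_bound n R (K * C) (angular_average \<nu> x j f)"
proof (induction n)
  case 0
  show ?case by (intro exI[of _ 1]) (auto intro!: norm_angular_average_le[OF nu])
next
  case (Suc n)
  then obtain K where K: "K \<ge> 0" "\<And>f j C. f \<in> even_smooth_functions \<Longrightarrow> C \<ge> 0 \<Longrightarrow>
      deriv_bound (2 * n) (R + \<bar>x\<bar>) C f \<Longrightarrow> deriv_bound n R (K * C) (angular_average \<nu> x j f)"
    by blast
  define K' where "K' = 1 + (2 ^ n * (max \<bar>R\<bar> 1 * K) + 2 ^ n * (\<bar>x\<bar> * K))"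
  have K': "K' \<ge> 1" unfolding K'_def using K(1) by (simp add: add_nonneg_nonneg)
  show ?case
  proof (intro exI[of _ K'] conjI ballI allI impI)
    fix f j and C :: real
    assume f: "f \<in> even_smooth_functions" and C: "C \<ge> 0" and b: "deriv_bound (2 * Suc n) (R + \<bar>x\<bar>) C f"
    let ?D = "radial_deriv f"
    have D: "?D \<in> even_smooth_functions" by (rule even_smooth_radial_deriv[OF f])
    have bD: "deriv_bound (2 * n) (R + \<bar>x\<bar>) C ?D" using b by (intro deriv_bound_radial_deriv[OF f]) simp
    show "deriv_bound (Suc n) R (K' * C) (angular_average \<nu> x j f)"
    proof (rule deriv_boundI[OF angular_average_deriv[OF nu f]])
      fix t assume t: "\<bar>t\<bar> \<le> R"
      have "norm (angular_average \<nu> x j f t) \<le> C"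
        by (intro norm_angular_average_le[OF nu C] deriv_bound_norm[OF b]) (use t in simp)
      also have "C \<le> K' * C" using K' C by (simp add: mult_le_cancel_right1)
      finally show "norm (angular_average \<nu> x j f t) \<le> K' * C" .
    next
      have 1: "deriv_bound n R (2 ^ n * (max \<bar>R\<bar> 1 * (K * C))) (\<lambda>t. complex_of_real t * angular_average \<nu> x j ?D t)"
        by (intro deriv_bound_mult deriv_bound_of_real K D C bD)
      have 2: "deriv_bound n R (2 ^ n * (\<bar>x\<bar> * (K * C))) (\<lambda>t. complex_of_real (- x) * angular_average \<nu> x (Suc j) ?D t)"
        by (intro deriv_bound_mult deriv_bound_const K D C bD) simp
      have "deriv_bound n R (2 ^ n * (max \<bar>R\<bar> 1 * (K * C)) + 2 ^ n * (\<bar>x\<bar> * (K * C)))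
          (\<lambda>t. complex_of_real t * angular_average \<nu> x j ?D t - complex_of_real x * angular_average \<nu> x (Suc j) ?D t)"
        using deriv_bound_add[OF 1 2] by simp
      moreover have "2 ^ n * (max \<bar>R\<bar> 1 * (K * C)) + 2 ^ n * (\<bar>x\<bar> * (K * C)) \<le> K' * C"
        using C by (simp add: K'_def algebra_simps)
      ultimately show "deriv_bound n R (K' * C)
          (\<lambda>t. complex_of_real t * angular_average \<nu> x j ?D t - complex_of_real x * angular_average \<nu> x (Suc j) ?D t)"
        by (rule deriv_bound_mono)
    qed
  qed (use K' in simp)
qed

lemma smooth_angular_average:
  assumes nu: "\<nu> > - 1 / 2" and f: "f \<in> even_smooth_functions"
  shows "smooth (angular_average \<nu> x j f)"
proof (rule smoothI)
  fix n
  obtain K where K: "\<forall>f\<in>even_smooth_functions. \<forall>j. \<forall>C\<ge>0. deriv_bound (2 * n) (0 + \<bar>x\<bar>) C f \<longrightarrow>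
           deriv_bound n 0 (K * C) (angular_average \<nu> x j f)"
    using angular_average_deriv_bound[OF nu, of 0 n x] by blast
  obtain C where "C \<ge> 0" "deriv_bound (2 * n) (0 + \<bar>x\<bar>) C f"
    using smooth_bounded_derivs f unfolding even_smooth_functions_iff by blast
  thus "\<exists>R C. deriv_bound n R C (angular_average \<nu> x j f)" using K f by blast
qed

lemma even_smooth_bessel_translation:
  assumes nu: "\<nu> > - 1 / 2" and f: "f \<in> even_smooth_functions"
  shows "bessel_translation \<nu> x f \<in> even_smooth_functions"
proof -
  have c: "continuous_on UNIV f" using f by (simp add: even_smooth_functions_iff smooth_continuous)
  show ?thesis
    using bessel_translation_even[OF nu c] smooth_angular_average[OF nu f]
    unfolding even_smooth_functions_iff bessel_translation_eq_average[OF nu c] by blast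
qed

section \<open>The Bessel operator\<close>

definition bessel_operator :: "real \<Rightarrow> (real \<Rightarrow> complex) \<Rightarrow> real \<Rightarrow> complex" where
  "bessel_operator \<nu> h t = iter_deriv 2 h t + complex_of_real (2 * \<nu> + 1) * radial_deriv h t"

lemma even_smooth_continuous: "f \<in> even_smooth_functions \<Longrightarrow> continuous_on UNIV f"
  by (simp add: even_smooth_functions_iff smooth_continuous)

text \<open>Integration by parts in the angle; the derivative of \<open>f (r)\<close> with respect to \<open>\<theta>\<close> is
  \<open>x * y * sin \<theta> * radial_deriv f r\<close>, and \<open>sin\<^sup>2 = 1 - cos\<^sup>2\<close>.\<close>

lemma angular_average_by_parts:
  assumes nu: "\<nu> > - 1 / 2" and f: "f \<in> even_smooth_functions"
  shows "complex_of_real (2 * \<nu> + 1) * angular_average \<nu> x 1 f y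
    = complex_of_real (x * y) * (angular_average \<nu> x 2 (radial_deriv f) y - angular_average \<nu> x 0 (radial_deriv f) y)"
proof -
  let ?D = "radial_deriv f"
  have c: "continuous_on UNIV f" and cD: "continuous_on UNIV ?D"
    using even_smooth_continuous[OF f] even_smooth_continuous[OF even_smooth_radial_deriv[OF f]] by auto
  have "(2 * \<nu> + 1) *\<^sub>R (LINT \<theta>|angular_measure \<nu>. cos \<theta> *\<^sub>R f (bessel_radius x y \<theta>))
      = - (LINT \<theta>|angular_measure \<nu>. sin \<theta> *\<^sub>R (complex_of_real (x * y * sin \<theta>) * ?D (bessel_radius x y \<theta>)))"
    by (intro angular_integral_by_parts[OF nu] even_compose_radius_angle_deriv[OF f] continuous_intros
        continuous_on_UNIV_compose[OF c] continuous_on_UNIV_compose[OF cD])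
  also have "(\<lambda>\<theta>. sin \<theta> *\<^sub>R (complex_of_real (x * y * sin \<theta>) * ?D (bessel_radius x y \<theta>)))
      = (\<lambda>\<theta>. complex_of_real (x * y) * (?D (bessel_radius x y \<theta>) * complex_of_real (cos \<theta> ^ 0)
          - ?D (bessel_radius x y \<theta>) * complex_of_real (cos \<theta> ^ 2)))"
  proof
    fix \<theta> :: real
    have *: "sin \<theta> *\<^sub>R (complex_of_real (x * y * sin \<theta>) * w) = complex_of_real (x * y) * (w * complex_of_real ((sin \<theta>)\<^sup>2))" for w
      by (simp add: scaleR_conv_of_real power2_eq_square mult_ac)
    show "sin \<theta> *\<^sub>R (complex_of_real (x * y * sin \<theta>) * ?D (bessel_radius x y \<theta>))
      = complex_of_real (x * y) * (?D (bessel_radius x y \<theta>) * complex_of_real (cos \<theta> ^ 0)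
          - ?D (bessel_radius x y \<theta>) * complex_of_real (cos \<theta> ^ 2))"
      unfolding * sin_squared_eq by (simp add: algebra_simps)
  qed
  also have "(LINT \<theta>|angular_measure \<nu>. complex_of_real (x * y) * (?D (bessel_radius x y \<theta>) * complex_of_real (cos \<theta> ^ 0)
          - ?D (bessel_radius x y \<theta>) * complex_of_real (cos \<theta> ^ 2)))
      = complex_of_real (x * y) * (angular_average \<nu> x 0 ?D y - angular_average \<nu> x 2 ?D y)"
    unfolding angular_average_def integral_mult_right_zero
    by (subst Bochner_Integration.integral_diff[OF integrable_average[OF nu cD] integrable_average[OF nu cD]]) simp
  also have "(LINT \<theta>|angular_measure \<nu>. cos \<theta> *\<^sub>R f (bessel_radius x y \<theta>)) = angular_average \<nu> x 1 f y"
    unfolding angular_average_def by (simp add: scaleR_conv_of_real mult.commute)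
  finally show ?thesis by (simp add: scaleR_conv_of_real algebra_simps)
qed

lemma bessel_operator_eq:
  assumes f: "f \<in> even_smooth_functions"
  shows "bessel_operator \<nu> f = (\<lambda>s. complex_of_real (2 * \<nu> + 2) * radial_deriv f s
    + complex_of_real (s\<^sup>2) * radial_deriv (radial_deriv f) s)"
  by (rule ext) (simp add: bessel_operator_def deriv2_eq_radial_deriv[OF f] algebra_simps)

lemma continuous_on_bessel_operator:
  assumes f: "f \<in> even_smooth_functions"
  shows "continuous_on UNIV (bessel_operator \<nu> f)"
  unfolding bessel_operator_eq[OF f]
  by (intro continuous_intros even_smooth_continuous even_smooth_radial_deriv f)

text \<open>With \<open>D\<close> and \<open>E\<close> the first and second radial derivative of \<open>f\<close> and \<open>A\<^sub>j\<close> the angular averages, the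
  two sides differ by \<open>x\<^sup>2 (A\<^sub>2 E - A\<^sub>0 E) - (2 \<nu> + 1) (x / y) A\<^sub>1 D\<close>, which vanishes after integration by
  parts. To include \<open>y = 0\<close>, the integration by parts is first used to write the derivative of the
  translate as \<open>y\<close> times a continuous function.\<close>

lemma bessel_operator_translation:
  assumes nu: "\<nu> > - 1 / 2" and f: "f \<in> even_smooth_functions"
  shows "bessel_operator \<nu> (bessel_translation \<nu> x f) = bessel_translation \<nu> x (bessel_operator \<nu> f)"
proof
  fix y
  let ?D = "radial_deriv f"
  let ?E = "radial_deriv (radial_deriv f)"
  let ?A = "\<lambda>j g. angular_average \<nu> x j g"
  have D: "?D \<in> even_smooth_functions" and E: "?E \<in> even_smooth_functions"
    using f by (auto intro: even_smooth_radial_deriv)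
  note cont = even_smooth_continuous[OF f] even_smooth_continuous[OF D] even_smooth_continuous[OF E]
  have u: "bessel_translation \<nu> x f = ?A 0 f" by (rule bessel_translation_eq_average[OF nu cont(1)])
  have u1: "iter_deriv 1 (?A 0 f) = (\<lambda>y. complex_of_real y * ?A 0 ?D y - complex_of_real x * ?A 1 ?D y)"
    by (rule iter_deriv_1_eqI) (use angular_average_deriv[OF nu f, of x 0] in simp)
  have u2: "iter_deriv 2 (?A 0 f) y = ?A 0 ?D y
      + complex_of_real y * (complex_of_real y * ?A 0 ?E y - complex_of_real x * ?A 1 ?E y)
      - complex_of_real x * (complex_of_real y * ?A 1 ?E y - complex_of_real x * ?A 2 ?E y)"
  proof -
    have "((\<lambda>y. complex_of_real y * ?A 0 ?D y - complex_of_real x * ?A 1 ?D y) has_vector_derivative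
        (complex_of_real y * (complex_of_real y * ?A 0 ?E y - complex_of_real x * ?A (Suc 0) ?E y) + 1 * ?A 0 ?D y)
        - (complex_of_real x * (complex_of_real y * ?A 1 ?E y - complex_of_real x * ?A (Suc 1) ?E y) + 0 * ?A 1 ?D y)) (at y)" for y
      by (intro has_vector_derivative_diff has_vector_derivative_mult has_vector_derivative_complex_of_real
          has_vector_derivative_const angular_average_deriv[OF nu D])
    from fun_cong[OF iter_deriv_1_eqI[OF this], of y]
    show ?thesis unfolding iter_deriv_2 u1 by (simp add: numeral_2_eq_2 add.commute)
  qed
  \<comment> \<open>the factor left after \<open>x * A\<^sub>1 D\<close> has been integrated by parts and \<open>y\<close> split off\<close>
  define k where "k = complex_of_real (x\<^sup>2 / (2 * \<nu> + 1))"
  have k: "complex_of_real (2 * \<nu> + 1) * k = complex_of_real (x\<^sup>2)"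
    unfolding k_def of_real_mult[symmetric] using nu by simp
  have q: "radial_deriv (?A 0 f) = (\<lambda>y. ?A 0 ?D y - k * (?A 2 ?E y - ?A 0 ?E y))"
  proof (rule radial_deriv_eqI)
    show "?A 0 f \<in> even_smooth_functions"
      using even_smooth_bessel_translation[OF nu f, of x] unfolding u .
    show "continuous_on UNIV (\<lambda>y. ?A 0 ?D y - k * (?A 2 ?E y - ?A 0 ?E y))"
      by (intro continuous_intros continuous_on_angular_average[OF nu] cont)
    fix t
    have nz: "complex_of_real (2 * \<nu> + 1) \<noteq> 0" using nu unfolding of_real_eq_0_iff by simp
    have "complex_of_real (2 * \<nu> + 1) * (complex_of_real x * ?A 1 ?D t)
        = complex_of_real (2 * \<nu> + 1) * (complex_of_real t * (k * (?A 2 ?E t - ?A 0 ?E t)))"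
    proof -
      have "complex_of_real (2 * \<nu> + 1) * (complex_of_real x * ?A 1 ?D t)
          = complex_of_real x * (complex_of_real (2 * \<nu> + 1) * ?A 1 ?D t)" by (rule mult.left_commute)
      also have "\<dots> = complex_of_real t * complex_of_real (x\<^sup>2) * (?A 2 ?E t - ?A 0 ?E t)"
        unfolding angular_average_by_parts[OF nu D] by (simp add: power2_eq_square mult_ac)
      finally show ?thesis unfolding k[symmetric] by (simp only: mult_ac)
    qed
    hence "complex_of_real (2 * \<nu> + 1) = 0 \<or>
        complex_of_real x * ?A 1 ?D t = complex_of_real t * (k * (?A 2 ?E t - ?A 0 ?E t))"
      by (simp only: mult_cancel_left)
    with nz have "complex_of_real x * ?A 1 ?D t = complex_of_real t * (k * (?A 2 ?E t - ?A 0 ?E t))"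
      by blast
    thus "iter_deriv 1 (?A 0 f) t = complex_of_real t * (?A 0 ?D t - k * (?A 2 ?E t - ?A 0 ?E t))"
      unfolding u1 by (simp only: right_diff_distrib)
  qed
  have rhs: "?A 0 (bessel_operator \<nu> f) y = complex_of_real (2 * \<nu> + 2) * ?A 0 ?D y
      + (complex_of_real (x\<^sup>2 + y\<^sup>2) * ?A 0 ?E y - complex_of_real (2 * x * y) * ?A 1 ?E y)"
  proof -
    have "?A 0 (bessel_operator \<nu> f) y = (LINT \<theta>|angular_measure \<nu>.
        complex_of_real (2 * \<nu> + 2) * (?D (bessel_radius x y \<theta>) * complex_of_real (cos \<theta> ^ 0))
        + (complex_of_real (x\<^sup>2 + y\<^sup>2) * (?E (bessel_radius x y \<theta>) * complex_of_real (cos \<theta> ^ 0))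
           - complex_of_real (2 * x * y) * (?E (bessel_radius x y \<theta>) * complex_of_real (cos \<theta> ^ 1))))"
      unfolding angular_average_def bessel_operator_eq[OF f] bessel_radius_square
      by (intro Bochner_Integration.integral_cong refl) (simp add: algebra_simps)
    also have "\<dots> = complex_of_real (2 * \<nu> + 2) * ?A 0 ?D y
      + (complex_of_real (x\<^sup>2 + y\<^sup>2) * ?A 0 ?E y - complex_of_real (2 * x * y) * ?A 1 ?E y)"
      unfolding angular_average_def
      by (simp only: Bochner_Integration.integral_add Bochner_Integration.integral_diff
          Bochner_Integration.integrable_diff integral_mult_right_zero integrable_mult_right
          integrable_average[OF nu cont(2)] integrable_average[OF nu cont(3)])
    finally show ?thesis .
  qed
  have "bessel_operator \<nu> (?A 0 f) y = ?A 0 ?D y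
      + complex_of_real y * (complex_of_real y * ?A 0 ?E y - complex_of_real x * ?A 1 ?E y)
      - complex_of_real x * (complex_of_real y * ?A 1 ?E y - complex_of_real x * ?A 2 ?E y)
      + (complex_of_real (2 * \<nu> + 1) * ?A 0 ?D y - complex_of_real (2 * \<nu> + 1) * k * (?A 2 ?E y - ?A 0 ?E y))"
    unfolding bessel_operator_def u2 q by (simp only: right_diff_distrib mult.assoc)
  also have "\<dots> = ?A 0 (bessel_operator \<nu> f) y"
    unfolding rhs k by (simp add: algebra_simps power2_eq_square)
  finally show "bessel_operator \<nu> (bessel_translation \<nu> x f) y = bessel_translation \<nu> x (bessel_operator \<nu> f) y"
    unfolding u bessel_translation_eq_average[OF nu continuous_on_bessel_operator[OF f]] .
qed

section \<open>Symmetric Markov kernels\<close>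

text \<open>The graph of \<open>t powr p\<close> lies above its tangent at \<open>s\<close>. After division by \<open>s powr p\<close> this is
  Bernoulli's inequality, a case of Young's.\<close>

lemma powr_tangent_le:
  fixes a s p :: real
  assumes "p \<ge> 1" "a \<ge> 0" "s > 0"
  shows "s powr p + p * s powr (p - 1) * (a - s) \<le> a powr p"
proof (cases "a = 0")
  case True
  have "s powr (p - 1) * s = s powr p" using assms powr_mult_base[of s "p - 1"] by (simp add: mult.commute)
  hence "s powr p + p * s powr (p - 1) * (0 - s) = (1 - p) * s powr p" by (simp add: algebra_simps)
  also have "\<dots> \<le> 0" using assms by (simp add: mult_nonpos_nonneg)
  finally show ?thesis using True by simp
next
  case False
  hence a: "a > 0" using assms by simp
  define t where "t = a / s"
  have t: "t > 0" using a assms by (simp add: t_def)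
  have "(t powr p) powr (1 / p) * 1 powr (1 - 1 / p) \<le> 1 / p * t powr p + (1 - 1 / p) * 1"
    using assms t by (intro Youngs_inequality_0) auto
  hence "t \<le> t powr p / p + 1 - 1 / p" using assms t by (simp add: powr_powr)
  hence "p * t \<le> p * (t powr p / p + 1 - 1 / p)" using assms by (intro mult_left_mono) auto
  also have "\<dots> = t powr p + p - 1" using assms by (simp add: right_diff_distrib distrib_left)
  finally have "p * t \<le> t powr p + p - 1" .
  hence "s powr p * (1 + p * (t - 1)) \<le> s powr p * t powr p"
    by (intro mult_left_mono) (auto simp: algebra_simps)
  also have "s powr p * t powr p = a powr p"
    using a assms t by (simp add: t_def flip: powr_mult)
  also have "s powr p * (1 + p * (t - 1)) = s powr p + p * s powr (p - 1) * (a - s)"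
  proof -
    have "s powr (p - 1) * s = s powr p" using assms powr_mult_base[of s "p - 1"] by (simp add: mult.commute)
    moreover have "t - 1 = (a - s) / s" using assms by (simp add: t_def diff_divide_distrib)
    ultimately show ?thesis using assms by (simp add: field_simps flip: \<open>s powr (p - 1) * s = s powr p\<close>)
  qed
  finally show ?thesis .
qed

text \<open>Jensen's inequality for the probability density \<open>w\<close>, obtained by integrating the tangent inequality
  at the mean \<open>s\<close> of \<open>g\<close>.\<close>

lemma powr_integral_le:
  fixes w g :: "'a \<Rightarrow> real"
  assumes p: "p \<ge> 1" and w: "integrable M w" "\<And>z. w z \<ge> 0" "(LINT z|M. w z) = 1"
    and g: "\<And>z. g z \<ge> 0" "integrable M (\<lambda>z. g z * w z)" "integrable M (\<lambda>z. g z powr p * w z)"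
  shows "(LINT z|M. g z * w z) powr p \<le> (LINT z|M. g z powr p * w z)"
proof -
  define s where "s = (LINT z|M. g z * w z)"
  have "s \<ge> 0" unfolding s_def using g w by (intro integral_nonneg_AE) auto
  show ?thesis
  proof (cases "s = 0")
    case True
    thus ?thesis unfolding s_def[symmetric] using g w by (auto intro!: integral_nonneg_AE)
  next
    case False
    hence s: "s > 0" using \<open>s \<ge> 0\<close> by simp
    let ?k = "p * s powr (p - 1)"
    have "(LINT z|M. s powr p * w z + ?k * (g z * w z - s * w z)) \<le> (LINT z|M. g z powr p * w z)"
    proof (rule integral_mono)
      show "integrable M (\<lambda>z. s powr p * w z + ?k * (g z * w z - s * w z))"
        using g w by (intro Bochner_Integration.integrable_add Bochner_Integration.integrable_diff integrable_mult_right) auto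
      fix z
      have "(s powr p + ?k * (g z - s)) * w z \<le> g z powr p * w z"
        by (intro mult_right_mono powr_tangent_le p g s w)
      thus "s powr p * w z + ?k * (g z * w z - s * w z) \<le> g z powr p * w z"
        by (simp add: algebra_simps)
    qed (rule g)
    also have "(LINT z|M. s powr p * w z + ?k * (g z * w z - s * w z)) = s powr p * 1 + ?k * (s - s * 1)"
      using g w by (simp add: s_def)
    finally show ?thesis by (simp add: s_def)
  qed
qed

text \<open>The example is the Bessel kernel with its first argument fixed. Mass one is demanded only almost
  everywhere, since the Bessel kernel degenerates at \<open>y = 0\<close>.\<close>

locale symmetric_markov_kernel = sigma_finite_measure M for M :: "'a measure" +
  fixes K :: "'a \<Rightarrow> 'a \<Rightarrow> real"
  assumes measurable_kernel [measurable]: "(\<lambda>(y, z). K y z) \<in> borel_measurable (M \<Otimes>\<^sub>M M)"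
    and kernel_nonneg: "K y z \<ge> 0"
    and kernel_commute: "K y z = K z y"
    and kernel_mass: "AE y in M. (\<integral>\<^sup>+z. ennreal (K y z) \<partial>M) = 1"
begin

sublocale pair: pair_sigma_finite M M ..

definition apply_kernel :: "('a \<Rightarrow> complex) \<Rightarrow> 'a \<Rightarrow> complex" where
  "apply_kernel f y = (LINT z|M. f z * complex_of_real (K y z))"

lemma measurable_apply_kernel [measurable (raw)]:
  assumes [measurable]: "f \<in> borel_measurable M"
  shows "apply_kernel f \<in> borel_measurable M"
  unfolding apply_kernel_def[abs_def] by measurable

text \<open>By symmetry the kernel also has mass one in its first variable, so Tonelli's theorem gives the claim.\<close>

lemma nn_integral_kernel:
  fixes h :: "'a \<Rightarrow> ennreal"
  assumes [measurable]: "h \<in> borel_measurable M"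
  shows "(\<integral>\<^sup>+y. (\<integral>\<^sup>+z. h z * ennreal (K y z) \<partial>M) \<partial>M) = (\<integral>\<^sup>+z. h z \<partial>M)"
proof -
  have "(\<integral>\<^sup>+y. (\<integral>\<^sup>+z. h z * ennreal (K y z) \<partial>M) \<partial>M) = (\<integral>\<^sup>+z. (\<integral>\<^sup>+y. h z * ennreal (K y z) \<partial>M) \<partial>M)"
    by (rule pair.Fubini') measurable
  also have "\<dots> = (\<integral>\<^sup>+z. h z * (\<integral>\<^sup>+y. ennreal (K z y) \<partial>M) \<partial>M)"
    by (intro nn_integral_cong) (simp add: nn_integral_cmult kernel_commute)
  also have "\<dots> = (\<integral>\<^sup>+z. h z * 1 \<partial>M)"
    using kernel_mass by (intro nn_integral_cong_AE) auto
  finally show ?thesis by simp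
qed

lemma kernel_integrable:
  assumes mass: "(\<integral>\<^sup>+z. ennreal (K y z) \<partial>M) = 1" and y: "y \<in> space M"
  shows "integrable M (K y)" "(LINT z|M. K y z) = 1"
proof -
  have [measurable]: "K y \<in> borel_measurable M" using y by measurable
  show "integrable M (K y)"
    by (rule integrableI_nonneg) (auto simp: kernel_nonneg mass)
  have "ennreal (LINT z|M. K y z) = 1"
    using \<open>integrable M (K y)\<close> mass by (subst nn_integral_eq_integral[symmetric]) (auto simp: kernel_nonneg)
  thus "(LINT z|M. K y z) = 1" by (simp add: ennreal_eq_1)
qed

text \<open>Jensen's inequality for almost every \<open>y\<close>, followed by integration over \<open>y\<close>. The integrability of \<open>f\<close>
  against the kernel follows from \<open>\<bar>f\<bar> \<le> 1 + \<bar>f\<bar>\<^sup>p\<close>.\<close>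

lemma apply_kernel_powr:
  assumes p: "p \<ge> 1" and f [measurable]: "f \<in> borel_measurable M"
    and fin: "(\<integral>\<^sup>+z. ennreal (norm (f z) powr p) \<partial>M) < \<infinity>"
  shows "AE y in M. integrable M (\<lambda>z. f z * complex_of_real (K y z))"
    and "(\<integral>\<^sup>+y. ennreal (norm (apply_kernel f y) powr p) \<partial>M) \<le> (\<integral>\<^sup>+z. ennreal (norm (f z) powr p) \<partial>M)"
proof -
  let ?h = "\<lambda>y. \<integral>\<^sup>+z. ennreal (norm (f z) powr p) * ennreal (K y z) \<partial>M"
  have [measurable]: "?h \<in> borel_measurable M" by measurable
  have hint: "(\<integral>\<^sup>+y. ?h y \<partial>M) = (\<integral>\<^sup>+z. ennreal (norm (f z) powr p) \<partial>M)"
    by (rule nn_integral_kernel) measurable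
  have "AE y in M. ?h y \<noteq> \<infinity>"
    by (rule nn_integral_PInf_AE) (use fin hint in auto)
  hence main: "AE y in M. integrable M (\<lambda>z. f z * complex_of_real (K y z))
      \<and> ennreal (norm (apply_kernel f y) powr p) \<le> ?h y"
    using kernel_mass AE_space
  proof eventually_elim
    case (elim y)
    note y = \<open>y \<in> space M\<close>
    have [measurable]: "K y \<in> borel_measurable M" using y by measurable
    note K = kernel_integrable[OF elim(2) y]
    have hy: "?h y = (\<integral>\<^sup>+z. ennreal (norm (f z) powr p * K y z) \<partial>M)"
      by (intro nn_integral_cong) (simp add: ennreal_mult' kernel_nonneg)
    have ip: "integrable M (\<lambda>z. norm (f z) powr p * K y z)"
      by (rule integrableI_nonneg) (use elim(1) in \<open>auto simp: kernel_nonneg hy[symmetric] top.not_eq_extremum\<close>)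
    have i1: "integrable M (\<lambda>z. norm (f z) * K y z)"
    proof (rule Bochner_Integration.integrable_bound)
      show "integrable M (\<lambda>z. K y z + norm (f z) powr p * K y z)"
        using K ip by simp
      show "AE z in M. norm (norm (f z) * K y z) \<le> norm (K y z + norm (f z) powr p * K y z)"
      proof (rule AE_I2)
        fix z
        have "norm (f z) \<le> 1 + norm (f z) powr p"
        proof (cases "norm (f z) \<le> 1")
          case False
          hence "norm (f z) powr 1 \<le> norm (f z) powr p" using p by (intro powr_mono) auto
          thus ?thesis using False by simp
        qed (simp add: add_increasing2)
        hence "norm (f z) * K y z \<le> (1 + norm (f z) powr p) * K y z"
          by (intro mult_right_mono kernel_nonneg)
        thus "norm (norm (f z) * K y z) \<le> norm (K y z + norm (f z) powr p * K y z)"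
          by (simp add: kernel_nonneg abs_mult algebra_simps)
      qed
    qed measurable
    have i2: "integrable M (\<lambda>z. f z * complex_of_real (K y z))"
      by (rule Bochner_Integration.integrable_bound[OF i1]) (auto simp: norm_mult)
    have "norm (apply_kernel f y) \<le> (LINT z|M. norm (f z) * K y z)"
      unfolding apply_kernel_def by (rule order_trans[OF integral_norm_bound]) (simp add: norm_mult kernel_nonneg)
    hence "norm (apply_kernel f y) powr p \<le> (LINT z|M. norm (f z) * K y z) powr p"
      using p by (intro powr_mono2) auto
    also have "\<dots> \<le> (LINT z|M. norm (f z) powr p * K y z)"
      using p K i1 ip kernel_nonneg by (intro powr_integral_le) auto
    finally have "ennreal (norm (apply_kernel f y) powr p) \<le> ?h y"
      unfolding hy by (subst nn_integral_eq_integral[OF ip]) (auto simp: kernel_nonneg intro: ennreal_leI)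
    thus ?case using i2 by simp
  qed
  thus "AE y in M. integrable M (\<lambda>z. f z * complex_of_real (K y z))" by auto
  have "(\<integral>\<^sup>+y. ennreal (norm (apply_kernel f y) powr p) \<partial>M) \<le> (\<integral>\<^sup>+y. ?h y \<partial>M)"
    using main by (intro nn_integral_mono_AE) auto
  thus "(\<integral>\<^sup>+y. ennreal (norm (apply_kernel f y) powr p) \<partial>M) \<le> (\<integral>\<^sup>+z. ennreal (norm (f z) powr p) \<partial>M)"
    by (simp only: hint)
qed

lemma apply_kernel_bounded:
  assumes f [measurable]: "f \<in> borel_measurable M" and C: "C \<ge> 0" and le: "AE z in M. norm (f z) \<le> C"
  shows "AE y in M. integrable M (\<lambda>z. f z * complex_of_real (K y z)) \<and> norm (apply_kernel f y) \<le> C"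
  using kernel_mass AE_space
proof eventually_elim
  case (elim y)
  note y = \<open>y \<in> space M\<close>
  have [measurable]: "K y \<in> borel_measurable M" using y by measurable
  note K = kernel_integrable[OF elim(1) y]
  have le': "AE z in M. norm (f z * complex_of_real (K y z)) \<le> C * K y z"
    using le by eventually_elim (simp add: norm_mult kernel_nonneg mult_right_mono)
  have int: "integrable M (\<lambda>z. f z * complex_of_real (K y z))"
  proof (rule Bochner_Integration.integrable_bound)
    show "integrable M (\<lambda>z. C * K y z)" using K by simp
    show "AE z in M. norm (f z * complex_of_real (K y z)) \<le> norm (C * K y z)"
      using le' by eventually_elim auto
  qed measurable
  have "norm (apply_kernel f y) \<le> (LINT z|M. norm (f z * complex_of_real (K y z)))"
    unfolding apply_kernel_def by (rule integral_norm_bound)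
  also have "\<dots> \<le> (LINT z|M. C * K y z)"
    using int K le' by (intro integral_mono_AE) auto
  also have "\<dots> = C" using K by simp
  finally show ?case using int by simp
qed

lemma apply_kernel_duality:
  assumes f: "integrable M f" and g [measurable]: "g \<in> borel_measurable M"
    and le: "\<And>z. z \<in> space M \<Longrightarrow> norm (g z) \<le> C"
  shows "integrable M (\<lambda>y. apply_kernel f y * g y)" "integrable M (\<lambda>y. f y * apply_kernel g y)"
    "(LINT y|M. apply_kernel f y * g y) = (LINT y|M. f y * apply_kernel g y)"
proof -
  have [measurable]: "f \<in> borel_measurable M" using f by simp
  let ?H = "\<lambda>(y, z). f z * complex_of_real (K y z) * g y"
  have int: "integrable (M \<Otimes>\<^sub>M M) ?H"
  proof (rule integrableI_bounded)
    have "(\<integral>\<^sup>+p. ennreal (norm (?H p)) \<partial>(M \<Otimes>\<^sub>M M)) = (\<integral>\<^sup>+y. (\<integral>\<^sup>+z. ennreal (norm (?H (y, z))) \<partial>M) \<partial>M)"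
      by (rule nn_integral_fst[symmetric]) measurable
    also have "\<dots> \<le> (\<integral>\<^sup>+y. (\<integral>\<^sup>+z. ennreal (norm (f z) * C) * ennreal (K y z) \<partial>M) \<partial>M)"
    proof (intro nn_integral_mono)
      fix y z assume y: "y \<in> space M"
      have "norm (?H (y, z)) = norm (f z) * norm (g y) * K y z"
        by (simp add: norm_mult kernel_nonneg)
      also have "\<dots> \<le> norm (f z) * C * K y z"
        by (intro mult_right_mono mult_left_mono le y kernel_nonneg norm_ge_zero)
      finally show "ennreal (norm (?H (y, z))) \<le> ennreal (norm (f z) * C) * ennreal (K y z)"
        unfolding ennreal_mult''[OF kernel_nonneg, symmetric] by (rule ennreal_leI)
    qed
    also have "\<dots> = (\<integral>\<^sup>+z. ennreal (norm (f z) * C) \<partial>M)"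
      by (rule nn_integral_kernel) measurable
    also have "\<dots> \<le> (\<integral>\<^sup>+z. ennreal (norm (norm (f z) * C)) \<partial>M)"
      by (intro nn_integral_mono ennreal_leI) simp
    also have "\<dots> < \<infinity>"
    proof -
      have "integrable M (\<lambda>z. norm (f z) * C)" using f by simp
      thus ?thesis by (simp only: integrable_iff_bounded)
    qed
    finally show "(\<integral>\<^sup>+p. ennreal (norm (?H p)) \<partial>(M \<Otimes>\<^sub>M M)) < \<infinity>" .
  qed measurable
  have 1: "(LINT z|M. ?H (y, z)) = apply_kernel f y * g y" for y
    by (simp add: apply_kernel_def)
  have 2: "(LINT y|M. ?H (y, z)) = f z * apply_kernel g z" for z
    by (simp add: apply_kernel_def mult_ac kernel_commute[of z] flip: integral_mult_right_zero)
  show "integrable M (\<lambda>y. apply_kernel f y * g y)"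
    using pair.integrable_fst'[OF int] unfolding 1 .
  show "integrable M (\<lambda>y. f y * apply_kernel g y)"
    using pair.integrable_snd[of "\<lambda>y z. ?H (y, z)"] int 2 by simp
  show "(LINT y|M. apply_kernel f y * g y) = (LINT y|M. f y * apply_kernel g y)"
    using pair.Fubini_integral[of "\<lambda>y z. ?H (y, z)"] int unfolding 1 2 by simp
qed

end

section \<open>The Bessel measure and the Bessel kernel\<close>

lemma sigma_finite_lebesgue: "sigma_finite_measure (lebesgue :: real measure)"
proof
  obtain A :: "real set set" where A: "countable A" "A \<subseteq> sets lborel" "\<Union>A = space lborel"
      "\<forall>a\<in>A. emeasure lborel a \<noteq> \<infinity>"
    using lborel.sigma_finite_countable by blast
  show "\<exists>A::real set set. countable A \<and> A \<subseteq> sets lebesgue \<and> \<Union>A = space lebesgue \<and> (\<forall>a\<in>A. emeasure lebesgue a \<noteq> \<infinity>)"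
    by (intro exI[of _ A]) (use A in auto)
qed

lemma sets_bessel_measure: "sets (bessel_measure \<nu>) = sets (lebesgue_on {0..})"
  by (simp add: bessel_measure_def)

lemma borel_measurable_bessel_measure: "f \<in> borel_measurable borel \<Longrightarrow> f \<in> borel_measurable (bessel_measure \<nu>)"
  unfolding measurable_cong_sets[OF sets_bessel_measure refl]
  by (intro measurable_restrict_space1 measurable_completion) simp

lemma measurable_powr_lebesgue_on:
  "(\<lambda>y. ennreal (y powr a)) \<in> borel_measurable (lebesgue_on {0..})" "(\<lambda>y. y powr a) \<in> borel_measurable (lebesgue_on {0..})"
  by (rule measurable_restrict_space1, rule measurable_completion, measurable)+

text \<open>Lebesgue measure and hence the Bessel measure are complete, but the Tonelli and Fubini theorems need
  only \<open>\<sigma>\<close>-finiteness. Lebesgue measurable functions can thus be treated without passing to Borel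
  representatives.\<close>

lemma sigma_finite_bessel_measure: "sigma_finite_measure (bessel_measure \<nu>)"
proof -
  interpret sigma_finite_measure "lebesgue_on {0::real..}"
    by (intro sigma_finite_measure_restrict_space sigma_finite_lebesgue) simp
  show ?thesis unfolding bessel_measure_def
    using sigma_finite_iff_density_finite[OF measurable_powr_lebesgue_on(1)] by simp
qed

lemma AE_lebesgue_on_pos: "AE y in lebesgue_on {0::real..}. y > 0"
proof -
  have "AE y::real in lborel. y \<noteq> 0" by (rule AE_lborel_singleton)
  hence "AE y::real in lebesgue. y \<noteq> 0" by (rule AE_completion)
  hence "AE y::real in lebesgue. y \<in> {0..} \<longrightarrow> y > 0" by eventually_elim auto
  thus ?thesis by (subst AE_restrict_space_iff) auto
qed

lemma AE_bessel_measure_iff: "(AE y in bessel_measure \<nu>. P y) \<longleftrightarrow> (AE y in lebesgue_on {0..}. P y)"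
  unfolding bessel_measure_def AE_density[OF measurable_powr_lebesgue_on(1)]
proof
  assume "AE y in lebesgue_on {0..}. 0 < ennreal (y powr (2 * \<nu> + 1)) \<longrightarrow> P y"
  with AE_lebesgue_on_pos show "AE y in lebesgue_on {0..}. P y" by eventually_elim simp
next
  assume "AE y in lebesgue_on {0..}. P y"
  thus "AE y in lebesgue_on {0..}. 0 < ennreal (y powr (2 * \<nu> + 1)) \<longrightarrow> P y" by eventually_elim simp
qed

lemma AE_bessel_measure_pos: "AE y in bessel_measure \<nu>. y > 0"
  unfolding AE_bessel_measure_iff by (rule AE_lebesgue_on_pos)

lemma triangle_area_commute: "triangle_area x y z = triangle_area x z y"
proof -
  have "(x + y + z) * (x + y - z) * (x - y + z) * (y + z - x)
      = (x + z + y) * (x + z - y) * (x - z + y) * (z + y - x)" by algebra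
  thus ?thesis by (simp only: triangle_area_def)
qed

lemma bessel_kernel_commute: "bessel_kernel \<nu> x y z = bessel_kernel \<nu> x z y"
proof -
  have "z \<in> {\<bar>x - y\<bar>..x + y} \<longleftrightarrow> y \<in> {\<bar>x - z\<bar>..x + z}" by auto
  hence "(indicator {\<bar>x - y\<bar>..x + y} z :: real) = indicator {\<bar>x - z\<bar>..x + z} y"
    by (simp only: indicator_def)
  thus ?thesis unfolding bessel_kernel_def triangle_area_commute[of x y z] by (simp add: mult_ac)
qed

lemma bessel_kernel_nonneg: "\<nu> > - 1 / 2 \<Longrightarrow> bessel_kernel \<nu> x y z \<ge> 0"
  unfolding bessel_kernel_def by (auto intro!: mult_nonneg_nonneg divide_nonneg_nonneg)

lemma bessel_kernel_measurable [measurable]: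
  "(\<lambda>(y, z). bessel_kernel \<nu> x y z) \<in> borel_measurable (borel \<Otimes>\<^sub>M borel)"
proof -
  have "(\<lambda>p :: real \<times> real. indicator {\<bar>x - fst p\<bar>..x + fst p} (snd p) :: real)
      = (\<lambda>p. if \<bar>x - fst p\<bar> \<le> snd p \<and> snd p \<le> x + fst p then 1 else 0)"
    by (auto simp: indicator_def)
  also have "\<dots> \<in> borel_measurable (borel \<Otimes>\<^sub>M borel)" by measurable
  finally have [measurable]: "(\<lambda>p :: real \<times> real. indicator {\<bar>x - fst p\<bar>..x + fst p} (snd p) :: real)
      \<in> borel_measurable (borel \<Otimes>\<^sub>M borel)" .
  show ?thesis
    unfolding bessel_kernel_def triangle_area_def case_prod_unfold by measurable
qed

text \<open>Heron's formula against half the product of two sides and the sine of the enclosed angle.\<close>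

lemma triangle_area_radius:
  assumes "x > 0" "y > 0" "\<theta> \<in> {0<..<pi}"
  shows "triangle_area x y (bessel_radius x y \<theta>) = x * y * sin \<theta> / 2"
proof -
  let ?z = "bessel_radius x y \<theta>"
  have "(x + y + ?z) * (x + y - ?z) * (x - y + ?z) * (y + ?z - x) = ((x + y)\<^sup>2 - ?z\<^sup>2) * (?z\<^sup>2 - (x - y)\<^sup>2)"
    by (simp add: power2_eq_square algebra_simps)
  also have "\<dots> = (2 * x * y)\<^sup>2 * (1 - (cos \<theta>)\<^sup>2)"
    unfolding bessel_radius_square by (simp add: power2_eq_square algebra_simps)
  also have "\<dots> = (2 * (x * y * sin \<theta>))\<^sup>2"
    by (simp add: sin_squared_eq power_mult_distrib)
  finally have "triangle_area x y ?z = 1 / 4 * \<bar>2 * (x * y * sin \<theta>)\<bar>"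
    by (simp only: triangle_area_def real_sqrt_abs)
  moreover have "x * y * sin \<theta> > 0" using assms by (intro mult_pos_pos sin_gt_zero) auto
  ultimately show ?thesis by simp
qed

lemma triangle_area_degenerate:
  assumes "x > 0" "y > 0" "z = \<bar>x - y\<bar> \<or> z = x + y"
  shows "triangle_area x y z = 0"
  using assms unfolding triangle_area_def by (auto simp: abs_if)

lemma bessel_radius_bij:
  assumes x: "x > 0" and y: "y > 0"
  shows "inj_on (bessel_radius x y) {0<..<pi}" "bessel_radius x y ` {0<..<pi} = {\<bar>x - y\<bar><..<x + y}"
proof -
  show "inj_on (bessel_radius x y) {0<..<pi}"
  proof (rule inj_onI)
    fix s t assume st: "s \<in> {0<..<pi}" "t \<in> {0<..<pi}" "bessel_radius x y s = bessel_radius x y t"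
    hence "(bessel_radius x y s)\<^sup>2 = (bessel_radius x y t)\<^sup>2" by simp
    hence "cos s = cos t" unfolding bessel_radius_square using x y by simp
    thus "s = t" using st cos_inj_pi[of s t] by simp
  qed
  show "bessel_radius x y ` {0<..<pi} = {\<bar>x - y\<bar><..<x + y}"
  proof (intro equalityI subsetI)
    fix z assume "z \<in> bessel_radius x y ` {0<..<pi}"
    then obtain t where t: "0 < t" "t < pi" "z = bessel_radius x y t" by auto
    have c: "cos t < cos 0" "cos pi < cos t" using t by (intro cos_monotone_0_pi; simp)+
    have z: "z \<ge> 0" "z\<^sup>2 = x\<^sup>2 + y\<^sup>2 - 2 * x * y * cos t" using t bessel_radius_square by auto
    have xy: "x * y > 0" using x y by simp
    have "x * y * cos t < x * y * 1" "x * y * (- 1) < x * y * cos t"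
      using c xy by (intro mult_strict_left_mono; simp)+
    hence "\<bar>x - y\<bar>\<^sup>2 < z\<^sup>2" "z\<^sup>2 < (x + y)\<^sup>2"
      unfolding z(2) power2_abs by (simp_all add: power2_diff power2_sum)
    hence "\<bar>x - y\<bar> < z" "z < x + y"
      using z(1) x y by (auto intro: power2_less_imp_less)
    thus "z \<in> {\<bar>x - y\<bar><..<x + y}" by (simp only: greaterThanLessThan_iff)
  next
    fix z assume z: "z \<in> {\<bar>x - y\<bar><..<x + y}"
    define c where "c = (x\<^sup>2 + y\<^sup>2 - z\<^sup>2) / (2 * x * y)"
    have sq: "\<bar>x - y\<bar>\<^sup>2 < z\<^sup>2" "z\<^sup>2 < (x + y)\<^sup>2"
      using z x y by (intro power_strict_mono; auto)+
    have "z > 0" using z by (auto intro: le_less_trans[OF abs_ge_zero])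
    have "- 1 < c" "c < 1"
      using sq x y unfolding c_def power2_abs less_divide_eq divide_less_eq
      by (simp_all add: power2_diff power2_sum)
    hence "arccos c \<in> {0<..<pi}" "cos (arccos c) = c" using arccos_lt_bounded[of c] by auto
    moreover have "bessel_radius x y (arccos c) = z"
    proof -
      have "2 * x * y * c = x\<^sup>2 + y\<^sup>2 - z\<^sup>2" using x y by (simp add: c_def)
      thus ?thesis using \<open>z > 0\<close> unfolding bessel_radius_def \<open>cos (arccos c) = c\<close> by simp
    qed
    ultimately show "z \<in> bessel_radius x y ` {0<..<pi}" by blast
  qed
qed

lemma bessel_radius_angle_deriv:
  assumes "x > 0" "y > 0" "\<theta> \<in> {0<..<pi}"
  shows "(bessel_radius x y has_real_derivative x * y * sin \<theta> / bessel_radius x y \<theta>) (at \<theta> within S)"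
    and "bessel_radius x y \<theta> > 0"
proof -
  have "x * sin \<theta> \<noteq> 0" using assms sin_gt_zero[of \<theta>] by auto
  hence pos: "x\<^sup>2 + y\<^sup>2 - 2 * x * y * cos \<theta> > 0"
    unfolding bessel_radius_polar by (intro add_nonneg_pos) auto
  thus "bessel_radius x y \<theta> > 0" by (simp add: bessel_radius_def)
  show "(bessel_radius x y has_real_derivative x * y * sin \<theta> / bessel_radius x y \<theta>) (at \<theta> within S)"
    unfolding bessel_radius_def[abs_def] using pos by (auto intro!: derivative_eq_intros simp: divide_simps)
qed

text \<open>The kernel is the density created by the substitution \<open>z = r (\<theta>)\<close>, since \<open>dz = (x y sin \<theta> / z) d\<theta>\<close> and
  the area of the triangle is \<open>x y sin \<theta> / 2\<close>.\<close>

lemma bessel_kernel_jacobian: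
  assumes x: "x > 0" and y: "y > 0" and th: "\<theta> \<in> {0<..<pi}"
  shows "\<bar>x * y * sin \<theta> / bessel_radius x y \<theta>\<bar>
      * (bessel_radius x y \<theta> powr (2 * \<nu> + 1) * bessel_kernel \<nu> x y (bessel_radius x y \<theta>))
    = bessel_const \<nu> * sin \<theta> powr (2 * \<nu>)"
proof -
  define z where "z = bessel_radius x y \<theta>"
  define q where "q = x * y"
  define s where "s = sin \<theta>"
  have pos: "z > 0" "q > 0" "s > 0"
    using bessel_radius_angle_deriv(2)[OF assms] x y th by (auto simp: z_def q_def s_def sin_gt_zero)
  have "z \<in> {\<bar>x - y\<bar><..<x + y}"
    unfolding z_def bessel_radius_bij(2)[OF x y, symmetric] using th by (rule imageI)
  hence K: "bessel_kernel \<nu> x y z = 2 powr (2 * \<nu> - 1) * bessel_const \<nu> * ((q * s / 2) powr (2 * \<nu> - 1) / (q * z) powr (2 * \<nu>))"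
    unfolding bessel_kernel_def z_def triangle_area_radius[OF assms] bessel_const_def
    by (simp add: q_def s_def)
  have e1: "2 powr (2 * \<nu> - 1) * (q * s / 2) powr (2 * \<nu> - 1) = (q * s) powr (2 * \<nu> - 1)"
    using pos by (simp flip: powr_mult)
  have e2: "(q * s) powr (2 * \<nu> - 1) * (q * s) = q powr (2 * \<nu>) * s powr (2 * \<nu>)"
    using pos powr_mult_base[of "q * s" "2 * \<nu> - 1"] by (simp add: powr_mult mult.commute)
  have e3: "z powr (2 * \<nu> + 1) = z powr (2 * \<nu>) * z" using pos by (simp add: powr_add)
  have e4: "(q * z) powr (2 * \<nu>) = q powr (2 * \<nu>) * z powr (2 * \<nu>)" using pos by (simp add: powr_mult)
  have "q * s / z * (z powr (2 * \<nu> + 1) * bessel_kernel \<nu> x y z)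
      = bessel_const \<nu> * ((2 powr (2 * \<nu> - 1) * (q * s / 2) powr (2 * \<nu> - 1)) * (q * s)) / q powr (2 * \<nu>)"
    unfolding K e3 e4 using pos by (simp add: field_simps)
  also have "\<dots> = bessel_const \<nu> * s powr (2 * \<nu>)"
    unfolding e1 e2 using pos by simp
  finally show ?thesis
    using pos by (simp add: z_def q_def s_def)
qed

text \<open>The change of variables \<open>z = r (\<theta>)\<close> on the open interval \<open>(0, \<pi>)\<close>, which the radius maps bijectively
  and smoothly onto \<open>(\<bar>x - y\<bar>, x + y)\<close>.\<close>

lemma bessel_kernel_integral:
  fixes f :: "real \<Rightarrow> complex"
  assumes nu: "\<nu> > - 1 / 2" and x: "x > 0" and y: "y > 0" and f: "continuous_on UNIV f"
  shows "integrable (bessel_measure \<nu>) (\<lambda>z. f z * complex_of_real (bessel_kernel \<nu> x y z))"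
    and "(LINT z|bessel_measure \<nu>. f z * complex_of_real (bessel_kernel \<nu> x y z)) = bessel_translation \<nu> x f y"
proof -
  let ?S = "{0<..<pi}"
  let ?I = "{\<bar>x - y\<bar><..<x + y}"
  let ?F = "\<lambda>z. (z powr (2 * \<nu> + 1) * bessel_kernel \<nu> x y z) *\<^sub>R f z"
  let ?G = "\<lambda>\<theta>. angular_density \<nu> \<theta> *\<^sub>R f (bessel_radius x y \<theta>)"
  have [measurable]: "f \<in> borel_measurable borel"
    by (rule borel_measurable_continuous_onI[OF f])
  have [measurable]: "(\<lambda>\<theta>. f (bessel_radius x y \<theta>)) \<in> borel_measurable borel"
    by (intro borel_measurable_continuous_onI continuous_on_UNIV_compose[OF f] continuous_intros)
  have [measurable]: "bessel_kernel \<nu> x y \<in> borel_measurable borel" by measurable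
  have G0: "indicator ?S \<theta> *\<^sub>R ?G \<theta> = ?G \<theta>" for \<theta>
  proof -
    have "\<theta> \<in> ?S \<or> \<theta> \<notin> {0..pi} \<or> \<theta> = 0 \<or> \<theta> = pi" by auto
    thus ?thesis by (auto simp: angular_density_def)
  qed
  have "integrable (angular_measure \<nu>) (\<lambda>\<theta>. f (bessel_radius x y \<theta>))"
    by (rule integrable_angular_radius[OF nu f])
  hence intG: "integrable lborel ?G"
    unfolding angular_measure_def by (subst (asm) integrable_density) (auto simp: angular_density_nonneg[OF nu])
  hence absG: "?G absolutely_integrable_on ?S"
    unfolding set_integrable_def G0 by (subst integrable_completion) auto
  have "integral ?S ?G = (LINT \<theta>:?S|lebesgue. ?G \<theta>)"
    by (rule set_lebesgue_integral_eq_integral(2)[OF absG, symmetric])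
  also have "\<dots> = (LINT \<theta>|lborel. ?G \<theta>)"
    unfolding set_lebesgue_integral_def G0 by (rule integral_completion) measurable
  also have "\<dots> = (LINT \<theta>|angular_measure \<nu>. f (bessel_radius x y \<theta>))"
    unfolding angular_measure_def by (subst integral_density) (auto simp: angular_density_nonneg[OF nu])
  also have "\<dots> = bessel_translation \<nu> x f y"
    by (rule bessel_translation_eq_angular[OF nu f, symmetric])
  finally have valG: "integral ?S ?G = bessel_translation \<nu> x f y" .
  have jac: "\<bar>x * y * sin \<theta> / bessel_radius x y \<theta>\<bar> *\<^sub>R ?F (bessel_radius x y \<theta>) = ?G \<theta>" if "\<theta> \<in> ?S" for \<theta>
    unfolding scaleR_scaleR bessel_kernel_jacobian[OF x y that] using that by (simp add: angular_density_def)
  have "(\<lambda>\<theta>. \<bar>x * y * sin \<theta> / bessel_radius x y \<theta>\<bar> *\<^sub>R ?F (bessel_radius x y \<theta>)) absolutely_integrable_on ?S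
      \<and> integral ?S (\<lambda>\<theta>. \<bar>x * y * sin \<theta> / bessel_radius x y \<theta>\<bar> *\<^sub>R ?F (bessel_radius x y \<theta>)) = bessel_translation \<nu> x f y"
    by (rule conjI[OF iffD2[OF set_integrable_cong[OF refl refl jac] absG]
          trans[OF Henstock_Kurzweil_Integration.integral_cong[OF jac] valG]])
  hence "?F absolutely_integrable_on bessel_radius x y ` ?S \<and> integral (bessel_radius x y ` ?S) ?F = bessel_translation \<nu> x f y"
    by (subst (asm) has_absolute_integral_change_of_variables_real)
       (auto simp: bessel_radius_bij[OF x y] intro!: bessel_radius_angle_deriv(1)[OF x y])
  hence absF: "?F absolutely_integrable_on ?I" and valF: "integral ?I ?F = bessel_translation \<nu> x f y"
    unfolding bessel_radius_bij[OF x y] by auto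
  \<comment> \<open>at the endpoints of the interval the triangle degenerates, and the kernel is zero since \<open>0 powr a = 0\<close>\<close>
  have F0: "indicator ?I z *\<^sub>R ?F z = indicator {0..} z *\<^sub>R ?F z" for z
  proof -
    have "z \<in> ?I \<or> z \<notin> {\<bar>x - y\<bar>..x + y} \<or> z = \<bar>x - y\<bar> \<or> z = x + y" by auto
    thus ?thesis
    proof (elim disjE)
      assume "z = \<bar>x - y\<bar>" thus ?thesis using triangle_area_degenerate[OF x y] by (simp add: bessel_kernel_def)
    next
      assume "z = x + y" thus ?thesis using triangle_area_degenerate[OF x y] by (simp add: bessel_kernel_def)
    qed (auto simp: bessel_kernel_def)
  qed
  have meas: "(\<lambda>z. f z * complex_of_real (bessel_kernel \<nu> x y z)) \<in> borel_measurable (lebesgue_on {0..})"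
    by (intro measurable_restrict_space1 measurable_completion) measurable
  have F1: "z powr (2 * \<nu> + 1) *\<^sub>R (f z * complex_of_real (bessel_kernel \<nu> x y z)) = ?F z" for z
    by (simp add: scaleR_conv_of_real mult_ac)
  have "integrable (lebesgue_on {0..}) ?F"
    using absF unfolding set_integrable_def F0 by (subst integrable_restrict_space) auto
  thus "integrable (bessel_measure \<nu>) (\<lambda>z. f z * complex_of_real (bessel_kernel \<nu> x y z))"
    unfolding bessel_measure_def
    by (subst integrable_density[OF meas measurable_powr_lebesgue_on(2)]) (auto simp: F1)
  have "(LINT z|bessel_measure \<nu>. f z * complex_of_real (bessel_kernel \<nu> x y z)) = (LINT z|lebesgue_on {0..}. ?F z)"
    unfolding bessel_measure_def
    by (subst integral_density[OF meas measurable_powr_lebesgue_on(2)]) (auto simp: F1)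
  also have "\<dots> = (LINT z:?I|lebesgue. ?F z)"
    unfolding set_lebesgue_integral_def F0 by (rule integral_restrict_space) simp
  also have "\<dots> = bessel_translation \<nu> x f y"
    unfolding set_lebesgue_integral_eq_integral(2)[OF absF] by (rule valF)
  finally show "(LINT z|bessel_measure \<nu>. f z * complex_of_real (bessel_kernel \<nu> x y z)) = bessel_translation \<nu> x f y" .
qed

lemma bessel_translation_const:
  assumes nu: "\<nu> > - 1 / 2"
  shows "bessel_translation \<nu> x (\<lambda>_. c) y = c"
proof -
  interpret prob_space "angular_measure \<nu>" by (rule angular_measure_prob_space[OF nu])
  show ?thesis using prob_space by (subst bessel_translation_eq_angular[OF nu]) auto
qed

text \<open>Mass one expresses that the translation fixes the constant function one.\<close>

lemma bessel_kernel_markov: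
  assumes nu: "\<nu> > - 1 / 2" and x: "x > 0"
  shows "symmetric_markov_kernel (bessel_measure \<nu>) (bessel_kernel \<nu> x)"
proof -
  interpret sigma_finite_measure "bessel_measure \<nu>" by (rule sigma_finite_bessel_measure)
  have id: "(\<lambda>x. x) \<in> borel_measurable (bessel_measure \<nu>)"
    by (rule borel_measurable_bessel_measure) simp
  show ?thesis
  proof
    have "(\<lambda>p. (\<lambda>(y, z). bessel_kernel \<nu> x y z) (fst p, snd p)) \<in> borel_measurable (bessel_measure \<nu> \<Otimes>\<^sub>M bessel_measure \<nu>)"
      by (rule measurable_compose[OF _ bessel_kernel_measurable])
         (rule measurable_Pair[OF measurable_compose[OF measurable_fst id] measurable_compose[OF measurable_snd id]])
    thus "(\<lambda>(y, z). bessel_kernel \<nu> x y z) \<in> borel_measurable (bessel_measure \<nu> \<Otimes>\<^sub>M bessel_measure \<nu>)"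
      by (simp add: case_prod_unfold)
    show "AE y in bessel_measure \<nu>. (\<integral>\<^sup>+z. ennreal (bessel_kernel \<nu> x y z) \<partial>bessel_measure \<nu>) = 1"
      using AE_bessel_measure_pos
    proof eventually_elim
      case (elim y)
      note B = bessel_kernel_integral[OF nu x elim, of "\<lambda>_. 1", simplified]
      have int: "integrable (bessel_measure \<nu>) (bessel_kernel \<nu> x y)"
        using integrable_Re[OF B(1)] by simp
      have "complex_of_real (LINT z|bessel_measure \<nu>. bessel_kernel \<nu> x y z) = 1"
        using B(2) bessel_translation_const[OF nu] by (simp only: integral_complex_of_real)
      hence "(LINT z|bessel_measure \<nu>. bessel_kernel \<nu> x y z) = 1" by (simp only: of_real_eq_1_iff)
      thus ?case using int by (subst nn_integral_eq_integral) (auto simp: bessel_kernel_nonneg[OF nu])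
    qed
  qed (rule bessel_kernel_nonneg[OF nu] bessel_kernel_commute)+
qed

section \<open>Lebesgue spaces\<close>

lemma Lp_functions_measurable: "f \<in> Lp_functions \<nu> p \<Longrightarrow> f \<in> borel_measurable (bessel_measure \<nu>)"
  by (simp add: Lp_functions_def)

lemma Lp_functions_finite:
  assumes "0 \<le> p"
  shows "f \<in> Lp_functions \<nu> (ennreal p) \<longleftrightarrow> f \<in> borel_measurable (bessel_measure \<nu>) \<and>
    (\<integral>\<^sup>+y. ennreal (norm (f y) powr p) \<partial>bessel_measure \<nu>) < \<infinity>"
  using assms by (auto simp: Lp_functions_def integrable_iff_bounded)

lemma Lp_norm_finite:
  assumes "0 \<le> p"
  shows "Lp_norm \<nu> (ennreal p) f = (LINT y|bessel_measure \<nu>. norm (f y) powr p) powr (1 / p)"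
  using assms by (simp add: Lp_norm_def)

lemma Lp_functions_1: "f \<in> Lp_functions \<nu> 1 \<longleftrightarrow> integrable (bessel_measure \<nu>) f"
  by (auto simp: Lp_functions_def integrable_norm_iff)

lemma nn_integral_powr_eq_Lp_norm:
  assumes p: "0 < p" and f: "f \<in> Lp_functions \<nu> (ennreal p)"
  shows "(\<integral>\<^sup>+y. ennreal (norm (f y) powr p) \<partial>bessel_measure \<nu>) = ennreal (Lp_norm \<nu> (ennreal p) f powr p)"
proof -
  have int: "integrable (bessel_measure \<nu>) (\<lambda>y. norm (f y) powr p)"
    using p f by (simp add: Lp_functions_def)
  have "Lp_norm \<nu> (ennreal p) f powr p = (LINT y|bessel_measure \<nu>. norm (f y) powr p)"
    using p by (simp add: Lp_norm_finite powr_powr)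
  thus ?thesis using nn_integral_eq_integral[OF int] by simp
qed

lemma ennreal_cases_ge_1:
  fixes p :: ennreal
  assumes "1 \<le> p"
  obtains "p = \<infinity>" | r where "p = ennreal r" "r \<ge> 1"
proof (cases p)
  case (real r)
  hence "r \<ge> 1" using assms by (simp add: ennreal_1[symmetric] del: ennreal_1)
  thus ?thesis using real that by blast
qed (use that in auto)

lemma esssup_Lp_bound:
  assumes "f \<in> Lp_functions \<nu> \<infinity>"
  shows "AE y in bessel_measure \<nu>. norm (f y) \<le> Lp_norm \<nu> \<infinity> f"
proof -
  have "esssup (bessel_measure \<nu>) (\<lambda>y. ennreal (norm (f y))) < \<infinity>"
    using assms by (simp add: Lp_functions_def)
  hence e: "esssup (bessel_measure \<nu>) (\<lambda>y. ennreal (norm (f y))) = ennreal (Lp_norm \<nu> \<infinity> f)"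
    by (simp add: Lp_norm_def)
  have nn: "0 \<le> Lp_norm \<nu> \<infinity> f" by (simp add: Lp_norm_def)
  show ?thesis using esssup_AE[of "\<lambda>y. ennreal (norm (f y))" "bessel_measure \<nu>"]
    unfolding e by eventually_elim (use nn in simp)
qed

lemma Lp_infinity_boundedI:
  assumes f [measurable]: "f \<in> borel_measurable (bessel_measure \<nu>)" and "0 \<le> C"
    and le: "AE y in bessel_measure \<nu>. norm (f y) \<le> C"
  shows "f \<in> Lp_functions \<nu> \<infinity>" "Lp_norm \<nu> \<infinity> f \<le> C"
proof -
  have "esssup (bessel_measure \<nu>) (\<lambda>y. ennreal (norm (f y))) \<le> ennreal C"
  proof (rule esssup_I)
    show "AE y in bessel_measure \<nu>. ennreal (norm (f y)) \<le> ennreal C"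
      using le by eventually_elim (rule ennreal_leI)
  qed measurable
  note e = this
  thus "f \<in> Lp_functions \<nu> \<infinity>"
    using f by (auto simp: Lp_functions_def intro: le_less_trans)
  show "Lp_norm \<nu> \<infinity> f \<le> C"
    using enn2real_mono[OF e] \<open>0 \<le> C\<close> by (simp add: Lp_norm_def)
qed

text \<open>Used to transfer membership and norm bounds between functions with almost everywhere equal modulus,
  for finite and infinite exponents alike.\<close>

lemma Lp_mono:
  assumes p: "1 \<le> p" and f: "f \<in> Lp_functions \<nu> p" and g: "g \<in> borel_measurable (bessel_measure \<nu>)"
    and le: "AE y in bessel_measure \<nu>. norm (g y) \<le> norm (f y)"
  shows "g \<in> Lp_functions \<nu> p" "Lp_norm \<nu> p g \<le> Lp_norm \<nu> p f"
proof -
  note fm = Lp_functions_measurable[OF f]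
  have "g \<in> Lp_functions \<nu> p \<and> Lp_norm \<nu> p g \<le> Lp_norm \<nu> p f"
  proof (rule ennreal_cases_ge_1[OF p])
    assume p: "p = \<infinity>"
    have "AE y in bessel_measure \<nu>. norm (g y) \<le> Lp_norm \<nu> \<infinity> f"
      using le esssup_Lp_bound[OF f[unfolded p]] by eventually_elim simp
    from Lp_infinity_boundedI[OF g _ this] show ?thesis
      by (simp add: p Lp_norm_def)
  next
    fix r assume r: "p = ennreal r" "r \<ge> 1"
    have int: "integrable (bessel_measure \<nu>) (\<lambda>y. norm (f y) powr r)"
      using r f by (simp add: Lp_functions_def)
    have le': "AE y in bessel_measure \<nu>. norm (g y) powr r \<le> norm (f y) powr r"
      using le by eventually_elim (use r in \<open>auto intro: powr_mono2\<close>)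
    have int': "integrable (bessel_measure \<nu>) (\<lambda>y. norm (g y) powr r)"
    proof (rule Bochner_Integration.integrable_bound[OF int])
      show "AE y in bessel_measure \<nu>. norm (norm (g y) powr r) \<le> norm (norm (f y) powr r)"
        using le' by eventually_elim simp
    qed (use g in measurable)
    have "(LINT y|bessel_measure \<nu>. norm (g y) powr r) \<le> (LINT y|bessel_measure \<nu>. norm (f y) powr r)"
      by (intro integral_mono_AE int int' le')
    hence "Lp_norm \<nu> p g \<le> Lp_norm \<nu> p f"
      using r by (auto simp: Lp_norm_finite intro!: powr_mono2 integral_nonneg_AE)
    thus ?thesis using int' g r by (simp add: Lp_functions_def)
  qed
  thus "g \<in> Lp_functions \<nu> p" "Lp_norm \<nu> p g \<le> Lp_norm \<nu> p f" by auto
qed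

lemma powr_add_le:
  fixes a b p :: real
  assumes "a \<ge> 0" "b \<ge> 0" "p \<ge> 0"
  shows "(a + b) powr p \<le> 2 powr p * (a powr p + b powr p)"
proof -
  have "(a + b) powr p \<le> (2 * max a b) powr p" using assms by (intro powr_mono2) auto
  also have "\<dots> = 2 powr p * max a b powr p" by (simp add: powr_mult)
  also have "\<dots> \<le> 2 powr p * (a powr p + b powr p)"
    by (intro mult_left_mono) (auto simp: max_def)
  finally show ?thesis .
qed

text \<open>A weak form of Minkowski's inequality; the factor \<open>2 powr p\<close> is harmless, as it serves only to show that
  integrals are finite or tend to zero.\<close>

lemma nn_integral_powr_add_le:
  fixes f g :: "'a \<Rightarrow> complex"
  assumes p: "0 \<le> p" and [measurable]: "f \<in> borel_measurable M" "g \<in> borel_measurable M"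
    and le: "AE y in M. norm (h y) \<le> norm (f y) + norm (g y)"
  shows "(\<integral>\<^sup>+y. ennreal (norm (h y) powr p) \<partial>M)
    \<le> ennreal (2 powr p) * ((\<integral>\<^sup>+y. ennreal (norm (f y) powr p) \<partial>M) + (\<integral>\<^sup>+y. ennreal (norm (g y) powr p) \<partial>M))"
proof -
  have "(\<integral>\<^sup>+y. ennreal (norm (h y) powr p) \<partial>M)
      \<le> (\<integral>\<^sup>+y. ennreal (2 powr p) * (ennreal (norm (f y) powr p) + ennreal (norm (g y) powr p)) \<partial>M)"
  proof (rule nn_integral_mono_AE)
    show "AE y in M. ennreal (norm (h y) powr p)
        \<le> ennreal (2 powr p) * (ennreal (norm (f y) powr p) + ennreal (norm (g y) powr p))"
      using le
    proof eventually_elim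
      case (elim y)
      have "norm (h y) powr p \<le> (norm (f y) + norm (g y)) powr p"
        using elim p by (intro powr_mono2) auto
      also have "\<dots> \<le> 2 powr p * (norm (f y) powr p + norm (g y) powr p)"
        using p by (intro powr_add_le) auto
      finally show ?case
        by (simp add: ennreal_mult'[symmetric] ennreal_plus[symmetric] ennreal_leI del: ennreal_plus)
    qed
  qed
  also have "\<dots> = ennreal (2 powr p) * ((\<integral>\<^sup>+y. ennreal (norm (f y) powr p) \<partial>M) + (\<integral>\<^sup>+y. ennreal (norm (g y) powr p) \<partial>M))"
    by (simp add: nn_integral_cmult nn_integral_add)
  finally show ?thesis .
qed

lemma Lp_diff:
  assumes p: "1 \<le> p" and f: "f \<in> Lp_functions \<nu> p" and g: "g \<in> Lp_functions \<nu> p"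
  shows "(\<lambda>t. g t - f t) \<in> Lp_functions \<nu> p"
proof (rule ennreal_cases_ge_1[OF p])
  note [measurable] = Lp_functions_measurable[OF f] Lp_functions_measurable[OF g]
  assume p: "p = \<infinity>"
  show ?thesis unfolding p
  proof (rule Lp_infinity_boundedI)
    show "AE y in bessel_measure \<nu>. norm (g y - f y) \<le> Lp_norm \<nu> \<infinity> g + Lp_norm \<nu> \<infinity> f"
      using esssup_Lp_bound[OF f[unfolded p]] esssup_Lp_bound[OF g[unfolded p]]
      by eventually_elim (rule order_trans[OF norm_triangle_ineq4 add_mono])
  qed (auto simp: Lp_norm_def)
next
  note [measurable] = Lp_functions_measurable[OF f] Lp_functions_measurable[OF g]
  fix r assume r: "p = ennreal r" "r \<ge> 1"
  have "(\<integral>\<^sup>+y. ennreal (norm (g y - f y) powr r) \<partial>bessel_measure \<nu>)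
    \<le> ennreal (2 powr r) * ((\<integral>\<^sup>+y. ennreal (norm (g y) powr r) \<partial>bessel_measure \<nu>)
       + (\<integral>\<^sup>+y. ennreal (norm (f y) powr r) \<partial>bessel_measure \<nu>))"
    using r by (intro nn_integral_powr_add_le AE_I2 norm_triangle_ineq4) auto
  also have "\<dots> < \<infinity>"
    using f g r by (simp add: Lp_functions_finite ennreal_mult_less_top ennreal_add_less_top)
  finally show ?thesis using r by (simp add: Lp_functions_finite)
qed

lemma bessel_translation_Lp_contraction:
  assumes nu: "\<nu> > - 1 / 2" and p: "1 \<le> p" and x: "x \<ge> 0" and f: "f \<in> Lp_functions \<nu> p"
  shows "AE y in bessel_measure \<nu>. bessel_translation_Lp_defined_at \<nu> x f y"
    and "bessel_translation_Lp \<nu> x f \<in> Lp_functions \<nu> p"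
    and "Lp_norm \<nu> p (bessel_translation_Lp \<nu> x f) \<le> Lp_norm \<nu> p f"
proof -
  note fm = Lp_functions_measurable[OF f]
  have "(AE y in bessel_measure \<nu>. bessel_translation_Lp_defined_at \<nu> x f y) \<and>
      bessel_translation_Lp \<nu> x f \<in> Lp_functions \<nu> p \<and>
      Lp_norm \<nu> p (bessel_translation_Lp \<nu> x f) \<le> Lp_norm \<nu> p f"
  proof (cases "x = 0")
    case True
    thus ?thesis using f by (simp add: bessel_translation_Lp_def[abs_def] bessel_translation_Lp_defined_at_def)
  next
    case False
    interpret symmetric_markov_kernel "bessel_measure \<nu>" "bessel_kernel \<nu> x"
      using False x by (intro bessel_kernel_markov nu) simp
    have T: "bessel_translation_Lp \<nu> x f = apply_kernel f"
      using False by (simp add: bessel_translation_Lp_def apply_kernel_def fun_eq_iff)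
    have def_at: "AE y in bessel_measure \<nu>. bessel_translation_Lp_defined_at \<nu> x f y"
      if "AE y in bessel_measure \<nu>. integrable (bessel_measure \<nu>) (\<lambda>z. f z * complex_of_real (bessel_kernel \<nu> x y z))"
      using that AE_bessel_measure_pos
      by eventually_elim (simp add: bessel_translation_Lp_defined_at_def)
    show ?thesis
    proof (rule ennreal_cases_ge_1[OF p])
      assume p: "p = \<infinity>"
      have "0 \<le> Lp_norm \<nu> \<infinity> f" by (simp add: Lp_norm_def)
      note b = apply_kernel_bounded[OF fm this esssup_Lp_bound[OF f[unfolded p]]]
      have "AE y in bessel_measure \<nu>. norm (apply_kernel f y) \<le> Lp_norm \<nu> \<infinity> f"
        using b by eventually_elim simp
      note c = Lp_infinity_boundedI[OF measurable_apply_kernel[OF fm] \<open>0 \<le> Lp_norm \<nu> \<infinity> f\<close> this]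
      have "AE y in bessel_measure \<nu>. integrable (bessel_measure \<nu>) (\<lambda>z. f z * complex_of_real (bessel_kernel \<nu> x y z))"
        using b by eventually_elim simp
      thus ?thesis unfolding T p using c def_at by blast
    next
      fix r assume r: "p = ennreal r" "r \<ge> 1"
      have fin: "(\<integral>\<^sup>+y. ennreal (norm (f y) powr r) \<partial>bessel_measure \<nu>) < \<infinity>"
        using f r by (simp add: Lp_functions_finite)
      note b = apply_kernel_powr[OF r(2) fm fin]
      have L: "apply_kernel f \<in> Lp_functions \<nu> p"
        unfolding r(1) using r(2) b(2) fin measurable_apply_kernel[OF fm]
        by (subst Lp_functions_finite) (auto intro: le_less_trans)
      have "ennreal (Lp_norm \<nu> p (apply_kernel f) powr r) \<le> ennreal (Lp_norm \<nu> p f powr r)"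
        using b(2) f L r by (simp add: nn_integral_powr_eq_Lp_norm)
      hence "Lp_norm \<nu> p (apply_kernel f) powr r \<le> Lp_norm \<nu> p f powr r"
        by simp
      moreover have "0 \<le> Lp_norm \<nu> p (apply_kernel f)" "0 \<le> Lp_norm \<nu> p f"
        using r by (auto simp: Lp_norm_finite)
      ultimately have "Lp_norm \<nu> p (apply_kernel f) \<le> Lp_norm \<nu> p f"
        using r powr_less_mono2[of r "Lp_norm \<nu> p f" "Lp_norm \<nu> p (apply_kernel f)"] by (force simp: not_less[symmetric])
      thus ?thesis unfolding T using L def_at[OF b(1)] by blast
    qed
  qed
  thus "AE y in bessel_measure \<nu>. bessel_translation_Lp_defined_at \<nu> x f y"
    "bessel_translation_Lp \<nu> x f \<in> Lp_functions \<nu> p"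
    "Lp_norm \<nu> p (bessel_translation_Lp \<nu> x f) \<le> Lp_norm \<nu> p f" by auto
qed

lemma bessel_translation_Lp_diff:
  assumes "bessel_translation_Lp_defined_at \<nu> x f y" "bessel_translation_Lp_defined_at \<nu> x g y"
  shows "bessel_translation_Lp \<nu> x (\<lambda>t. g t - f t) y = bessel_translation_Lp \<nu> x g y - bessel_translation_Lp \<nu> x f y"
  using assms by (auto simp: bessel_translation_Lp_def bessel_translation_Lp_defined_at_def left_diff_distrib)

lemma bessel_translation_0:
  assumes nu: "\<nu> > - 1 / 2" and f: "continuous_on UNIV f" and ev: "even_function f"
  shows "bessel_translation \<nu> 0 f y = f y"
proof -
  have "bessel_translation \<nu> 0 f y = bessel_translation \<nu> 0 (\<lambda>_. f y) y"
  proof -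
    have "f \<bar>y\<bar> = f y" using ev by (auto simp: abs_if even_function_def)
    thus ?thesis by (simp add: bessel_translation_eq_angular[OF nu] f bessel_radius_0)
  qed
  thus ?thesis by (simp add: bessel_translation_const[OF nu])
qed

text \<open>Self-adjointness of the Bessel kernel. For \<open>g\<close> the kernel integral is the angular mean, which is where
  continuity of \<open>g\<close> enters; for \<open>x = 0\<close> both translations are the identity, which uses that \<open>g\<close> is even.\<close>

lemma bessel_translation_duality:
  assumes nu: "\<nu> > - 1 / 2" and x: "x \<ge> 0" and f: "integrable (bessel_measure \<nu>) f"
    and g: "continuous_on UNIV g" and ev: "even_function g" and bdd: "\<And>t. norm (g t) \<le> C"
  shows "integrable (bessel_measure \<nu>) (\<lambda>y. bessel_translation_Lp \<nu> x f y * g y)"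
    and "integrable (bessel_measure \<nu>) (\<lambda>y. f y * bessel_translation \<nu> x g y)"
    and "(LINT y|bessel_measure \<nu>. bessel_translation_Lp \<nu> x f y * g y)
       = (LINT y|bessel_measure \<nu>. f y * bessel_translation \<nu> x g y)"
proof -
  have gm [measurable]: "g \<in> borel_measurable (bessel_measure \<nu>)"
    by (intro borel_measurable_bessel_measure borel_measurable_continuous_onI g)
  have fm [measurable]: "f \<in> borel_measurable (bessel_measure \<nu>)" using f by simp
  have bgm [measurable]: "bessel_translation \<nu> x g \<in> borel_measurable (bessel_measure \<nu>)"
    by (intro borel_measurable_bessel_measure borel_measurable_continuous_onI continuous_on_bessel_translation nu g)
  have "integrable (bessel_measure \<nu>) (\<lambda>y. bessel_translation_Lp \<nu> x f y * g y) \<and>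
     integrable (bessel_measure \<nu>) (\<lambda>y. f y * bessel_translation \<nu> x g y) \<and>
     (LINT y|bessel_measure \<nu>. bessel_translation_Lp \<nu> x f y * g y)
       = (LINT y|bessel_measure \<nu>. f y * bessel_translation \<nu> x g y)"
  proof (cases "x = 0")
    case True
    have "integrable (bessel_measure \<nu>) (\<lambda>y. f y * g y)"
    proof (rule Bochner_Integration.integrable_bound)
      show "integrable (bessel_measure \<nu>) (\<lambda>y. f y * complex_of_real C)" using f by simp
      show "AE y in bessel_measure \<nu>. norm (f y * g y) \<le> norm (f y * complex_of_real C)"
        using bdd order_trans[OF norm_ge_zero bdd] by (intro AE_I2) (simp add: norm_mult mult_left_mono)
    qed measurable
    thus ?thesis using True by (simp add: bessel_translation_Lp_def bessel_translation_0[OF nu g ev])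
  next
    case False
    hence x0: "x > 0" using x by simp
    interpret symmetric_markov_kernel "bessel_measure \<nu>" "bessel_kernel \<nu> x"
      by (intro bessel_kernel_markov nu x0)
    have T: "bessel_translation_Lp \<nu> x f = apply_kernel f"
      using False by (simp add: bessel_translation_Lp_def apply_kernel_def fun_eq_iff)
    have Tg: "AE y in bessel_measure \<nu>. f y * apply_kernel g y = f y * bessel_translation \<nu> x g y"
      using AE_bessel_measure_pos
      by eventually_elim (simp add: apply_kernel_def bessel_kernel_integral(2)[OF nu x0 _ g])
    note d = apply_kernel_duality[OF f gm, of C, OF bdd]
    have [measurable]: "(\<lambda>y. f y * apply_kernel g y) \<in> borel_measurable (bessel_measure \<nu>)"
      using measurable_apply_kernel[OF gm] by measurable
    have "integrable (bessel_measure \<nu>) (\<lambda>y. f y * bessel_translation \<nu> x g y)"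
      using d(2) by (rule integrable_cong_AE_imp) (use Tg in auto)
    moreover have "(LINT y|bessel_measure \<nu>. f y * apply_kernel g y) = (LINT y|bessel_measure \<nu>. f y * bessel_translation \<nu> x g y)"
      using Tg by (intro integral_cong_AE) measurable
    ultimately show ?thesis unfolding T using d by simp
  qed
  thus "integrable (bessel_measure \<nu>) (\<lambda>y. bessel_translation_Lp \<nu> x f y * g y)"
    "integrable (bessel_measure \<nu>) (\<lambda>y. f y * bessel_translation \<nu> x g y)"
    "(LINT y|bessel_measure \<nu>. bessel_translation_Lp \<nu> x f y * g y)
       = (LINT y|bessel_measure \<nu>. f y * bessel_translation \<nu> x g y)" by auto
qed

lemma integrable_indicator_bessel_measure:
  assumes nu: "\<nu> > - 1 / 2" and R: "R \<ge> 0"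
  shows "integrable (bessel_measure \<nu>) (\<lambda>y. indicator {..R} y :: real)"
proof (rule integrableI_bounded)
  show "(\<lambda>y. indicator {..R} y :: real) \<in> borel_measurable (bessel_measure \<nu>)"
    by (intro borel_measurable_bessel_measure) measurable
  have m: "(\<lambda>y. ennreal (norm (indicator {..R} y :: real))) \<in> borel_measurable (lebesgue_on {0..})"
    by (intro measurable_restrict_space1 measurable_completion) measurable
  have "(\<integral>\<^sup>+y. ennreal (norm (indicator {..R} y :: real)) \<partial>bessel_measure \<nu>)
      = (\<integral>\<^sup>+y. ennreal (y powr (2 * \<nu> + 1)) * ennreal (norm (indicator {..R} y :: real)) \<partial>lebesgue_on {0..})"
    unfolding bessel_measure_def by (rule nn_integral_density[OF measurable_powr_lebesgue_on(1) m])
  also have "\<dots> = (\<integral>\<^sup>+y. ennreal (y powr (2 * \<nu> + 1)) * ennreal (norm (indicator {..R} y :: real)) * indicator {0..} y \<partial>lebesgue)"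
    by (rule nn_integral_restrict_space) simp
  also have "\<dots> \<le> (\<integral>\<^sup>+y. ennreal (R powr (2 * \<nu> + 1)) * indicator {0..R} y \<partial>lebesgue)"
    using nu by (intro nn_integral_mono) (auto simp: indicator_def intro!: ennreal_leI powr_mono2)
  also have "\<dots> = ennreal (R powr (2 * \<nu> + 1)) * emeasure lebesgue {0..R}"
    by (rule nn_integral_cmult_indicator) simp
  also have "\<dots> < \<infinity>" using R by (simp add: ennreal_mult_less_top)
  finally show "(\<integral>\<^sup>+y. ennreal (norm (indicator {..R} y :: real)) \<partial>bessel_measure \<nu>) < \<infinity>" .
qed

text \<open>On a bounded interval the measure is finite and \<open>\<bar>f\<bar> \<le> 1 + \<bar>f\<bar>\<^sup>p\<close>, hence truncations are integrable; they
  converge by dominated convergence.\<close>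

lemma Lp_truncation:
  assumes nu: "\<nu> > - 1 / 2" and p: "p \<ge> 1" and f: "f \<in> Lp_functions \<nu> (ennreal p)"
  shows "(\<lambda>s. indicator {..real n} s * f s) \<in> Lp_functions \<nu> (ennreal p) \<inter> Lp_functions \<nu> 1"
    and "(\<lambda>n. Lp_norm \<nu> (ennreal p) (\<lambda>s. f s - indicator {..real n} s * f s)) \<longlonglongrightarrow> 0"
proof -
  note fm [measurable] = Lp_functions_measurable[OF f]
  have im [measurable]: "(\<lambda>y. indicator {..real n} y :: 'b::{real_normed_algebra_1}) \<in> borel_measurable (bessel_measure \<nu>)" for n
    by (intro borel_measurable_bessel_measure) measurable
  have p1: "1 \<le> ennreal p" using p by (simp add: ennreal_1[symmetric] del: ennreal_1)
  have "(\<lambda>s. indicator {..real n} s * f s) \<in> Lp_functions \<nu> (ennreal p)"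
  proof (rule Lp_mono(1)[OF p1 f])
    show "AE s in bessel_measure \<nu>. norm (indicator {..real n} s * f s) \<le> norm (f s)"
      by (intro AE_I2) (simp add: norm_mult indicator_def)
  qed measurable
  moreover have "integrable (bessel_measure \<nu>) (\<lambda>s. indicator {..real n} s * f s)"
  proof (rule Bochner_Integration.integrable_bound)
    show "integrable (bessel_measure \<nu>) (\<lambda>s. indicator {..real n} s + norm (f s) powr p)"
      using f p integrable_indicator_bessel_measure[OF nu, of "real n"] by (simp add: Lp_functions_def)
    show "AE s in bessel_measure \<nu>. norm (indicator {..real n} s * f s) \<le> norm (indicator {..real n} s + norm (f s) powr p)"
    proof (rule AE_I2)
      fix s
      have "norm (f s) \<le> 1 + norm (f s) powr p"
      proof (cases "norm (f s) \<le> 1")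
        case False
        hence "norm (f s) powr 1 \<le> norm (f s) powr p" using p by (intro powr_mono) auto
        thus ?thesis using False by simp
      qed (simp add: add_increasing2)
      thus "norm (indicator {..real n} s * f s) \<le> norm (indicator {..real n} s + norm (f s) powr p)"
        by (simp add: norm_mult indicator_def)
    qed
  qed measurable
  ultimately show "(\<lambda>s. indicator {..real n} s * f s) \<in> Lp_functions \<nu> (ennreal p) \<inter> Lp_functions \<nu> 1"
    by (simp add: Lp_functions_1)
  have "(\<lambda>n. LINT s|bessel_measure \<nu>. norm (f s - indicator {..real n} s * f s) powr p)
      \<longlonglongrightarrow> (LINT s|bessel_measure \<nu>. 0)"
  proof (rule integral_dominated_convergence)
    show "integrable (bessel_measure \<nu>) (\<lambda>s. norm (f s) powr p)"
      using f p by (simp add: Lp_functions_def)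
    show "AE s in bessel_measure \<nu>. norm (norm (f s - indicator {..real n} s * f s) powr p) \<le> norm (f s) powr p" for n
      by (intro AE_I2) (auto simp: indicator_def)
    show "AE s in bessel_measure \<nu>. (\<lambda>n. norm (f s - indicator {..real n} s * f s) powr p) \<longlonglongrightarrow> 0"
    proof (rule AE_I2)
      fix s
      obtain N where N: "s \<le> real N" using real_arch_simple by blast
      have "\<forall>\<^sub>F n in sequentially. norm (f s - indicator {..real n} s * f s) powr p = 0"
        using eventually_ge_at_top[of N] by eventually_elim (use N in \<open>simp add: indicator_def\<close>)
      thus "(\<lambda>n. norm (f s - indicator {..real n} s * f s) powr p) \<longlonglongrightarrow> 0"
        by (rule tendsto_eventually)
    qed
  qed measurable
  hence "(\<lambda>n. (LINT s|bessel_measure \<nu>. norm (f s - indicator {..real n} s * f s) powr p) powr (1 / p)) \<longlonglongrightarrow> 0"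
    using p by (intro tendsto_zero_powrI[where b="1 / p"]) (auto intro!: integral_nonneg_AE always_eventually)
  thus "(\<lambda>n. Lp_norm \<nu> (ennreal p) (\<lambda>s. f s - indicator {..real n} s * f s)) \<longlonglongrightarrow> 0"
    using p by (simp add: Lp_norm_finite)
qed

section \<open>Reduction of the canonical objects to the Bessel translation\<close>

lemma exp_eq_chirp:
  "exp (\<i> / 2 * complex_of_real (\<alpha> * (x\<^sup>2 + y\<^sup>2))) = chirp \<alpha> x * chirp \<alpha> y"
  "exp (- (\<i> / 2) * complex_of_real (\<alpha> * y\<^sup>2)) = chirp (- \<alpha>) y"
  "exp (- \<i> * complex_of_real (\<alpha> * y\<^sup>2)) = chirp (- \<alpha>) y * chirp (- \<alpha>) y"
  "exp (\<i> / 2 * complex_of_real (\<alpha> * y\<^sup>2)) = chirp \<alpha> y"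
  by (simp_all add: chirp_def exp_add[symmetric] algebra_simps)

lemma lct_translation_eq:
  "lct_translation \<nu> m x f y = chirp (m $ 2 $ 2 / m $ 1 $ 2) x * chirp (m $ 2 $ 2 / m $ 1 $ 2) y
     * bessel_translation \<nu> x (\<lambda>s. chirp (- (m $ 2 $ 2 / m $ 1 $ 2)) s * f s) y"
  unfolding lct_translation_def exp_eq_chirp ..

lemma lct_translation_Lp_eq:
  "lct_translation_Lp \<nu> m x f y = chirp (m $ 2 $ 2 / m $ 1 $ 2) x * chirp (m $ 2 $ 2 / m $ 1 $ 2) y
     * bessel_translation_Lp \<nu> x (\<lambda>s. chirp (- (m $ 2 $ 2 / m $ 1 $ 2)) s * f s) y"
  unfolding lct_translation_Lp_def exp_eq_chirp ..

lemma lct_translation_Lp_defined_at_eq: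
  "lct_translation_Lp_defined_at \<nu> m x f y \<longleftrightarrow>
     bessel_translation_Lp_defined_at \<nu> x (\<lambda>s. chirp (- (m $ 2 $ 2 / m $ 1 $ 2)) s * f s) y"
  unfolding lct_translation_Lp_defined_at_def exp_eq_chirp ..

lemma lct_kernel_eq:
  "lct_kernel \<nu> m x y = chirp (m $ 2 $ 2 / m $ 1 $ 2) x * chirp (m $ 1 $ 1 / m $ 1 $ 2) y
     * complex_of_real (normalized_bessel \<nu> (x * y / m $ 1 $ 2))"
proof -
  have "exp (\<i> / 2 * complex_of_real (\<alpha> * x\<^sup>2 + \<beta> * y\<^sup>2)) = chirp \<alpha> x * chirp \<beta> y" for \<alpha> \<beta>
    by (simp add: chirp_def exp_add[symmetric] algebra_simps)
  thus ?thesis by (simp only: lct_kernel_def)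
qed

lemma continuous_on_chirp_mult: "continuous_on UNIV f \<Longrightarrow> continuous_on UNIV (\<lambda>s. chirp \<alpha> s * f s)"
  by (intro continuous_intros continuous_on_chirp)

lemma even_smooth_mult:
  "f \<in> even_smooth_functions \<Longrightarrow> g \<in> even_smooth_functions \<Longrightarrow> (\<lambda>t. f t * g t) \<in> even_smooth_functions"
  by (simp add: even_smooth_functions_iff smooth_mult even_function_def)

lemma even_smooth_chirp: "chirp \<alpha> \<in> even_smooth_functions"
  by (simp add: even_smooth_functions_iff smooth_chirp even_chirp)

lemma even_smooth_const: "(\<lambda>_. c) \<in> even_smooth_functions"
  by (simp add: even_smooth_functions_iff smooth_const even_function_def)

lemma lct_translation_linear:
  assumes nu: "\<nu> > - 1 / 2" and f: "continuous_on UNIV f" and g: "continuous_on UNIV g"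
  shows "lct_translation \<nu> m x (\<lambda>t. l * f t + g t) y = l * lct_translation \<nu> m x f y + lct_translation \<nu> m x g y"
proof -
  have e: "(\<lambda>s. chirp \<alpha> s * (l * f s + g s)) = (\<lambda>s. l * (chirp \<alpha> s * f s) + chirp \<alpha> s * g s)" for \<alpha>
    by (simp add: algebra_simps)
  show ?thesis
    unfolding lct_translation_eq e
      bessel_translation_linear[OF nu continuous_on_chirp_mult[OF f] continuous_on_chirp_mult[OF g]]
    by (simp add: algebra_simps)
qed

lemma lct_translation_diff:
  assumes nu: "\<nu> > - 1 / 2" and f: "continuous_on UNIV f" and g: "continuous_on UNIV g"
  shows "lct_translation \<nu> m x (\<lambda>t. g t - f t) y = lct_translation \<nu> m x g y - lct_translation \<nu> m x f y"
  using lct_translation_linear[OF nu f g, of m x "-1" y] by simp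

lemma continuous_on_lct_translation:
  assumes nu: "\<nu> > - 1 / 2" and f: "continuous_on UNIV f"
  shows "continuous_on UNIV (lct_translation \<nu> m x f)"
  unfolding lct_translation_eq[abs_def]
  by (intro continuous_intros continuous_on_chirp continuous_on_bessel_translation[OF nu] f)

lemma bessel_translation_scale:
  assumes nu: "\<nu> > - 1 / 2" and f: "continuous_on UNIV f"
  shows "bessel_translation \<nu> x (\<lambda>t. c * f t) y = c * bessel_translation \<nu> x f y"
  using bessel_translation_linear[OF nu f continuous_on_const[of UNIV 0], of x c y]
  by (simp add: bessel_translation_const[OF nu])

lemma lct_translation_commute:
  assumes nu: "\<nu> > - 1 / 2" and f: "continuous_on UNIV f"
  shows "lct_translation \<nu> m x (lct_translation \<nu> m y f) = lct_translation \<nu> m y (lct_translation \<nu> m x f)"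
proof
  fix z
  let ?\<alpha> = "m $ 2 $ 2 / m $ 1 $ 2"
  let ?f = "\<lambda>s. chirp (- ?\<alpha>) s * f s"
  note cf = continuous_on_chirp_mult[OF f]
  have two: "lct_translation \<nu> m x (lct_translation \<nu> m y f) z = chirp ?\<alpha> x * chirp ?\<alpha> y * chirp ?\<alpha> z *
      bessel_translation \<nu> x (bessel_translation \<nu> y ?f) z" for x y
  proof -
    have e: "(\<lambda>s. chirp (- ?\<alpha>) s * lct_translation \<nu> m y f s) = (\<lambda>s. chirp ?\<alpha> y * bessel_translation \<nu> y ?f s)"
      by (rule ext) (simp add: lct_translation_eq mult.left_commute)
    show ?thesis
      unfolding lct_translation_eq[of \<nu> m x "lct_translation \<nu> m y f" z] e
        bessel_translation_scale[OF nu continuous_on_bessel_translation[OF nu cf]]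
      by (simp add: mult_ac)
  qed
  show "lct_translation \<nu> m x (lct_translation \<nu> m y f) z = lct_translation \<nu> m y (lct_translation \<nu> m x f) z"
    unfolding two bessel_translation_commute[OF nu cf, of x y] by (simp add: mult_ac)
qed

section \<open>The differential operator\<close>

text \<open>Since \<open>(chirp \<alpha> h)' = t * chirp \<alpha> t * (D h + \<i> \<alpha> h)\<close> with \<open>D h = h' / t\<close>, all terms can be written with \<open>h\<close>
  and its radial derivatives, which also covers \<open>t = 0\<close>. The terms with \<open>\<alpha>\<close> then cancel.\<close>

lemma lct_operator_chirp:
  assumes h: "h \<in> even_smooth_functions"
  shows "lct_operator \<nu> m (\<lambda>t. chirp (m $ 2 $ 2 / m $ 1 $ 2) t * h t) t
    = chirp (m $ 2 $ 2 / m $ 1 $ 2) t * bessel_operator \<nu> h t"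
proof -
  define \<alpha> where "\<alpha> = m $ 2 $ 2 / m $ 1 $ 2"
  have sm: "smooth h" using h by (simp add: even_smooth_functions_iff)
  have smD: "smooth (radial_deriv h)"
    using even_smooth_radial_deriv[OF h] by (simp add: even_smooth_functions_iff)
  let ?q = "\<lambda>t. chirp \<alpha> t * (radial_deriv h t + \<i> * complex_of_real \<alpha> * h t)"
  let ?q' = "\<lambda>t. chirp \<alpha> t * (iter_deriv 1 (radial_deriv h) t + \<i> * complex_of_real \<alpha> * iter_deriv 1 h t)
      + \<i> * complex_of_real \<alpha> * (complex_of_real t * chirp \<alpha> t) * (radial_deriv h t + \<i> * complex_of_real \<alpha> * h t)"
  have d1: "iter_deriv 1 (\<lambda>t. chirp \<alpha> t * h t) = (\<lambda>t. complex_of_real t * ?q t)"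
  proof (rule iter_deriv_1_eqI)
    fix t
    have "chirp \<alpha> t * iter_deriv 1 h t + \<i> * complex_of_real \<alpha> * (complex_of_real t * chirp \<alpha> t) * h t
        = complex_of_real t * ?q t"
      unfolding deriv_eq_radial_deriv[OF h] by (simp add: algebra_simps)
    with has_vector_derivative_mult[OF chirp_deriv smooth_has_deriv[OF sm], of \<alpha> t]
    show "((\<lambda>t. chirp \<alpha> t * h t) has_vector_derivative complex_of_real t * ?q t) (at t)" by simp
  qed
  have dq: "(?q has_vector_derivative ?q' t) (at t)" for t
  proof -
    have "((\<lambda>t. radial_deriv h t + \<i> * complex_of_real \<alpha> * h t) has_vector_derivative
        iter_deriv 1 (radial_deriv h) t + \<i> * complex_of_real \<alpha> * iter_deriv 1 h t) (at t)"
      by (intro has_vector_derivative_add smooth_has_deriv smD has_vector_derivative_mult_right sm)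
    from has_vector_derivative_mult[OF chirp_deriv this] show ?thesis .
  qed
  have d2: "iter_deriv 2 (\<lambda>t. chirp \<alpha> t * h t) = (\<lambda>t. complex_of_real t * ?q' t + 1 * ?q t)"
    unfolding iter_deriv_2 d1
    by (rule iter_deriv_1_eqI) (rule has_vector_derivative_mult[OF has_vector_derivative_complex_of_real dq])
  have dquot: "deriv_quotient (\<lambda>t. chirp \<alpha> t * h t) t = ?q t"
  proof (rule deriv_quotient_eqI)
    show "continuous_on UNIV ?q"
      by (intro continuous_intros continuous_on_chirp smooth_continuous smD sm)
  qed (simp only: d1)
  have h2: "bessel_operator \<nu> h t = complex_of_real (2 * \<nu> + 2) * radial_deriv h t
      + complex_of_real (t\<^sup>2) * radial_deriv (radial_deriv h) t"
    by (simp only: bessel_operator_eq[OF h])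
  have sq: "(m $ 2 $ 2)\<^sup>2 / (m $ 1 $ 2)\<^sup>2 = \<alpha>\<^sup>2" by (simp add: \<alpha>_def power_divide)
  have i2: "\<i> * (\<i> * z) = - z" for z by (simp add: mult.assoc[symmetric])
  show ?thesis
    unfolding lct_operator_def \<alpha>_def[symmetric] d2 dquot d1 h2 sq
      deriv_eq_radial_deriv[OF h] deriv_eq_radial_deriv[OF even_smooth_radial_deriv[OF h]]
    by (simp add: algebra_simps power2_eq_square i2)
qed

lemma bessel_operator_scale:
  assumes h: "h \<in> even_smooth_functions"
  shows "bessel_operator \<nu> (\<lambda>t. c * h t) t = c * bessel_operator \<nu> h t"
proof -
  have sm: "smooth h" using h by (simp add: even_smooth_functions_iff)
  have d1: "iter_deriv 1 (\<lambda>t. c * g t) = (\<lambda>t. c * iter_deriv 1 g t)" if "smooth g" for g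
    by (rule iter_deriv_1_eqI) (intro has_vector_derivative_mult_right smooth_has_deriv that)
  have d2: "iter_deriv 2 (\<lambda>t. c * h t) = (\<lambda>t. c * iter_deriv 2 h t)"
    unfolding iter_deriv_2 d1[OF sm] d1[OF smooth_deriv[OF sm]] ..
  have "radial_deriv (\<lambda>t. c * h t) t = c * radial_deriv h t"
    unfolding radial_deriv_def d2 dilation_mean_def by (simp add: mult.left_commute)
  thus ?thesis unfolding bessel_operator_def d2 by (simp add: algebra_simps)
qed

lemma lct_operator_translation:
  assumes nu: "\<nu> > - 1 / 2" and f: "f \<in> even_smooth_functions"
  shows "lct_operator \<nu> m (lct_translation \<nu> m x f) = lct_translation \<nu> m x (lct_operator \<nu> m f)"
proof
  fix y
  define \<alpha> where "\<alpha> = m $ 2 $ 2 / m $ 1 $ 2"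
  define h where "h = (\<lambda>s. chirp (- \<alpha>) s * f s)"
  have h: "h \<in> even_smooth_functions" unfolding h_def by (intro even_smooth_mult even_smooth_chirp f)
  have Th: "bessel_translation \<nu> x h \<in> even_smooth_functions" by (rule even_smooth_bessel_translation[OF nu h])
  have fh: "f = (\<lambda>t. chirp \<alpha> t * h t)" by (simp add: h_def)
  have T: "lct_translation \<nu> m x f = (\<lambda>t. chirp \<alpha> t * (chirp \<alpha> x * bessel_translation \<nu> x h t))"
    by (rule ext) (simp add: lct_translation_eq \<alpha>_def h_def mult_ac)
  have "lct_operator \<nu> m (lct_translation \<nu> m x f) y
      = chirp \<alpha> y * bessel_operator \<nu> (\<lambda>t. chirp \<alpha> x * bessel_translation \<nu> x h t) y"
    unfolding T \<alpha>_def
    by (rule lct_operator_chirp) (intro even_smooth_mult even_smooth_const Th[unfolded \<alpha>_def])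
  also have "\<dots> = chirp \<alpha> x * chirp \<alpha> y * bessel_translation \<nu> x (bessel_operator \<nu> h) y"
    unfolding bessel_operator_scale[OF Th] bessel_operator_translation[OF nu h] by (simp add: mult_ac)
  also have "bessel_operator \<nu> h = (\<lambda>s. chirp (- \<alpha>) s * lct_operator \<nu> m f s)"
    by (rule ext) (simp add: fh lct_operator_chirp[OF h, of \<nu> m, folded \<alpha>_def])
  finally show "lct_operator \<nu> m (lct_translation \<nu> m x f) y = lct_translation \<nu> m x (lct_operator \<nu> m f) y"
    unfolding lct_translation_eq[of \<nu> m x "lct_operator \<nu> m f"] \<alpha>_def .
qed

section \<open>Continuity on spaces of continuous and smooth functions\<close>

text \<open>The margin in a strict inequality on a compact set; it makes room for the neighbourhoods in the two
  continuity proofs below.\<close>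

lemma compact_gap:
  fixes \<phi> :: "real \<Rightarrow> real"
  assumes "compact K" "continuous_on K \<phi>" "\<forall>t\<in>K. \<phi> t < e"
  obtains \<delta> where "\<delta> > 0" "\<forall>t\<in>K. \<phi> t + \<delta> < e"
proof (cases "K = {}")
  case True
  thus ?thesis using that[of 1] by simp
next
  case False
  then obtain s where s: "s \<in> K" "\<forall>t\<in>K. \<phi> t \<le> \<phi> s"
    using continuous_attains_sup[OF assms(1) _ assms(2)] by blast
  have "\<phi> s < e" using assms(3) s(1) by blast
  hence "\<forall>t\<in>K. \<phi> t + (e - \<phi> s) / 2 < e" using s(2) by (auto simp: field_simps intro: order_le_less_trans)
  thus ?thesis using that[of "(e - \<phi> s) / 2"] \<open>\<phi> s < e\<close> by simp
qed

lemma compact_real_bounded: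
  assumes "compact (K :: real set)"
  obtains R where "R \<ge> 0" "\<forall>t\<in>K. \<bar>t\<bar> \<le> R"
proof -
  obtain B where B: "B > 0" "\<forall>t\<in>K. norm t \<le> B"
    using compact_imp_bounded[OF assms] unfolding bounded_pos by blast
  show ?thesis by (rule that[of B]) (use B in auto)
qed

lemma topspace_cont_topology: "topspace cont_topology = cont_functions"
proof -
  have "\<exists>f K e. cont_functions = {g \<in> cont_functions. \<forall>t\<in>K. dist (g t) (f t) < e} \<and>
      f \<in> cont_functions \<and> compact K \<and> e > (0::real)"
    by (rule exI[of _ "\<lambda>_. 0"], rule exI[of _ "{}"], rule exI[of _ 1]) (simp add: cont_functions_def)
  thus ?thesis unfolding cont_topology_def topology_generated_by_topspace by blast
qed

lemma openin_cont_ball: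
  assumes "f \<in> cont_functions" "compact K" "e > 0"
  shows "openin cont_topology {g \<in> cont_functions. \<forall>t\<in>K. dist (g t) (f t) < e}"
  unfolding cont_topology_def by (rule topology_generated_by_Basis) (use assms in blast)

lemma lct_translation_bound:
  assumes nu: "\<nu> > - 1 / 2" and f: "continuous_on UNIV f" and "0 \<le> C"
    and le: "\<And>t. 0 \<le> t \<Longrightarrow> t \<le> \<bar>x\<bar> + \<bar>y\<bar> \<Longrightarrow> norm (f t) \<le> C"
  shows "norm (lct_translation \<nu> m x f y) \<le> C"
  using bessel_translation_bound[OF nu continuous_on_chirp_mult[OF f] \<open>0 \<le> C\<close>, of x y "- (m $ 2 $ 2 / m $ 1 $ 2)"] le
  by (simp add: lct_translation_eq norm_mult)

lemma continuous_map_cont_topology_lct_translation: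
  assumes nu: "\<nu> > - 1 / 2"
  shows "continuous_map cont_topology cont_topology (lct_translation \<nu> m x)"
proof -
  let ?T = "lct_translation \<nu> m x"
  let ?B = "{{g \<in> cont_functions. \<forall>t\<in>K. dist (g t) (f t) < e} |f K e.
        f \<in> cont_functions \<and> compact K \<and> e > 0}"
  have cT: "?T f \<in> cont_functions" if "f \<in> cont_functions" for f
    using that continuous_on_lct_translation[OF nu] by (simp add: cont_functions_def)
  have "continuous_map cont_topology (topology_generated_by ?B) ?T"
  proof (rule continuous_on_generated_topo)
    have UB: "\<Union> ?B = cont_functions"
      using topspace_cont_topology unfolding cont_topology_def topology_generated_by_topspace .
    show "?T ` topspace cont_topology \<subseteq> \<Union> ?B"
      unfolding UB topspace_cont_topology by (rule image_subsetI) (rule cT)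
    fix U assume "U \<in> ?B"
    then obtain f K e where U: "U = {g \<in> cont_functions. \<forall>t\<in>K. dist (g t) (f t) < e}"
      and f: "f \<in> cont_functions" and K: "compact K" and e: "e > 0" by blast
    show "openin cont_topology (?T -` U \<inter> topspace cont_topology)"
    proof (subst openin_subopen, intro ballI)
      fix h assume "h \<in> ?T -` U \<inter> topspace cont_topology"
      hence h: "h \<in> cont_functions" and hU: "\<forall>t\<in>K. dist (?T h t) (f t) < e"
        unfolding topspace_cont_topology U by auto
      have "continuous_on K (\<lambda>t. dist (?T h t) (f t))"
        using cT[OF h] f unfolding cont_functions_def
        by (intro continuous_on_dist) (auto intro: continuous_on_subset)
      then obtain \<delta> where \<delta>: "\<delta> > 0" "\<forall>t\<in>K. dist (?T h t) (f t) + \<delta> < e"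
        using compact_gap[OF K _ hU] by blast
      obtain R where R: "R \<ge> 0" "\<forall>t\<in>K. \<bar>t\<bar> \<le> R" by (rule compact_real_bounded[OF K])
      let ?V = "{g \<in> cont_functions. \<forall>t\<in>{0..\<bar>x\<bar> + R}. dist (g t) (h t) < \<delta>}"
      have "openin cont_topology ?V" by (intro openin_cont_ball h \<delta>) auto
      moreover have "h \<in> ?V" using h \<delta> by simp
      moreover have "?V \<subseteq> ?T -` U \<inter> topspace cont_topology"
      proof
        fix g assume gV: "g \<in> ?V"
        hence g: "g \<in> cont_functions" by simp
        have ch: "continuous_on UNIV h" and cg: "continuous_on UNIV g"
          using h g by (auto simp: cont_functions_def)
        have "dist (?T g t) (f t) < e" if t: "t \<in> K" for t
        proof -
          have "norm (?T g t - ?T h t) \<le> \<delta>"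
            unfolding lct_translation_diff[OF nu ch cg, symmetric]
          proof (rule lct_translation_bound[OF nu])
            show "continuous_on UNIV (\<lambda>t. g t - h t)" by (intro continuous_intros cg ch)
            fix s assume "0 \<le> s" "s \<le> \<bar>x\<bar> + \<bar>t\<bar>"
            hence "s \<in> {0..\<bar>x\<bar> + R}" using R(2) t by fastforce
            thus "norm (g s - h s) \<le> \<delta>" using gV by (auto simp: dist_norm less_imp_le)
          qed (use \<delta> in simp)
          moreover have "dist (?T g t) (f t) \<le> dist (?T g t) (?T h t) + dist (?T h t) (f t)"
            by (rule dist_triangle)
          ultimately show ?thesis using \<delta>(2)[rule_format, OF t] by (simp add: dist_norm)
        qed
        thus "g \<in> ?T -` U \<inter> topspace cont_topology"
          unfolding topspace_cont_topology U using g cT[OF g] by simp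
      qed
      ultimately show "\<exists>V. openin cont_topology V \<and> h \<in> V \<and> V \<subseteq> ?T -` U \<inter> topspace cont_topology"
        by blast
    qed
  qed
  thus ?thesis unfolding cont_topology_def .
qed

lemma topspace_even_smooth_topology: "topspace even_smooth_topology = even_smooth_functions"
proof -
  have "\<exists>f K k e. even_smooth_functions
        = {g \<in> even_smooth_functions. \<forall>t\<in>K. dist (iter_deriv k g t) (iter_deriv k f t) < e} \<and>
      f \<in> even_smooth_functions \<and> compact K \<and> e > (0::real)"
    by (rule exI[of _ "\<lambda>_. 0"], rule exI[of _ "{}"], rule exI[of _ 0], rule exI[of _ 1])
       (simp add: even_smooth_const)
  thus ?thesis unfolding even_smooth_topology_def topology_generated_by_topspace by blast
qed

lemma openin_even_smooth_ball:
  assumes "f \<in> even_smooth_functions" "compact K" "e > 0"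
  shows "openin even_smooth_topology
    {g \<in> even_smooth_functions. \<forall>t\<in>K. dist (iter_deriv k g t) (iter_deriv k f t) < e}"
  unfolding even_smooth_topology_def by (rule topology_generated_by_Basis) (use assms in blast)

lemma even_smooth_lct_translation:
  assumes nu: "\<nu> > - 1 / 2" and f: "f \<in> even_smooth_functions"
  shows "lct_translation \<nu> m x f \<in> even_smooth_functions"
  unfolding lct_translation_eq[abs_def]
  by (intro even_smooth_mult even_smooth_const even_smooth_chirp even_smooth_bessel_translation[OF nu] f)

text \<open>The estimate for angular averages together with the Leibniz rule for the two chirps.\<close>

lemma lct_translation_deriv_bound:
  assumes nu: "\<nu> > - 1 / 2" and R: "R \<ge> 0"
  obtains L where "L \<ge> 0" "\<And>f C. f \<in> even_smooth_functions \<Longrightarrow> C \<ge> 0 \<Longrightarrow>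
    deriv_bound (2 * n) (R + \<bar>x\<bar>) C f \<Longrightarrow> deriv_bound n R (L * C) (lct_translation \<nu> m x f)"
proof -
  define \<alpha> where "\<alpha> = m $ 2 $ 2 / m $ 1 $ 2"
  obtain A where A: "A \<ge> 0" "deriv_bound (2 * n) (R + \<bar>x\<bar>) A (chirp (- \<alpha>))"
    using smooth_bounded_derivs[OF smooth_chirp] by blast
  obtain B where B: "B \<ge> 0" "deriv_bound n R B (chirp \<alpha>)"
    using smooth_bounded_derivs[OF smooth_chirp] by blast
  obtain K where K: "K \<ge> 0" "\<And>f C. f \<in> even_smooth_functions \<Longrightarrow> C \<ge> 0 \<Longrightarrow>
      deriv_bound (2 * n) (R + \<bar>x\<bar>) C f \<Longrightarrow> deriv_bound n R (K * C) (angular_average \<nu> x 0 f)"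
    using angular_average_deriv_bound[OF nu R, of n x] by blast
  define L where "L = 2 ^ n * ((2 ^ n * (1 * B)) * (K * (2 ^ (2 * n) * A)))"
  show ?thesis
  proof (rule that[of L])
    show "L \<ge> 0" unfolding L_def using A B K by simp
    fix f and C :: real
    assume f: "f \<in> even_smooth_functions" and C: "C \<ge> 0" and b: "deriv_bound (2 * n) (R + \<bar>x\<bar>) C f"
    let ?h = "\<lambda>s. chirp (- \<alpha>) s * f s"
    have h: "?h \<in> even_smooth_functions" by (intro even_smooth_mult even_smooth_chirp f)
    have "deriv_bound n R (K * (2 ^ (2 * n) * (A * C))) (angular_average \<nu> x 0 ?h)"
      using A C by (intro K(2) h deriv_bound_mult b) auto
    hence "deriv_bound n R (2 ^ n * ((2 ^ n * (1 * B)) * (K * (2 ^ (2 * n) * (A * C)))))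
        (\<lambda>y. (chirp \<alpha> x * chirp \<alpha> y) * angular_average \<nu> x 0 ?h y)"
      by (intro deriv_bound_mult deriv_bound_const B) simp
    moreover have "lct_translation \<nu> m x f = (\<lambda>y. (chirp \<alpha> x * chirp \<alpha> y) * angular_average \<nu> x 0 ?h y)"
      unfolding lct_translation_eq[abs_def] \<alpha>_def[symmetric]
        bessel_translation_eq_average[OF nu even_smooth_continuous[OF h]] ..
    ultimately show "deriv_bound n R (L * C) (lct_translation \<nu> m x f)"
      by (simp add: L_def mult_ac)
  qed
qed

text \<open>The translation is linear and maps a seminorm of order \<open>2 k\<close> on \<open>[-R - \<bar>x\<bar>, R + \<bar>x\<bar>]\<close> to one of order \<open>k\<close>
  on \<open>[-R, R]\<close>. A basic neighbourhood of the image thus contains the image of a finite intersection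
  of basic neighbourhoods, one for each order up to \<open>2 k\<close>.\<close>

lemma continuous_map_even_smooth_topology_lct_translation:
  assumes nu: "\<nu> > - 1 / 2"
  shows "continuous_map even_smooth_topology even_smooth_topology (lct_translation \<nu> m x)"
proof -
  let ?T = "lct_translation \<nu> m x"
  let ?B = "{{g \<in> even_smooth_functions. \<forall>t\<in>K. dist (iter_deriv k g t) (iter_deriv k f t) < e} |f K k e.
        f \<in> even_smooth_functions \<and> compact K \<and> e > 0}"
  note eT = even_smooth_lct_translation[OF nu, of _ m x]
  have "continuous_map even_smooth_topology (topology_generated_by ?B) ?T"
  proof (rule continuous_on_generated_topo)
    have UB: "\<Union> ?B = even_smooth_functions"
      using topspace_even_smooth_topology unfolding even_smooth_topology_def topology_generated_by_topspace .
    show "?T ` topspace even_smooth_topology \<subseteq> \<Union> ?B"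
      unfolding UB topspace_even_smooth_topology by (rule image_subsetI) (rule eT)
    fix U assume "U \<in> ?B"
    then obtain f K k e where U: "U = {g \<in> even_smooth_functions. \<forall>t\<in>K. dist (iter_deriv k g t) (iter_deriv k f t) < e}"
      and f: "f \<in> even_smooth_functions" and K: "compact K" and e: "e > 0" by blast
    show "openin even_smooth_topology (?T -` U \<inter> topspace even_smooth_topology)"
    proof (subst openin_subopen, intro ballI)
      fix h assume "h \<in> ?T -` U \<inter> topspace even_smooth_topology"
      hence h: "h \<in> even_smooth_functions" and hU: "\<forall>t\<in>K. dist (iter_deriv k (?T h) t) (iter_deriv k f t) < e"
        unfolding topspace_even_smooth_topology U by auto
      have smooth: "smooth g" if "g \<in> even_smooth_functions" for g
        using that by (simp add: even_smooth_functions_iff)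
      have "continuous_on K (\<lambda>t. dist (iter_deriv k (?T h) t) (iter_deriv k f t))"
        by (intro continuous_on_dist continuous_on_subset[OF smooth_continuous[OF smooth_iter_deriv]] smooth eT h f) auto
      then obtain \<delta> where \<delta>: "\<delta> > 0" "\<forall>t\<in>K. dist (iter_deriv k (?T h) t) (iter_deriv k f t) + \<delta> < e"
        using compact_gap[OF K _ hU] by blast
      obtain R where R: "R \<ge> 0" "\<forall>t\<in>K. \<bar>t\<bar> \<le> R" by (rule compact_real_bounded[OF K])
      obtain L where L: "L \<ge> 0" "\<And>f C. f \<in> even_smooth_functions \<Longrightarrow> C \<ge> 0 \<Longrightarrow>
          deriv_bound (2 * k) (R + \<bar>x\<bar>) C f \<Longrightarrow> deriv_bound k R (L * C) (?T f)"
        using lct_translation_deriv_bound[OF nu R(1), of k x m] by blast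
      \<comment> \<open>\<open>L + 1\<close> instead of \<open>L\<close>, as \<open>L\<close> may be zero\<close>
      define \<eta> where "\<eta> = \<delta> / (L + 1)"
      have \<eta>: "\<eta> > 0" "L * \<eta> \<le> \<delta>" using \<delta>(1) L(1) by (auto simp: \<eta>_def field_simps)
      let ?V = "\<Inter>j\<le>2 * k. {g \<in> even_smooth_functions. \<forall>t\<in>{- (R + \<bar>x\<bar>)..R + \<bar>x\<bar>}. dist (iter_deriv j g t) (iter_deriv j h t) < \<eta>}"
      have "openin even_smooth_topology ?V"
        by (intro openin_Inter) (auto intro!: openin_even_smooth_ball h \<eta>)
      moreover have "h \<in> ?V" using h \<eta> by simp
      moreover have "?V \<subseteq> ?T -` U \<inter> topspace even_smooth_topology"
      proof
        fix g assume gV: "g \<in> ?V"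
        hence g: "g \<in> even_smooth_functions" by auto
        have d: "(\<lambda>t. g t - h t) \<in> even_smooth_functions"
          using g h by (simp add: even_smooth_functions_iff smooth_diff even_function_def)
        have "deriv_bound (2 * k) (R + \<bar>x\<bar>) \<eta> (\<lambda>t. g t - h t)"
          unfolding deriv_bound_iff[OF smooth[OF d]] iter_deriv_diff[OF smooth[OF g] smooth[OF h]]
          using gV by (auto simp: dist_norm abs_le_iff less_imp_le)
        hence "deriv_bound k R (L * \<eta>) (?T (\<lambda>t. g t - h t))" using \<eta>(1) by (intro L(2) d) auto
        moreover have "?T (\<lambda>t. g t - h t) = (\<lambda>t. ?T g t - ?T h t)"
          by (rule ext) (rule lct_translation_diff[OF nu even_smooth_continuous[OF h] even_smooth_continuous[OF g]])
        ultimately have "deriv_bound k R (L * \<eta>) (\<lambda>t. ?T g t - ?T h t)" by simp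
        hence bd: "\<forall>t. \<bar>t\<bar> \<le> R \<longrightarrow> norm (iter_deriv k (?T g) t - iter_deriv k (?T h) t) \<le> L * \<eta>"
          using deriv_bound_iff[OF smooth_diff[OF smooth[OF eT[OF g]] smooth[OF eT[OF h]]]]
          by (simp add: iter_deriv_diff[OF smooth[OF eT[OF g]] smooth[OF eT[OF h]]])
        have "dist (iter_deriv k (?T g) t) (iter_deriv k f t) < e" if t: "t \<in> K" for t
        proof -
          have "dist (iter_deriv k (?T g) t) (iter_deriv k f t)
              \<le> dist (iter_deriv k (?T g) t) (iter_deriv k (?T h) t) + dist (iter_deriv k (?T h) t) (iter_deriv k f t)"
            by (rule dist_triangle)
          moreover have "dist (iter_deriv k (?T g) t) (iter_deriv k (?T h) t) \<le> \<delta>"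
            using bd R(2) t \<eta>(2) unfolding dist_norm by (blast intro: order_trans)
          ultimately show ?thesis using \<delta>(2)[rule_format, OF t] by linarith
        qed
        thus "g \<in> ?T -` U \<inter> topspace even_smooth_topology"
          unfolding topspace_even_smooth_topology U using g eT[OF g] by simp
      qed
      ultimately show "\<exists>V. openin even_smooth_topology V \<and> h \<in> V \<and> V \<subseteq> ?T -` U \<inter> topspace even_smooth_topology"
        by blast
    qed
  qed
  thus ?thesis unfolding even_smooth_topology_def .
qed

section \<open>The canonical translation on Lebesgue spaces\<close>

lemma Lp_chirp_mult:
  assumes p: "1 \<le> p" and f: "f \<in> Lp_functions \<nu> p"
  shows "(\<lambda>s. chirp \<alpha> s * f s) \<in> Lp_functions \<nu> p" "Lp_norm \<nu> p (\<lambda>s. chirp \<alpha> s * f s) \<le> Lp_norm \<nu> p f"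
proof -
  have [measurable]: "chirp \<alpha> \<in> borel_measurable (bessel_measure \<nu>)"
    by (intro borel_measurable_bessel_measure borel_measurable_continuous_onI continuous_on_chirp)
  note [measurable] = Lp_functions_measurable[OF f]
  have "(\<lambda>s. chirp \<alpha> s * f s) \<in> borel_measurable (bessel_measure \<nu>)" by measurable
  from Lp_mono[OF p f this] show "(\<lambda>s. chirp \<alpha> s * f s) \<in> Lp_functions \<nu> p"
    "Lp_norm \<nu> p (\<lambda>s. chirp \<alpha> s * f s) \<le> Lp_norm \<nu> p f" by (simp_all add: norm_mult)
qed

lemma lct_translation_Lp_contraction:
  assumes nu: "\<nu> > - 1 / 2" and p: "1 \<le> p" and x: "x \<ge> 0" and f: "f \<in> Lp_functions \<nu> p"
  shows "AE y in lebesgue_on {0..}. lct_translation_Lp_defined_at \<nu> m x f y"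
    and "lct_translation_Lp \<nu> m x f \<in> Lp_functions \<nu> p"
    and "Lp_norm \<nu> p (lct_translation_Lp \<nu> m x f) \<le> Lp_norm \<nu> p f"
proof -
  define \<alpha> where "\<alpha> = m $ 2 $ 2 / m $ 1 $ 2"
  let ?h = "\<lambda>s. chirp (- \<alpha>) s * f s"
  note h = Lp_chirp_mult[OF p f, of "- \<alpha>"]
  note B = bessel_translation_Lp_contraction[OF nu p x h(1)]
  show "AE y in lebesgue_on {0..}. lct_translation_Lp_defined_at \<nu> m x f y"
    using B(1) unfolding AE_bessel_measure_iff lct_translation_Lp_defined_at_eq \<alpha>_def .
  have e: "lct_translation_Lp \<nu> m x f = (\<lambda>y. chirp \<alpha> x * chirp \<alpha> y * bessel_translation_Lp \<nu> x ?h y)"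
    unfolding lct_translation_Lp_eq[abs_def] \<alpha>_def ..
  have [measurable]: "chirp \<alpha> \<in> borel_measurable (bessel_measure \<nu>)"
    by (intro borel_measurable_bessel_measure borel_measurable_continuous_onI continuous_on_chirp)
  note [measurable] = Lp_functions_measurable[OF B(2)]
  have "(\<lambda>y. chirp \<alpha> x * chirp \<alpha> y * bessel_translation_Lp \<nu> x ?h y) \<in> borel_measurable (bessel_measure \<nu>)"
    by measurable
  note L = Lp_mono[OF p B(2) this]
  show "lct_translation_Lp \<nu> m x f \<in> Lp_functions \<nu> p"
    unfolding e by (rule L) (simp add: norm_mult)
  have "Lp_norm \<nu> p (lct_translation_Lp \<nu> m x f) \<le> Lp_norm \<nu> p (bessel_translation_Lp \<nu> x ?h)"
    unfolding e by (rule L) (simp add: norm_mult)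
  also note B(3)
  also note h(2)
  finally show "Lp_norm \<nu> p (lct_translation_Lp \<nu> m x f) \<le> Lp_norm \<nu> p f" .
qed

lemma lct_translation_Lp_diff:
  assumes "lct_translation_Lp_defined_at \<nu> m x f y" "lct_translation_Lp_defined_at \<nu> m x g y"
  shows "lct_translation_Lp \<nu> m x (\<lambda>t. g t - f t) y = lct_translation_Lp \<nu> m x g y - lct_translation_Lp \<nu> m x f y"
  using bessel_translation_Lp_diff[OF assms[unfolded lct_translation_Lp_defined_at_eq]]
  by (simp add: lct_translation_Lp_eq right_diff_distrib)

lemma lct_translation_Lp_diff_norm:
  assumes nu: "\<nu> > - 1 / 2" and p: "1 \<le> p" and x: "x \<ge> 0"
    and f: "f \<in> Lp_functions \<nu> p" and g: "g \<in> Lp_functions \<nu> p"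
  shows "Lp_norm \<nu> p (\<lambda>t. lct_translation_Lp \<nu> m x g t - lct_translation_Lp \<nu> m x f t)
    \<le> Lp_norm \<nu> p (\<lambda>t. g t - f t)"
proof -
  have d: "(\<lambda>t. g t - f t) \<in> Lp_functions \<nu> p" by (rule Lp_diff[OF p f g])
  note T = lct_translation_Lp_contraction[OF nu p x, of _ m]
  have "AE y in bessel_measure \<nu>. norm (lct_translation_Lp \<nu> m x g y - lct_translation_Lp \<nu> m x f y)
      \<le> norm (lct_translation_Lp \<nu> m x (\<lambda>t. g t - f t) y)"
    unfolding AE_bessel_measure_iff using T(1)[OF f] T(1)[OF g]
    by eventually_elim (simp add: lct_translation_Lp_diff)
  from Lp_mono(2)[OF p T(2)[OF d] _ this]
  have "Lp_norm \<nu> p (\<lambda>t. lct_translation_Lp \<nu> m x g t - lct_translation_Lp \<nu> m x f t)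
      \<le> Lp_norm \<nu> p (lct_translation_Lp \<nu> m x (\<lambda>t. g t - f t))"
    using Lp_functions_measurable[OF Lp_diff[OF p T(2)[OF f] T(2)[OF g]]] by simp
  also have "\<dots> \<le> Lp_norm \<nu> p (\<lambda>t. g t - f t)" by (rule T(3)[OF d])
  finally show ?thesis .
qed

text \<open>The factor \<open>exp (- \<i> \<alpha> y\<^sup>2)\<close> is the square of a chirp: one copy cancels the chirp of the translation, the
  other one is absorbed by the function that is not translated.\<close>

lemma lct_translation_duality:
  fixes m :: "real^2^2"
  assumes nu: "\<nu> > - 1 / 2" and x: "x \<ge> 0" and f: "f \<in> Lp_functions \<nu> 1"
    and g: "g \<in> even_bounded_cont_functions"
  defines "\<alpha> \<equiv> m $ 2 $ 2 / m $ 1 $ 2"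
  shows "integrable (bessel_measure \<nu>) (\<lambda>y. lct_translation_Lp \<nu> m x f y
             * (exp (- \<i> * complex_of_real (\<alpha> * y\<^sup>2)) * g y))"
    and "integrable (bessel_measure \<nu>) (\<lambda>y. (exp (- \<i> * complex_of_real (\<alpha> * y\<^sup>2)) * f y)
             * lct_translation \<nu> m x g y)"
    and "(LINT y|bessel_measure \<nu>. lct_translation_Lp \<nu> m x f y
             * (exp (- \<i> * complex_of_real (\<alpha> * y\<^sup>2)) * g y))
        = (LINT y|bessel_measure \<nu>. (exp (- \<i> * complex_of_real (\<alpha> * y\<^sup>2)) * f y)
             * lct_translation \<nu> m x g y)"
proof -
  let ?f = "\<lambda>s. chirp (- \<alpha>) s * f s"
  let ?g = "\<lambda>s. chirp (- \<alpha>) s * g s"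
  have cg: "continuous_on UNIV g" and eg: "even_function g" and "bounded (range g)"
    using g by (auto simp: even_bounded_cont_functions_def)
  then obtain C where C: "\<And>t. norm (g t) \<le> C" by (auto simp: bounded_iff)
  have hf: "integrable (bessel_measure \<nu>) ?f"
    using Lp_chirp_mult(1)[OF order_refl f] by (simp only: Lp_functions_1)
  have hg: "even_function ?g" using eg even_chirp[of "- \<alpha>"] by (simp add: even_function_def)
  have ng: "norm (?g t) \<le> C" for t using C by (simp add: norm_mult)
  note D = bessel_translation_duality[OF nu x hf continuous_on_chirp_mult[OF cg] hg ng]
  have 1: "lct_translation_Lp \<nu> m x f y * (exp (- \<i> * complex_of_real (\<alpha> * y\<^sup>2)) * g y)
      = chirp \<alpha> x * (bessel_translation_Lp \<nu> x ?f y * ?g y)" for y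
    unfolding lct_translation_Lp_eq \<alpha>_def[symmetric] exp_eq_chirp by (simp add: mult_ac)
  have 2: "(exp (- \<i> * complex_of_real (\<alpha> * y\<^sup>2)) * f y) * lct_translation \<nu> m x g y
      = chirp \<alpha> x * (?f y * bessel_translation \<nu> x ?g y)" for y
    unfolding lct_translation_eq \<alpha>_def[symmetric] exp_eq_chirp by (simp add: mult_ac)
  show "integrable (bessel_measure \<nu>) (\<lambda>y. lct_translation_Lp \<nu> m x f y
             * (exp (- \<i> * complex_of_real (\<alpha> * y\<^sup>2)) * g y))"
    unfolding 1 by (intro integrable_mult_right D)
  show "integrable (bessel_measure \<nu>) (\<lambda>y. (exp (- \<i> * complex_of_real (\<alpha> * y\<^sup>2)) * f y)
             * lct_translation \<nu> m x g y)"
    unfolding 2 by (intro integrable_mult_right D)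
  show "(LINT y|bessel_measure \<nu>. lct_translation_Lp \<nu> m x f y
             * (exp (- \<i> * complex_of_real (\<alpha> * y\<^sup>2)) * g y))
        = (LINT y|bessel_measure \<nu>. (exp (- \<i> * complex_of_real (\<alpha> * y\<^sup>2)) * f y)
             * lct_translation \<nu> m x g y)"
    unfolding 1 2 integral_mult_right_zero D(3) ..
qed

section \<open>The canonical transform of a translate\<close>

text \<open>As a function of its first variable the kernel is a chirp times \<open>j\<^sub>\<nu>\<close>. The chirp is cancelled by the one
  in the translation, and the product formula for \<open>j\<^sub>\<nu>\<close> remains.\<close>

lemma lct_translation_kernel_product:
  assumes nu: "\<nu> > - 1 / 2"
  shows "lct_translation \<nu> m x (\<lambda>t. lct_kernel \<nu> m t y) z
        = exp (- (\<i> / 2) * complex_of_real (m $ 1 $ 1 / m $ 1 $ 2 * y\<^sup>2)) * lct_kernel \<nu> m x y * lct_kernel \<nu> m z y"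
proof -
  define \<alpha> where "\<alpha> = m $ 2 $ 2 / m $ 1 $ 2"
  define \<beta> where "\<beta> = m $ 1 $ 1 / m $ 1 $ 2"
  let ?j = "\<lambda>t. complex_of_real (normalized_bessel \<nu> (y / m $ 1 $ 2 * t))"
  have j: "continuous_on UNIV ?j"
    by (intro continuous_intros continuous_on_UNIV_compose[OF continuous_on_normalized_bessel[OF nu]])
  have k: "lct_kernel \<nu> m t y = chirp \<alpha> t * (chirp \<beta> y * ?j t)" for t
    unfolding lct_kernel_eq \<alpha>_def \<beta>_def by (simp add: mult_ac)
  have "lct_translation \<nu> m x (\<lambda>t. lct_kernel \<nu> m t y) z
      = chirp \<alpha> x * chirp \<alpha> z * bessel_translation \<nu> x (\<lambda>t. chirp \<beta> y * ?j t) z"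
    unfolding lct_translation_eq \<alpha>_def[symmetric] k by simp
  also have "\<dots> = chirp \<alpha> x * chirp \<alpha> z * (chirp \<beta> y * (?j x * ?j z))"
    unfolding bessel_translation_scale[OF nu j] bessel_translation_normalized_bessel[OF nu] by simp
  also have "\<dots> = chirp (- \<beta>) y * lct_kernel \<nu> m x y * lct_kernel \<nu> m z y"
    unfolding k by (simp add: mult_ac)
  finally show ?thesis unfolding exp_eq_chirp \<beta>_def .
qed

lemma matrix_inv_2:
  fixes a b c d :: real
  assumes "a * d - b * c = 1"
  shows "matrix_inv (vector [vector [a, b], vector [c, d]] :: real^2^2)
    = vector [vector [d, - b], vector [- c, a]]"
proof -
  define A :: "real^2^2" where "A = vector [vector [a, b], vector [c, d]]"
  define B :: "real^2^2" where "B = vector [vector [d, - b], vector [- c, a]]"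
  have AB: "A ** B = mat 1" and BA: "B ** A = mat 1"
    using assms unfolding A_def B_def
    by (auto simp: vec_eq_iff matrix_matrix_mult_def mat_def sum_2 forall_2 algebra_simps)
  hence inv: "A ** matrix_inv A = mat 1 \<and> matrix_inv A ** A = mat 1"
    unfolding matrix_inv_def by (rule_tac someI[of _ B]) simp
  have "matrix_inv A = matrix_inv A ** (A ** B)" by (simp add: AB)
  also have "\<dots> = (matrix_inv A ** A) ** B" by (rule matrix_mul_assoc)
  also have "\<dots> = B" using inv by simp
  finally show ?thesis unfolding A_def B_def by simp
qed

text \<open>Duality moves the translation to \<open>j\<^sub>\<nu> (l y / b)\<close>, an even bounded function that is an eigenfunction of
  all translations. The chirps match because the transform has the chirp with parameter \<open>a / b\<close> in
  \<open>y\<close>, and the translation attached to the inverse matrix the one with parameter \<open>- a / b\<close>.\<close>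

lemma lct_transform_translate:
  assumes nu: "\<nu> > - 1 / 2" and m: "m = vector [vector [a, b], vector [c, d]]"
    and m': "m' = vector [vector [d, - b], vector [- c, a]]"
    and f: "f \<in> Lp_functions \<nu> 1" and x: "x \<ge> 0"
  shows "lct_transform \<nu> m (lct_translation_Lp \<nu> m' x f) l
    = exp (\<i> / 2 * complex_of_real (d / b * l\<^sup>2)) * lct_kernel \<nu> m' x l * lct_transform \<nu> m f l"
proof -
  let ?\<beta> = "a / b"
  let ?\<delta> = "d / b"
  let ?f = "\<lambda>s. chirp ?\<beta> s * f s"
  let ?j = "\<lambda>t. complex_of_real (normalized_bessel \<nu> (l / b * t))"
  have j: "continuous_on UNIV ?j"
    by (intro continuous_intros continuous_on_UNIV_compose[OF continuous_on_normalized_bessel[OF nu]])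
  have je: "even_function ?j"
    by (simp add: even_function_def normalized_bessel_minus)
  have jb: "norm (?j t) \<le> 1" for t by (simp add: abs_normalized_bessel_le_1[OF nu])
  have hf: "integrable (bessel_measure \<nu>) ?f"
    using Lp_chirp_mult(1)[OF order_refl f] by (simp only: Lp_functions_1)
  have k: "lct_kernel \<nu> m l y = chirp ?\<delta> l * (chirp ?\<beta> y * ?j y)" for y
    unfolding lct_kernel_eq m by (simp add: mult_ac)
  have k': "lct_kernel \<nu> m' x l = chirp (- ?\<beta>) x * (chirp (- ?\<delta>) l * ?j x)"
    unfolding lct_kernel_eq m' by (simp add: normalized_bessel_minus mult_ac)
  have T: "lct_translation_Lp \<nu> m' x f y = chirp (- ?\<beta>) x * chirp (- ?\<beta>) y * bessel_translation_Lp \<nu> x ?f y" for y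
    unfolding lct_translation_Lp_eq m' by simp
  have "(LINT y|bessel_measure \<nu>. lct_kernel \<nu> m l y * lct_translation_Lp \<nu> m' x f y)
      = (LINT y|bessel_measure \<nu>. chirp ?\<delta> l * chirp (- ?\<beta>) x * (bessel_translation_Lp \<nu> x ?f y * ?j y))"
    unfolding k T by (intro Bochner_Integration.integral_cong refl) (simp add: mult_ac)
  also have "\<dots> = chirp ?\<delta> l * chirp (- ?\<beta>) x * (LINT y|bessel_measure \<nu>. ?f y * bessel_translation \<nu> x ?j y)"
    unfolding integral_mult_right_zero bessel_translation_duality(3)[OF nu x hf j je jb] ..
  also have "(LINT y|bessel_measure \<nu>. ?f y * bessel_translation \<nu> x ?j y)
      = (LINT y|bessel_measure \<nu>. ?j x * chirp (- ?\<delta>) l * (lct_kernel \<nu> m l y * f y))"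
    unfolding bessel_translation_normalized_bessel[OF nu] k
    by (intro Bochner_Integration.integral_cong refl) (simp add: mult_ac)
  also have "\<dots> = ?j x * chirp (- ?\<delta>) l * (LINT y|bessel_measure \<nu>. lct_kernel \<nu> m l y * f y)"
    by (rule integral_mult_right_zero)
  finally have "(LINT y|bessel_measure \<nu>. lct_kernel \<nu> m l y * lct_translation_Lp \<nu> m' x f y)
      = chirp ?\<delta> l * lct_kernel \<nu> m' x l * (LINT y|bessel_measure \<nu>. lct_kernel \<nu> m l y * f y)"
    unfolding k' by (simp add: mult_ac)
  thus ?thesis unfolding lct_transform_def exp_eq_chirp by (simp add: mult_ac)
qed

text \<open>The truncations \<open>f'\<^sub>n\<close> of \<open>f\<close> are integrable, so that the identity holds for them. In the difference \<open>D\<close> of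
  the two sides for \<open>f\<close>, the function \<open>f\<close> can be replaced by \<open>f - f'\<^sub>n\<close>. The norm of this function tends to
  zero, the translation is a contraction, \<open>F\<close> is bounded and the multiplier \<open>\<phi>\<close> has modulus at most one.\<close>

lemma lct_transform_extension_translate:
  assumes nu: "\<nu> > - 1 / 2" and m: "m = vector [vector [a, b], vector [c, d]]"
    and m': "m' = vector [vector [d, - b], vector [- c, a]]"
    and p: "1 < p" and pq: "1 / p + 1 / q = 1" and F: "lct_transform_extension \<nu> m p q F"
    and f: "f \<in> Lp_functions \<nu> (ennreal p)" and x: "x \<ge> 0"
  shows "AE l in lebesgue_on {0..}. F (lct_translation_Lp \<nu> m' x f) l
    = exp (\<i> / 2 * complex_of_real (d / b * l\<^sup>2)) * lct_kernel \<nu> m' x l * F f l"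
proof -
  let ?M = "bessel_measure \<nu>"
  let ?P = "Lp_functions \<nu> (ennreal p)"
  let ?Q = "Lp_functions \<nu> (ennreal q)"
  let ?np = "Lp_norm \<nu> (ennreal p)"
  let ?nq = "Lp_norm \<nu> (ennreal q)"
  let ?T = "lct_translation_Lp \<nu> m' x"
  have p1: "1 \<le> ennreal p" using p by (simp add: ennreal_1[symmetric] del: ennreal_1)
  have q: "q > 1"
  proof -
    have "1 / q = 1 - 1 / p" using pq by simp
    moreover have "0 < 1 - 1 / p" "1 - 1 / p < 1" using p by auto
    ultimately have "0 < 1 / q" "1 / q < 1" by auto
    thus ?thesis by (simp add: divide_less_eq_1 split: if_splits)
  qed
  define \<phi> where "\<phi> = (\<lambda>l. exp (\<i> / 2 * complex_of_real (d / b * l\<^sup>2)) * lct_kernel \<nu> m' x l)"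
  have \<phi>1: "norm (\<phi> l) \<le> 1" for l
    unfolding \<phi>_def exp_eq_chirp lct_kernel_eq by (simp add: norm_mult abs_normalized_bessel_le_1[OF nu])
  have F_in: "F g \<in> ?Q" if "g \<in> ?P" for g
    using F that unfolding lct_transform_extension_def by blast
  have F_lin: "AE t in ?M. F (\<lambda>s. \<alpha> * f s + g s) t = \<alpha> * F f t + F g t" if "f \<in> ?P" "g \<in> ?P" for f g \<alpha>
    using F that unfolding lct_transform_extension_def AE_bessel_measure_iff by blast
  have F_L1: "AE t in ?M. F g t = lct_transform \<nu> m g t" if "g \<in> Lp_functions \<nu> 1 \<inter> ?P" for g
    using F that unfolding lct_transform_extension_def AE_bessel_measure_iff by blast
  obtain C where C: "\<And>g. g \<in> ?P \<Longrightarrow> ?nq (F g) \<le> C * ?np g"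
    using F unfolding lct_transform_extension_def by blast
  have T_in: "?T g \<in> ?P" if "g \<in> ?P" for g
    by (rule lct_translation_Lp_contraction(2)[OF nu p1 x that])
  \<comment> \<open>to be shown: \<open>D\<close> vanishes almost everywhere\<close>
  define D where "D = (\<lambda>l. F (?T f) l - \<phi> l * F f l)"
  define f' where "f' = (\<lambda>n s. indicator {..real n} s * f s)"
  define \<epsilon> where "\<epsilon> = (\<lambda>n. ?np (\<lambda>s. f s - f' n s))"
  have f'_in: "f' n \<in> ?P \<inter> Lp_functions \<nu> 1" for n
    unfolding f'_def by (rule Lp_truncation(1)[OF nu _ f]) (use p in simp)
  have \<epsilon>_lim: "\<epsilon> \<longlonglongrightarrow> 0"
    unfolding \<epsilon>_def f'_def by (rule Lp_truncation(2)[OF nu _ f]) (use p in simp)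
  have \<epsilon>_nonneg: "\<epsilon> n \<ge> 0" for n unfolding \<epsilon>_def using p by (simp add: Lp_norm_finite)
  have bound: "(\<integral>\<^sup>+l. ennreal (norm (D l) powr q) \<partial>?M) \<le> ennreal (2 powr q * (2 * (\<bar>C\<bar> * \<epsilon> n) powr q))" for n
  proof -
    let ?r = "\<lambda>s. f s - f' n s"
    let ?h = "\<lambda>s. ?T f s - ?T (f' n) s"
    have r: "?r \<in> ?P" using Lp_diff[OF p1 _ f] f'_in by blast
    have h: "?h \<in> ?P" using Lp_diff[OF p1 T_in T_in[OF f]] f'_in by blast
    have hr: "?np ?h \<le> \<epsilon> n"
      unfolding \<epsilon>_def using f'_in by (intro lct_translation_Lp_diff_norm[OF nu p1 x _ f]) blast
    have small: "(\<integral>\<^sup>+l. ennreal (norm (F g l) powr q) \<partial>?M) \<le> ennreal ((\<bar>C\<bar> * \<epsilon> n) powr q)"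
      if g: "g \<in> ?P" "?np g \<le> \<epsilon> n" for g
    proof -
      have nn: "0 \<le> ?np g" "0 \<le> ?nq (F g)" using p q by (auto simp: Lp_norm_finite)
      have "?nq (F g) \<le> \<bar>C\<bar> * ?np g"
        using C[OF g(1)] mult_right_mono[OF abs_ge_self nn(1), of C] by linarith
      also have "\<dots> \<le> \<bar>C\<bar> * \<epsilon> n" using g(2) by (intro mult_left_mono) auto
      finally have "?nq (F g) powr q \<le> (\<bar>C\<bar> * \<epsilon> n) powr q" using nn q by (intro powr_mono2) auto
      thus ?thesis using q nn_integral_powr_eq_Lp_norm[OF _ F_in[OF g(1)]] by (simp add: ennreal_leI)
    qed
    have "AE l in ?M. D l = F ?h l - \<phi> l * F ?r l"
    proof -
      \<comment> \<open>brings the additivity of \<open>F\<close> with scalar \<open>-1\<close> into the form of a difference\<close>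
      have e: "(\<lambda>s. - 1 * u s + v s) = (\<lambda>s. v s - u s)" for u v :: "real \<Rightarrow> complex" by auto
      have "AE l in ?M. F ?h l = - 1 * F (?T (f' n)) l + F (?T f) l"
        using F_lin[OF T_in T_in[OF f], of "f' n" "-1"] f'_in unfolding e by blast
      moreover have "AE l in ?M. F ?r l = - 1 * F (f' n) l + F f l"
        using F_lin[OF _ f, of "f' n" "-1"] f'_in unfolding e by blast
      moreover have "AE l in ?M. F (f' n) l = lct_transform \<nu> m (f' n) l"
        using F_L1[of "f' n"] f'_in by blast
      moreover have "AE l in ?M. F (?T (f' n)) l = lct_transform \<nu> m (?T (f' n)) l"
        using F_L1[of "?T (f' n)"] f'_in T_in lct_translation_Lp_contraction(2)[OF nu order_refl x] by blast
      ultimately show ?thesis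
      proof eventually_elim
        case (elim l)
        have tr: "lct_transform \<nu> m (?T (f' n)) l = \<phi> l * lct_transform \<nu> m (f' n) l"
          unfolding \<phi>_def using f'_in by (intro lct_transform_translate[OF nu m m' _ x]) blast
        have 1: "F (?T f) l = \<phi> l * lct_transform \<nu> m (f' n) l + F ?h l"
          using elim(1,4) tr by simp
        have 2: "F f l = lct_transform \<nu> m (f' n) l + F ?r l"
          using elim(2,3) by simp
        show ?case unfolding D_def 1 2 by (simp add: algebra_simps)
      qed
    qed
    hence le: "AE l in ?M. norm (D l) \<le> norm (F ?h l) + norm (F ?r l)"
    proof eventually_elim
      case (elim l)
      have "norm (D l) \<le> norm (F ?h l) + norm (\<phi> l * F ?r l)" unfolding elim by (rule norm_triangle_ineq4)
      also have "norm (\<phi> l * F ?r l) \<le> 1 * norm (F ?r l)"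
        unfolding norm_mult by (intro mult_right_mono \<phi>1) auto
      finally show ?case by simp
    qed
    have "(\<integral>\<^sup>+l. ennreal (norm (D l) powr q) \<partial>?M) \<le> ennreal (2 powr q) *
        ((\<integral>\<^sup>+l. ennreal (norm (F ?h l) powr q) \<partial>?M) + (\<integral>\<^sup>+l. ennreal (norm (F ?r l) powr q) \<partial>?M))"
      using q le by (intro nn_integral_powr_add_le Lp_functions_measurable[OF F_in] h r) auto
    also have "\<dots> \<le> ennreal (2 powr q) * (ennreal ((\<bar>C\<bar> * \<epsilon> n) powr q) + ennreal ((\<bar>C\<bar> * \<epsilon> n) powr q))"
      by (intro mult_left_mono add_mono small h r hr) (auto simp: \<epsilon>_def)
    also have "\<dots> = ennreal (2 powr q * (2 * (\<bar>C\<bar> * \<epsilon> n) powr q))"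
      by (simp add: ennreal_mult'[symmetric] ennreal_plus[symmetric] del: ennreal_plus)
    finally show ?thesis .
  qed
  have "(\<lambda>n. 2 powr q * (2 * (\<bar>C\<bar> * \<epsilon> n) powr q)) \<longlonglongrightarrow> 2 powr q * (2 * 0)"
    using q \<epsilon>_nonneg tendsto_mult[OF tendsto_const[of "\<bar>C\<bar>"] \<epsilon>_lim]
    by (intro tendsto_mult tendsto_const tendsto_zero_powrI[where b=q]) auto
  hence "(\<lambda>n. ennreal (2 powr q * (2 * (\<bar>C\<bar> * \<epsilon> n) powr q))) \<longlonglongrightarrow> ennreal (2 powr q * (2 * 0))"
    by (rule tendsto_ennrealI)
  hence "(\<integral>\<^sup>+l. ennreal (norm (D l) powr q) \<partial>?M) \<le> ennreal (2 powr q * (2 * 0))"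
    using bound by (intro LIMSEQ_le_const) auto
  hence z: "(\<integral>\<^sup>+l. ennreal (norm (D l) powr q) \<partial>?M) = 0" by simp
  have "\<phi> \<in> borel_measurable borel"
    unfolding \<phi>_def exp_eq_chirp lct_kernel_eq divide_inverse
    by (intro borel_measurable_continuous_onI continuous_intros continuous_on_chirp
        continuous_on_UNIV_compose[OF continuous_on_normalized_bessel[OF nu]])
  hence [measurable]: "\<phi> \<in> borel_measurable ?M" by (rule borel_measurable_bessel_measure)
  note [measurable] = Lp_functions_measurable[OF F_in[OF f]] Lp_functions_measurable[OF F_in[OF T_in[OF f]]]
  have "D \<in> borel_measurable ?M" unfolding D_def by measurable
  hence "AE l in ?M. ennreal (norm (D l) powr q) = 0"
    using z by (subst (asm) nn_integral_0_iff_AE) auto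
  hence "AE l in ?M. F (?T f) l = \<phi> l * F f l"
    by eventually_elim (auto simp: D_def)
  thus ?thesis unfolding AE_bessel_measure_iff \<phi>_def .
qed

lemma lct_translation_support:
  assumes nu: "\<nu> > - 1 / 2" and f: "continuous_on UNIV f" and x: "x \<ge> 0" and y: "y \<ge> 0"
    and zero: "\<And>t. t \<ge> r \<Longrightarrow> f t = 0" and xy: "\<bar>x - y\<bar> \<ge> r"
  shows "lct_translation \<nu> m x f y = 0"
proof -
  have "f (bessel_radius x y \<theta>) = 0" for \<theta>
    using bessel_radius_ge[OF x y, of \<theta>] xy by (intro zero) simp
  thus ?thesis
    by (simp add: lct_translation_eq bessel_translation_eq_angular[OF nu continuous_on_chirp_mult[OF f]])
qed

lemma lct_translation_kernel_formula:
  fixes m :: "real^2^2"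
  assumes nu: "\<nu> > - 1 / 2" and f: "continuous_on UNIV f" and x: "x > 0" and y: "y > 0"
  defines "\<alpha> \<equiv> m $ 2 $ 2 / m $ 1 $ 2"
  shows "integrable (bessel_measure \<nu>) (\<lambda>z. exp (- \<i> * complex_of_real (\<alpha> * z\<^sup>2)) * f z
             * lct_translation_kernel \<nu> m x y z)"
    and "lct_translation \<nu> m x f y
        = (LINT z|bessel_measure \<nu>. exp (- \<i> * complex_of_real (\<alpha> * z\<^sup>2)) * f z
             * lct_translation_kernel \<nu> m x y z)"
proof -
  note B = bessel_kernel_integral[OF nu x y continuous_on_chirp_mult[OF f, of "- \<alpha>"]]
  have "exp (\<i> / 2 * complex_of_real (\<alpha> * (x\<^sup>2 + y\<^sup>2 + z\<^sup>2))) = chirp \<alpha> x * chirp \<alpha> y * chirp \<alpha> z" for z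
    by (simp add: chirp_def exp_add[symmetric] algebra_simps)
  hence e: "exp (- \<i> * complex_of_real (\<alpha> * z\<^sup>2)) * f z * lct_translation_kernel \<nu> m x y z
      = chirp \<alpha> x * chirp \<alpha> y * (chirp (- \<alpha>) z * f z * complex_of_real (bessel_kernel \<nu> x y z))" for z
    unfolding lct_translation_kernel_def \<alpha>_def[symmetric] exp_eq_chirp by (simp add: mult_ac)
  show "integrable (bessel_measure \<nu>) (\<lambda>z. exp (- \<i> * complex_of_real (\<alpha> * z\<^sup>2)) * f z
             * lct_translation_kernel \<nu> m x y z)"
    unfolding e by (intro integrable_mult_right B)
  show "lct_translation \<nu> m x f y = (LINT z|bessel_measure \<nu>. exp (- \<i> * complex_of_real (\<alpha> * z\<^sup>2)) * f z
             * lct_translation_kernel \<nu> m x y z)"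
    unfolding e integral_mult_right_zero B(2) lct_translation_eq \<alpha>_def[symmetric] ..
qed

lemma lct_translation_0:
  assumes nu: "\<nu> > - 1 / 2" and f: "continuous_on UNIV f" and ev: "even_function f"
  shows "lct_translation \<nu> m 0 f = f"
proof
  fix y
  have "even_function (\<lambda>s. chirp \<alpha> s * f s)" for \<alpha>
    using ev even_chirp[of \<alpha>] by (simp add: even_function_def)
  thus "lct_translation \<nu> m 0 f y = f y"
    unfolding lct_translation_eq by (subst bessel_translation_0[OF nu continuous_on_chirp_mult[OF f]]) (auto simp: chirp_def[of _ 0])
qed

lemma lct_translation_symmetric: "lct_translation \<nu> m x f y = lct_translation \<nu> m y f x"
  by (simp add: lct_translation_eq bessel_translation_def add.commute mult_ac)

theorem proposition3p3:
  fixes \<nu> a b c d :: real and m :: "real^2^2"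
  assumes nu: "\<nu> > - 1 / 2"
    and m: "m = vector [vector [a, b], vector [c, d]]"
    and SL2: "det m = 1"
    and b: "b \<noteq> 0"
  shows
    \<comment> \<open>1) Symmetry\<close>
    "(\<forall>f. continuous_on UNIV f \<and> even_function f \<longrightarrow>
        lct_translation \<nu> m 0 f = f \<and>
        (\<forall>x y. lct_translation \<nu> m x f y = lct_translation \<nu> m y f x)) \<and>
    \<comment> \<open>2) Linearity\<close>
     (\<forall>f\<in>cont_functions. \<forall>g\<in>cont_functions. \<forall>l x y.
        lct_translation \<nu> m x (\<lambda>t. l * f t + g t) y
          = l * lct_translation \<nu> m x f y + lct_translation \<nu> m x g y) \<and>
    \<comment> \<open>3) Compact support\<close>
     (\<forall>f\<in>cont_functions. \<forall>r>0. \<forall>x\<ge>0. (\<forall>y\<ge>r. f y = 0) \<longrightarrow>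
        (\<forall>y\<ge>0. \<bar>x - y\<bar> \<ge> r \<longrightarrow> lct_translation \<nu> m x f y = 0)) \<and>
    \<comment> \<open>4) Product formula\<close>
     (\<forall>x y z. lct_translation \<nu> m x (\<lambda>t. lct_kernel \<nu> m t y) z
        = exp (- (\<i> / 2) * complex_of_real (a / b * y\<^sup>2))
            * lct_kernel \<nu> m x y * lct_kernel \<nu> m z y) \<and>
    \<comment> \<open>5) Kernel formula\<close>
     (\<forall>x>0. \<forall>y>0. \<forall>f\<in>cont_functions.
        integrable (bessel_measure \<nu>) (\<lambda>z. exp (- \<i> * complex_of_real (d / b * z\<^sup>2)) * f z
             * lct_translation_kernel \<nu> m x y z) \<and>
        lct_translation \<nu> m x f y
        = (LINT z|bessel_measure \<nu>. exp (- \<i> * complex_of_real (d / b * z\<^sup>2)) * f z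
             * lct_translation_kernel \<nu> m x y z)) \<and>
    \<comment> \<open>6) Continuity\<close>
     (\<forall>x. continuous_map cont_topology cont_topology (lct_translation \<nu> m x)) \<and>
     (\<forall>x. continuous_map even_smooth_topology even_smooth_topology (lct_translation \<nu> m x)) \<and>
     (\<forall>p\<ge>1. \<forall>x\<ge>0.
        (\<forall>f\<in>Lp_functions \<nu> p.
           (AE y in lebesgue_on {0..}. lct_translation_Lp_defined_at \<nu> m x f y) \<and>
           lct_translation_Lp \<nu> m x f \<in> Lp_functions \<nu> p \<and>
           Lp_norm \<nu> p (lct_translation_Lp \<nu> m x f) \<le> Lp_norm \<nu> p f) \<and>
        (\<forall>f\<in>Lp_functions \<nu> p. \<forall>e>0. \<exists>\<delta>>0. \<forall>g\<in>Lp_functions \<nu> p.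
           Lp_norm \<nu> p (\<lambda>t. g t - f t) < \<delta> \<longrightarrow>
           Lp_norm \<nu> p (\<lambda>t. lct_translation_Lp \<nu> m x g t - lct_translation_Lp \<nu> m x f t) < e)) \<and>
    \<comment> \<open>7) Commutativity\<close>
     (\<forall>f\<in>cont_functions. \<forall>x y.
        lct_translation \<nu> m x (lct_translation \<nu> m y f)
          = lct_translation \<nu> m y (lct_translation \<nu> m x f)) \<and>
     (\<forall>f\<in>even_smooth_functions. \<forall>x.
        lct_operator \<nu> m (lct_translation \<nu> m x f)
          = lct_translation \<nu> m x (lct_operator \<nu> m f)) \<and>
    \<comment> \<open>8) Duality\<close>
     (\<forall>f\<in>Lp_functions \<nu> 1. \<forall>g\<in>even_bounded_cont_functions. \<forall>x\<ge>0.
        integrable (bessel_measure \<nu>) (\<lambda>y. lct_translation_Lp \<nu> m x f y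
             * (exp (- \<i> * complex_of_real (d / b * y\<^sup>2)) * g y)) \<and>
        integrable (bessel_measure \<nu>) (\<lambda>y. (exp (- \<i> * complex_of_real (d / b * y\<^sup>2)) * f y)
             * lct_translation \<nu> m x g y) \<and>
        (LINT y|bessel_measure \<nu>. lct_translation_Lp \<nu> m x f y
             * (exp (- \<i> * complex_of_real (d / b * y\<^sup>2)) * g y))
        = (LINT y|bessel_measure \<nu>. (exp (- \<i> * complex_of_real (d / b * y\<^sup>2)) * f y)
             * lct_translation \<nu> m x g y)) \<and>
    \<comment> \<open>9) Transform of a translate, integrable functions\<close>
     (\<forall>f\<in>Lp_functions \<nu> 1. \<forall>x\<ge>0. \<forall>l.
        lct_transform \<nu> m (lct_translation_Lp \<nu> (matrix_inv m) x f) l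
        = exp (\<i> / 2 * complex_of_real (d / b * l\<^sup>2))
            * lct_kernel \<nu> (matrix_inv m) x l * lct_transform \<nu> m f l) \<and>
    \<comment> \<open>10) Transform of a translate; \<open>F\<close> is the transform on the Lebesgue space with exponent \<open>p\<close>\<close>
     (\<forall>p q F. 1 < p \<and> p \<le> 2 \<and> 1 / p + 1 / q = 1 \<and> lct_transform_extension \<nu> m p q F \<longrightarrow>
        (\<forall>f\<in>Lp_functions \<nu> (ennreal p). \<forall>x\<ge>0.
           AE l in lebesgue_on {0..}.
             F (lct_translation_Lp \<nu> (matrix_inv m) x f) l
             = exp (\<i> / 2 * complex_of_real (d / b * l\<^sup>2))
                 * lct_kernel \<nu> (matrix_inv m) x l * F f l))"
proof -
  have m11: "m $ 1 $ 1 = a" and m12: "m $ 1 $ 2 = b" and m22: "m $ 2 $ 2 = d"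
    unfolding m by simp_all
  have "a * d - b * c = 1" using SL2 unfolding det_2 by (simp add: m)
  hence inv: "matrix_inv m = vector [vector [d, - b], vector [- c, a]]"
    unfolding m by (rule matrix_inv_2)
  show ?thesis
    apply (intro conjI)
    subgoal using lct_translation_0[OF nu] lct_translation_symmetric by blast
    subgoal unfolding cont_functions_def using lct_translation_linear[OF nu] by blast
    subgoal unfolding cont_functions_def using lct_translation_support[OF nu] by blast
    subgoal using lct_translation_kernel_product[OF nu, of m] unfolding m11 m12 by blast
    subgoal unfolding cont_functions_def
      using lct_translation_kernel_formula[OF nu, where m=m, unfolded m12 m22] by blast
    subgoal using continuous_map_cont_topology_lct_translation[OF nu] by blast
    subgoal using continuous_map_even_smooth_topology_lct_translation[OF nu] by blast
    subgoal
    proof (intro allI impI conjI ballI)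
      fix p and x :: real and f assume p: "(1::ennreal) \<le> p" and x: "0 \<le> x" and f: "f \<in> Lp_functions \<nu> p"
      note T = lct_translation_Lp_contraction[OF nu p x f, of m]
      show "AE y in lebesgue_on {0..}. lct_translation_Lp_defined_at \<nu> m x f y" by (rule T)
      show "lct_translation_Lp \<nu> m x f \<in> Lp_functions \<nu> p" by (rule T)
      show "Lp_norm \<nu> p (lct_translation_Lp \<nu> m x f) \<le> Lp_norm \<nu> p f" by (rule T)
      fix e :: real assume e: "e > 0"
      show "\<exists>\<delta>>0. \<forall>g\<in>Lp_functions \<nu> p. Lp_norm \<nu> p (\<lambda>t. g t - f t) < \<delta> \<longrightarrow>
           Lp_norm \<nu> p (\<lambda>t. lct_translation_Lp \<nu> m x g t - lct_translation_Lp \<nu> m x f t) < e"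
        using e lct_translation_Lp_diff_norm[OF nu p x f, of _ m] by (intro exI[of _ e]) force
    qed
    subgoal unfolding cont_functions_def using lct_translation_commute[OF nu] by blast
    subgoal using lct_operator_translation[OF nu] by blast
    subgoal using lct_translation_duality[OF nu, where m=m, unfolded m12 m22] by blast
    subgoal using lct_transform_translate[OF nu m inv] by blast
    subgoal using lct_transform_extension_translate[OF nu m inv] by blast
    done
qed

end
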